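(* Let $\mathcal K=\langle\mathcal F,\delta\rangle$ be a differentially closed field of characteristic zero, where $\mathcal F=\langle F,+,\cdot\rangle$ is the underlying algebraically closed field, and let $C=\ker(\delta)$ be its field of constants. Let $X\subseteq F^n$ be a set definable in the pair $\mathcal M=\langle\mathcal F,C\rangle$. Then $\dim_2(X)=\delta\text{-}\dim(X)$.
   Context: Definability is with parameters. $\dim_2$: let $\mathcal M^*=\langle\mathcal F^*,C^*\rangle$ be an $|F|^+$-saturated elementary extension of $\mathcal M$; for $A\subseteq F^*$ let $\operatorname{cl}_F(A)=\operatorname{acl}(A\cup F\cup C^* )$, the field-theoretic algebraic closure in $F^*$; this is a pregeometry, and for nonempty $X$ definable in $\mathcal M$, $\dim_2(X)=\max_{a\in X(F^* )}\operatorname{cl}_F\text{-}\dim(a)$ (size of a maximal independent subtuple), with $\dim_2(\emptyset)=-\infty$. $\delta$-dimension: for an $|F|^+$-saturated elementary extension $\mathcal K^*=\langle\mathcal F^*,\delta\rangle$ of $\mathcal K$ and nonempty $X$ definable in $\mathcal K$, $\delta\text{-}\dim(X)$ is the maximum over $a\in X(F^* )$ of the differential transcendence degree of $a$ over $F$, with $\delta\text{-}\dim(\emptyset)=-\infty$. *)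

theory Defs
  imports Complex_Main "HOL-Library.Extended_Real" "HOL-Library.Poly_Mapping"
    "HOL-Computational_Algebra.Polynomial"
begin

text \<open>Terms of the language of (differential) rings, with parameters of type 'p.
  The constructor Der is the derivation symbol (only in the language of K).\<close>
datatype 'p tm = Var nat | Par 'p | Zero | One | Add "'p tm" "'p tm"
  | Mul "'p tm" "'p tm" | Neg "'p tm" | Der "'p tm"

text \<open>Formulas; Pc is the unary predicate symbol for the constants C
  (only in the language of the pair M).\<close>
datatype 'p fm = Eq "'p tm" "'p tm" | Pc "'p tm" | Not "'p fm"
  | Conj "'p fm" "'p fm" | Ex nat "'p fm"

primrec eval_tm :: "('b::field \<Rightarrow> 'b) \<Rightarrow> ('p \<Rightarrow> 'b) \<Rightarrow> (nat \<Rightarrow> 'b) \<Rightarrow> 'p tm \<Rightarrow> 'b" where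
  "eval_tm D par v (Var i) = v i"
| "eval_tm D par v (Par p) = par p"
| "eval_tm D par v Zero = 0"
| "eval_tm D par v One = 1"
| "eval_tm D par v (Add s t) = eval_tm D par v s + eval_tm D par v t"
| "eval_tm D par v (Mul s t) = eval_tm D par v s * eval_tm D par v t"
| "eval_tm D par v (Neg s) = - eval_tm D par v s"
| "eval_tm D par v (Der s) = D (eval_tm D par v s)"

primrec sat :: "('b::field \<Rightarrow> 'b) \<Rightarrow> 'b set \<Rightarrow> ('p \<Rightarrow> 'b) \<Rightarrow> (nat \<Rightarrow> 'b) \<Rightarrow> 'p fm \<Rightarrow> bool" where
  "sat D P par v (Eq s t) = (eval_tm D par v s = eval_tm D par v t)"
| "sat D P par v (Pc s) = (eval_tm D par v s \<in> P)"
| "sat D P par v (Not f) = (\<not> sat D P par v f)"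
| "sat D P par v (Conj f g) = (sat D P par v f \<and> sat D P par v g)"
| "sat D P par v (Ex n f) = (\<exists>x. sat D P par (v(n := x)) f)"

primrec fv_tm :: "'p tm \<Rightarrow> nat set" where
  "fv_tm (Var i) = {i}" | "fv_tm (Par p) = {}" | "fv_tm Zero = {}" | "fv_tm One = {}"
| "fv_tm (Add s t) = fv_tm s \<union> fv_tm t" | "fv_tm (Mul s t) = fv_tm s \<union> fv_tm t"
| "fv_tm (Neg s) = fv_tm s" | "fv_tm (Der s) = fv_tm s"

primrec fv :: "'p fm \<Rightarrow> nat set" where
  "fv (Eq s t) = fv_tm s \<union> fv_tm t" | "fv (Pc s) = fv_tm s" | "fv (Not f) = fv f"
| "fv (Conj f g) = fv f \<union> fv g" | "fv (Ex n f) = fv f - {n}"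

primrec params_tm :: "'p tm \<Rightarrow> 'p set" where
  "params_tm (Var i) = {}" | "params_tm (Par p) = {p}" | "params_tm Zero = {}" | "params_tm One = {}"
| "params_tm (Add s t) = params_tm s \<union> params_tm t" | "params_tm (Mul s t) = params_tm s \<union> params_tm t"
| "params_tm (Neg s) = params_tm s" | "params_tm (Der s) = params_tm s"

primrec params :: "'p fm \<Rightarrow> 'p set" where
  "params (Eq s t) = params_tm s \<union> params_tm t" | "params (Pc s) = params_tm s" | "params (Not f) = params f"
| "params (Conj f g) = params f \<union> params g" | "params (Ex n f) = params f"

primrec nodev_tm :: "'p tm \<Rightarrow> bool" where
  "nodev_tm (Var i) = True" | "nodev_tm (Par p) = True" | "nodev_tm Zero = True" | "nodev_tm One = True"
| "nodev_tm (Add s t) = (nodev_tm s \<and> nodev_tm t)" | "nodev_tm (Mul s t) = (nodev_tm s \<and> nodev_tm t)"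
| "nodev_tm (Neg s) = nodev_tm s" | "nodev_tm (Der s) = False"

primrec pair_fm :: "'p fm \<Rightarrow> bool" where
  "pair_fm (Eq s t) = (nodev_tm s \<and> nodev_tm t)" | "pair_fm (Pc s) = nodev_tm s"
| "pair_fm (Not f) = pair_fm f" | "pair_fm (Conj f g) = (pair_fm f \<and> pair_fm g)"
| "pair_fm (Ex n f) = pair_fm f"

primrec diff_fm :: "'p fm \<Rightarrow> bool" where
  "diff_fm (Eq s t) = True" | "diff_fm (Pc s) = False"
| "diff_fm (Not f) = diff_fm f" | "diff_fm (Conj f g) = (diff_fm f \<and> diff_fm g)"
| "diff_fm (Ex n f) = diff_fm f"

definition is_derivation :: "('a::field \<Rightarrow> 'a) \<Rightarrow> bool" where
  "is_derivation d \<longleftrightarrow> (\<forall>x y. d (x + y) = d x + d y \<and> d (x * y) = x * d y + d x * y)"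

definition alg_closed_field :: "'a::field itself \<Rightarrow> bool" where
  "alg_closed_field _ \<longleftrightarrow> (\<forall>p :: 'a poly. degree p > 0 \<longrightarrow> (\<exists>x. poly p x = 0))"

text \<open>Differential polynomials in one differential indeterminate x over 'a:
  polynomials in the variables x, x', x'', ...; a monomial maps i to the exponent
  of the i-th derivative of x.\<close>
type_synonym 'a dpoly = "(nat \<Rightarrow>\<^sub>0 nat) \<Rightarrow>\<^sub>0 'a"

definition dpoly_vars :: "'a::zero dpoly \<Rightarrow> nat set" where
  "dpoly_vars f = (\<Union>m\<in>Poly_Mapping.keys f. Poly_Mapping.keys m)"

definition dord :: "'a::zero dpoly \<Rightarrow> int" where
  "dord f = (if dpoly_vars f = {} then -1 else int (Max (dpoly_vars f)))"

definition deval :: "('a::field \<Rightarrow> 'a) \<Rightarrow> 'a dpoly \<Rightarrow> 'a \<Rightarrow> 'a" where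
  "deval d f a = (\<Sum>m\<in>Poly_Mapping.keys f. Poly_Mapping.lookup f m * (\<Prod>i\<in>Poly_Mapping.keys m. ((d ^^ i) a) ^ Poly_Mapping.lookup m i))"

text \<open>Blum's axioms for differentially closed fields.\<close>
definition diff_closed :: "('a::field \<Rightarrow> 'a) \<Rightarrow> bool" where
  "diff_closed d \<longleftrightarrow> (\<forall>f g :: 'a dpoly. dord f \<ge> 0 \<and> g \<noteq> 0 \<and> dord g < dord f
       \<longrightarrow> (\<exists>a. deval d f a = 0 \<and> deval d g a \<noteq> 0))"

definition defines_pair :: "'a::field set \<Rightarrow> nat \<Rightarrow> 'a fm \<Rightarrow> 'a list set \<Rightarrow> bool" where
  "defines_pair C n \<phi> X \<longleftrightarrow> pair_fm \<phi> \<and> fv \<phi> \<subseteq> {..<n} \<and>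
     X = {xs. length xs = n \<and> sat id C id (\<lambda>i. xs ! i) \<phi>}"

definition definable_pair :: "'a::field set \<Rightarrow> nat \<Rightarrow> 'a list set \<Rightarrow> bool" where
  "definable_pair C n X \<longleftrightarrow> (\<exists>\<phi>. defines_pair C n \<phi> X)"

definition defines_K :: "('a::field \<Rightarrow> 'a) \<Rightarrow> nat \<Rightarrow> 'a fm \<Rightarrow> 'a list set \<Rightarrow> bool" where
  "defines_K d n \<phi> X \<longleftrightarrow> diff_fm \<phi> \<and> fv \<phi> \<subseteq> {..<n} \<and>
     X = {xs. length xs = n \<and> sat d {} id (\<lambda>i. xs ! i) \<phi>}"

definition pair_elem_ext :: "'a::field set \<Rightarrow> ('a \<Rightarrow> 'b::field) \<Rightarrow> 'b set \<Rightarrow> bool" where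
  "pair_elem_ext C e Cs \<longleftrightarrow> (\<forall>(\<phi>::'a fm) v. pair_fm \<phi> \<longrightarrow>
      (sat id C id v \<phi> \<longleftrightarrow> sat id Cs e (e \<circ> v) \<phi>))"

definition K_elem_ext :: "('a::field \<Rightarrow> 'a) \<Rightarrow> ('a \<Rightarrow> 'b::field) \<Rightarrow> ('b \<Rightarrow> 'b) \<Rightarrow> bool" where
  "K_elem_ext d e ds \<longleftrightarrow> (\<forall>(\<phi>::'a fm) v. diff_fm \<phi> \<longrightarrow>
      (sat d {} id v \<phi> \<longleftrightarrow> sat ds {} e (e \<circ> v) \<phi>))"

definition pair_saturated :: "'a set \<Rightarrow> 'b::field set \<Rightarrow> bool" where
  "pair_saturated F Cs \<longleftrightarrow> (\<forall>\<Phi> :: 'b fm set.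
      (\<forall>\<phi>\<in>\<Phi>. pair_fm \<phi> \<and> fv \<phi> \<subseteq> {0}) \<longrightarrow>
      (card_of (\<Union>\<phi>\<in>\<Phi>. params \<phi>), card_of F) \<in> ordLeq \<longrightarrow>
      (\<forall>\<Psi>\<subseteq>\<Phi>. finite \<Psi> \<longrightarrow> (\<exists>v. \<forall>\<phi>\<in>\<Psi>. sat id Cs id v \<phi>)) \<longrightarrow>
      (\<exists>v. \<forall>\<phi>\<in>\<Phi>. sat id Cs id v \<phi>))"

definition K_saturated :: "'a set \<Rightarrow> ('b::field \<Rightarrow> 'b) \<Rightarrow> bool" where
  "K_saturated F ds \<longleftrightarrow> (\<forall>\<Phi> :: 'b fm set.
      (\<forall>\<phi>\<in>\<Phi>. diff_fm \<phi> \<and> fv \<phi> \<subseteq> {0}) \<longrightarrow>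
      (card_of (\<Union>\<phi>\<in>\<Phi>. params \<phi>), card_of F) \<in> ordLeq \<longrightarrow>
      (\<forall>\<Psi>\<subseteq>\<Phi>. finite \<Psi> \<longrightarrow> (\<exists>v. \<forall>\<phi>\<in>\<Psi>. sat ds {} id v \<phi>)) \<longrightarrow>
      (\<exists>v. \<forall>\<phi>\<in>\<Phi>. sat ds {} id v \<phi>))"

inductive_set subfield_gen :: "'b::field set \<Rightarrow> 'b set" for S where
  base: "x \<in> S \<Longrightarrow> x \<in> subfield_gen S"
| zero: "0 \<in> subfield_gen S"
| one: "1 \<in> subfield_gen S"
| add: "x \<in> subfield_gen S \<Longrightarrow> y \<in> subfield_gen S \<Longrightarrow> x + y \<in> subfield_gen S"
| neg: "x \<in> subfield_gen S \<Longrightarrow> - x \<in> subfield_gen S"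
| mult: "x \<in> subfield_gen S \<Longrightarrow> y \<in> subfield_gen S \<Longrightarrow> x * y \<in> subfield_gen S"
| inv: "x \<in> subfield_gen S \<Longrightarrow> inverse x \<in> subfield_gen S"

definition acl :: "'b::field set \<Rightarrow> 'b set" where
  "acl S = {x. \<exists>p. p \<noteq> 0 \<and> (\<forall>i. coeff p i \<in> subfield_gen S) \<and> poly p x = 0}"

definition clF :: "('a \<Rightarrow> 'b::field) \<Rightarrow> 'b set \<Rightarrow> 'b set \<Rightarrow> 'b set" where
  "clF e Cs A = acl (A \<union> range e \<union> Cs)"

definition clF_dim :: "('a \<Rightarrow> 'b::field) \<Rightarrow> 'b set \<Rightarrow> 'b list \<Rightarrow> nat" where
  "clF_dim e Cs ys = Max {card I | I. I \<subseteq> {..<length ys} \<and>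
      (\<forall>i\<in>I. ys ! i \<notin> clF e Cs ((\<lambda>j. ys ! j) ` (I - {i})))}"

text \<open>dim_2(X), computed in the |F|^+-saturated elementary extension (e, Cs) of M.\<close>
definition dim2 :: "'a::field set \<Rightarrow> ('a \<Rightarrow> 'b::field) \<Rightarrow> 'b set \<Rightarrow> nat \<Rightarrow> 'a list set \<Rightarrow> ereal" where
  "dim2 C e Cs n X = (let \<phi> = (SOME \<phi>. defines_pair C n \<phi> X);
      Y = {ys. length ys = n \<and> sat id Cs e (\<lambda>i. ys ! i) \<phi>} in
      if X = {} then - \<infinity> else ereal (real (Max (clF_dim e Cs ` Y))))"

definition alg_indep_over :: "('a \<Rightarrow> 'b::field) \<Rightarrow> 'i set \<Rightarrow> ('i \<Rightarrow> 'b) \<Rightarrow> bool" where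
  "alg_indep_over e J x \<longleftrightarrow> (\<forall>j\<in>J. x j \<notin> acl (range e \<union> x ` (J - {j})))"

definition dtrdeg :: "('a \<Rightarrow> 'b::field) \<Rightarrow> ('b \<Rightarrow> 'b) \<Rightarrow> 'b list \<Rightarrow> nat" where
  "dtrdeg e ds ys = Max {card I | I. I \<subseteq> {..<length ys} \<and>
      alg_indep_over e (I \<times> (UNIV :: nat set)) (\<lambda>(i, k). (ds ^^ k) (ys ! i))}"

text \<open>delta-dim(X), computed in the |F|^+-saturated elementary extension (e, ds) of K.\<close>
definition delta_dim :: "('a::field \<Rightarrow> 'a) \<Rightarrow> ('a \<Rightarrow> 'b::field) \<Rightarrow> ('b \<Rightarrow> 'b) \<Rightarrow> nat \<Rightarrow> 'a list set \<Rightarrow> ereal" where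
  "delta_dim d e ds n X = (let \<phi> = (SOME \<phi>. defines_K d n \<phi> X);
      Y = {ys. length ys = n \<and> sat ds {} e (\<lambda>i. ys ! i) \<phi>} in
      if X = {} then - \<infinity> else ereal (real (Max (dtrdeg e ds ` Y))))"

end

theory Submission
  imports Defs
begin

text \<open>Algebraic closure is a pregeometry, and by Steinitz exchange a tuple that is differentially independent
  over \<open>F\<close> is algebraically independent over \<open>F\<close> and the constants: if \<open>y\<close> were algebraic over a differential
  field extended by \<open>r\<close> constants, then so would be all its derivatives, but \<open>r + 1\<close> of them are independent.
  Conversely, the pair of fields knows only one generic type: partial isomorphisms between algebraically closed
  subfields that are independent from the constants form a back-and-forth system between any two saturated
  elementary extensions of the pair, and tuples that are \<open>cl\<^sub>F\<close>-independent can be matched arbitrarily.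
  Hence a \<open>cl\<^sub>F\<close>-independent subtuple of a point of \<open>X\<close> can be moved onto a differentially independent one,
  and back.  Generic elements of the pair exist because differentially transcendental elements do, by
  saturation and Blum's axioms; the corresponding first-order sentences transfer through \<open>F\<close>.\<close>

section \<open>Algebraic closure as a pregeometry\<close>

text \<open>The extensions of the pair and of the differential field are unrelated structures,
  saturated only for |F| many parameters and of no prescribed size, so no isomorphism between them
  is at hand. Closures of finite sets over \<open>F\<close> suffice: at each step saturation has to
  provide only one constant, or one element generic over the constants, outside such a closure. The
  delicate point is that adjoining a constant on one side must not create constants whose partners
  are not constants. Independence from the constants (\<open>free_from\<close>) prevents this; for
  \<open>F\<close> itself it comes from elementarity, because a linear relation over the constants
  between elements of \<open>F\<close> is a first-order statement. Both dimensions pick a defining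
  formula arbitrarily, so the two formulas have to be shown equivalent in the extension of the
  differential field. The maxima are then compared through the index sets on which some point is
  independent.\<close>

definition subfld :: "'b::field set \<Rightarrow> bool" where
  "subfld K \<longleftrightarrow> 0 \<in> K \<and> 1 \<in> K \<and> (\<forall>x\<in>K. \<forall>y\<in>K. x + y \<in> K \<and> x * y \<in> K) \<and>
     (\<forall>x\<in>K. - x \<in> K \<and> inverse x \<in> K)"

lemma subfldD:
  assumes "subfld K"
  shows "0 \<in> K" "1 \<in> K" "x \<in> K \<Longrightarrow> y \<in> K \<Longrightarrow> x + y \<in> K" "x \<in> K \<Longrightarrow> y \<in> K \<Longrightarrow> x * y \<in> K"
    "x \<in> K \<Longrightarrow> - x \<in> K" "x \<in> K \<Longrightarrow> inverse x \<in> K" "x \<in> K \<Longrightarrow> y \<in> K \<Longrightarrow> x - y \<in> K"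
    "x \<in> K \<Longrightarrow> y \<in> K \<Longrightarrow> x / y \<in> K"
proof -
  show 1: "0 \<in> K" "1 \<in> K" "x \<in> K \<Longrightarrow> y \<in> K \<Longrightarrow> x + y \<in> K" "x \<in> K \<Longrightarrow> y \<in> K \<Longrightarrow> x * y \<in> K"
    "x \<in> K \<Longrightarrow> - x \<in> K" "x \<in> K \<Longrightarrow> inverse x \<in> K" for x y
    using assms unfolding subfld_def by auto
  show "x \<in> K \<Longrightarrow> y \<in> K \<Longrightarrow> x - y \<in> K" using 1(3)[of x "- y"] 1(5) by simp
  show "x \<in> K \<Longrightarrow> y \<in> K \<Longrightarrow> x / y \<in> K" using 1(4)[of x "inverse y"] 1(6) by (simp add: field_simps)
qed

lemma sum_closed:
  fixes R :: "'b::comm_monoid_add set"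
  assumes "0 \<in> R" "\<And>x y. x \<in> R \<Longrightarrow> y \<in> R \<Longrightarrow> x + y \<in> R" "\<And>i. i \<in> I \<Longrightarrow> f i \<in> R"
  shows "sum f I \<in> R"
  using assms(3) by (induction I rule: infinite_finite_induct) (auto simp: assms(1,2))

lemma subfld_sum: "subfld K \<Longrightarrow> (\<And>i. i \<in> I \<Longrightarrow> f i \<in> K) \<Longrightarrow> sum f I \<in> K"
  by (rule sum_closed) (auto simp: subfldD)

lemma subfld_subfield_gen: "subfld (subfield_gen S)"
  unfolding subfld_def by (auto intro: subfield_gen.intros)

lemma subfield_gen_least:
  assumes "subfld K" "S \<subseteq> K" shows "subfield_gen S \<subseteq> K"
proof
  fix x assume "x \<in> subfield_gen S"
  then show "x \<in> K" by induction (use assms in \<open>auto simp: subfldD\<close>)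
qed

lemma subfield_gen_superset: "S \<subseteq> subfield_gen S"
  by (auto intro: subfield_gen.base)

lemma subfield_gen_mono: "S \<subseteq> S' \<Longrightarrow> subfield_gen S \<subseteq> subfield_gen S'"
  by (rule subfield_gen_least[OF subfld_subfield_gen]) (use subfield_gen_superset in blast)

lemma subfield_gen_finite:
  assumes "x \<in> subfield_gen S" shows "\<exists>S0. finite S0 \<and> S0 \<subseteq> S \<and> x \<in> subfield_gen S0"
  using assms
proof induction
  case (base x) then show ?case by (intro exI[of _ "{x}"]) (auto intro: subfield_gen.base)
next
  case zero then show ?case by (intro exI[of _ "{}"]) (auto intro: subfield_gen.intros)
next
  case one then show ?case by (intro exI[of _ "{}"]) (auto intro: subfield_gen.intros)
next
  case (add x y)
  then obtain A B where *: "finite A" "A \<subseteq> S" "x \<in> subfield_gen A" "finite B" "B \<subseteq> S" "y \<in> subfield_gen B" by blast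
  then have "x \<in> subfield_gen (A \<union> B)" "y \<in> subfield_gen (A \<union> B)"
    using subfield_gen_mono[of A "A \<union> B"] subfield_gen_mono[of B "A \<union> B"] by auto
  with * show ?case by (intro exI[of _ "A \<union> B"]) (auto intro: subfield_gen.intros)
next
  case (neg x) then show ?case by (meson subfield_gen.intros)
next
  case (mult x y)
  then obtain A B where *: "finite A" "A \<subseteq> S" "x \<in> subfield_gen A" "finite B" "B \<subseteq> S" "y \<in> subfield_gen B" by blast
  then have "x \<in> subfield_gen (A \<union> B)" "y \<in> subfield_gen (A \<union> B)"
    using subfield_gen_mono[of A "A \<union> B"] subfield_gen_mono[of B "A \<union> B"] by auto
  with * show ?case by (intro exI[of _ "A \<union> B"]) (auto intro: subfield_gen.intros)
next
  case (inv x) then show ?case by (meson subfield_gen.intros)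
qed

definition algover :: "'b::field set \<Rightarrow> 'b set" where
  "algover K = {x. \<exists>p. p \<noteq> 0 \<and> (\<forall>i. coeff p i \<in> K) \<and> poly p x = 0}"

lemma acl_eq: "acl S = algover (subfield_gen S)"
  unfolding acl_def algover_def ..

lemma algoverI:
  assumes "0 \<in> K" "\<And>i. i \<le> N \<Longrightarrow> k i \<in> K" "j \<le> N" "k j \<noteq> 0" "(\<Sum>i\<le>N. k i * x ^ i) = 0"
  shows "x \<in> algover K"
proof -
  let ?p = "\<Sum>i\<le>N. monom (k i) i"
  have c: "coeff ?p i = (if i \<le> N then k i else 0)" for i
    by (simp add: coeff_sum)
  have "poly ?p x = 0" using assms(5) by (simp add: poly_sum poly_monom)
  moreover have "?p \<noteq> 0" using c[of j] assms(3,4) by (metis coeff_0)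
  moreover have "coeff ?p i \<in> K" for i using c[of i] assms(1,2) by auto
  ultimately show ?thesis unfolding algover_def by blast
qed

lemma algoverE:
  assumes "x \<in> algover K"
  obtains N k j where "\<And>i. k i \<in> K" "j \<le> N" "k j \<noteq> 0" "(\<Sum>i\<le>N. k i * x ^ i) = 0"
proof -
  from assms obtain p where p: "p \<noteq> 0" "\<forall>i. coeff p i \<in> K" "poly p x = 0" unfolding algover_def by blast
  show ?thesis
    by (rule that[of "coeff p" "degree p" "degree p"]) (use p in \<open>auto simp: poly_altdef\<close>)
qed

lemma poly_closed:
  assumes "0 \<in> R" "\<And>x y. x \<in> R \<Longrightarrow> y \<in> R \<Longrightarrow> x + y \<in> R \<and> x * y \<in> R"
    "\<forall>i. coeff p i \<in> R" "x \<in> R"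
  shows "poly p x \<in> (R :: 'b::comm_semiring_0 set)"
  using assms(3)
proof (induction p)
  case 0 then show ?case using assms by simp
next
  case (pCons a p)
  have "a \<in> R" using pCons.prems[rule_format, of 0] by simp
  moreover have "\<forall>i. coeff p i \<in> R" using pCons.prems by (metis coeff_pCons_Suc)
  ultimately show ?case using pCons.IH assms by simp
qed

section \<open>Linear dependence over a subfield\<close>

definition spanK :: "'b::field set \<Rightarrow> 'b set \<Rightarrow> 'b set" where
  "spanK K B = {\<Sum>b\<in>B. k b * b | k. \<forall>b. k b \<in> K}"

lemma spanK_add: "subfld K \<Longrightarrow> x \<in> spanK K B \<Longrightarrow> y \<in> spanK K B \<Longrightarrow> x + y \<in> spanK K B"
  unfolding spanK_def
proof (clarify, goal_cases)
  case (1 k l)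
  then show ?case by (intro exI[of _ "\<lambda>b. k b + l b"]) (auto simp: subfldD sum.distrib distrib_right)
qed

lemma spanK_scale: "subfld K \<Longrightarrow> c \<in> K \<Longrightarrow> x \<in> spanK K B \<Longrightarrow> c * x \<in> spanK K B"
  unfolding spanK_def
proof (clarify, goal_cases)
  case (1 k)
  then show ?case by (intro exI[of _ "\<lambda>b. c * k b"]) (auto simp: subfldD sum_distrib_left mult.assoc)
qed

lemma spanK_0: "subfld K \<Longrightarrow> 0 \<in> spanK K B"
  unfolding spanK_def by (auto simp: subfldD intro!: exI[of _ "\<lambda>b. 0"])

lemma spanK_base: "subfld K \<Longrightarrow> finite B \<Longrightarrow> b \<in> B \<Longrightarrow> b \<in> spanK K B"
  unfolding spanK_def
proof (clarify, goal_cases)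
  case 1
  have "(\<Sum>c\<in>B. (if c = b then 1 else 0) * c) = b"
    using 1 by (subst sum.cong[OF refl, where h = "\<lambda>c. if c = b then c else 0"]) auto
  then show ?case by (intro exI[of _ "\<lambda>c. if c = b then 1 else 0"]) (auto simp: 1 subfldD)
qed

lemma spanK_insert:
  assumes "finite B" "b \<notin> B" "x \<in> spanK K (insert b B)"
  obtains k y where "k \<in> K" "y \<in> spanK K B" "x = k * b + y"
proof -
  from assms(3) obtain k where k: "\<forall>b. k b \<in> K" "x = (\<Sum>b\<in>insert b B. k b * b)" unfolding spanK_def by blast
  show ?thesis by (rule that[of "k b" "\<Sum>b\<in>B. k b * b"]) (use k assms in \<open>auto simp: spanK_def\<close>)
qed

text \<open>Gaussian elimination, by induction on the spanning set: a vector \<open>w j0\<close>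
  with nonzero coefficient at \<open>b\<close> removes \<open>b\<close> from the other vectors,
  which costs one vector and one generator. The vectors form a family because the powers to which
  this is applied may coincide.\<close>

lemma linear_dependence:
  assumes "subfld K" "finite B" "finite J" "card J > card B" "\<And>j. j \<in> J \<Longrightarrow> w j \<in> spanK K B"
  shows "\<exists>k. (\<forall>j. k j \<in> K) \<and> (\<exists>j\<in>J. k j \<noteq> 0) \<and> (\<Sum>j\<in>J. k j * w j) = 0"
  using assms(2-)
proof (induction B arbitrary: J w rule: finite_induct)
  case empty
  then have "w j = 0" if "j \<in> J" for j using that unfolding spanK_def by auto
  then show ?case using empty assms(1) by (intro exI[of _ "\<lambda>_. 1"]) (auto simp: subfldD card_gt_0_iff)
next
  case (insert b B)
  have "\<forall>j\<in>J. \<exists>k y. k \<in> K \<and> y \<in> spanK K B \<and> w j = k * b + y"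
    using insert by (meson spanK_insert)
  then obtain \<kappa> r where \<kappa>: "\<And>j. j \<in> J \<Longrightarrow> \<kappa> j \<in> K" "\<And>j. j \<in> J \<Longrightarrow> r j \<in> spanK K B"
    "\<And>j. j \<in> J \<Longrightarrow> w j = \<kappa> j * b + r j" by metis
  show ?case
  proof (cases "\<forall>j\<in>J. \<kappa> j = 0")
    case True
    then show ?thesis using insert \<kappa> by (intro insert.IH) auto
  next
    case False
    then obtain j0 where j0: "j0 \<in> J" "\<kappa> j0 \<noteq> 0" by blast
    define J' where "J' = J - {j0}"
    define c where "c j = - (\<kappa> j / \<kappa> j0)" for j
    have J: "J = insert j0 J'" "j0 \<notin> J'" "finite J'" using j0 insert unfolding J'_def by auto
    have cK: "c j \<in> K" if "j \<in> J" for j using that \<kappa> j0 assms(1) unfolding c_def by (auto simp: subfldD)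
    have "w j + c j * w j0 = r j + c j * r j0" if "j \<in> J" for j
      using \<kappa>(3)[OF that] \<kappa>(3)[OF j0(1)] j0(2) unfolding c_def by (simp add: field_simps)
    then have "w j + c j * w j0 \<in> spanK K B" if "j \<in> J'" for j
      using that J \<kappa>(2) j0 cK by (auto intro!: spanK_add spanK_scale assms(1))
    moreover have "card J' > card B" using insert J by auto
    ultimately obtain k where k: "\<forall>j. k j \<in> K" "\<exists>j\<in>J'. k j \<noteq> 0" "(\<Sum>j\<in>J'. k j * (w j + c j * w j0)) = 0"
      using insert.IH[of J' "\<lambda>j. w j + c j * w j0"] J by blast
    \<comment> \<open>The coefficient at \<open>j0\<close> collects the multiples of
      \<open>w j0\<close> that the elimination added to the other vectors.\<close>
    define k' where "k' j = (if j = j0 then \<Sum>j\<in>J'. k j * c j else k j)" for j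
    have "(\<Sum>j\<in>J. k' j * w j) = (\<Sum>j\<in>J'. k j * c j) * w j0 + (\<Sum>j\<in>J'. k j * w j)"
      using J by (auto simp: k'_def intro!: sum.cong)
    also have "\<dots> = (\<Sum>j\<in>J'. k j * (w j + c j * w j0))"
      by (simp add: distrib_left sum.distrib sum_distrib_right mult.assoc)
    finally have "(\<Sum>j\<in>J. k' j * w j) = 0" using k by simp
    moreover have "\<forall>j. k' j \<in> K" using k J cK assms(1) unfolding k'_def
      by (auto intro!: subfld_sum simp: subfldD)
    moreover have "\<exists>j\<in>J. k' j \<noteq> 0" using k J unfolding k'_def by auto
    ultimately show ?thesis by blast
  qed
qed

text \<open>Algebraic elements over \<open>K\<close> are handled through the finite-dimensional rings containing them.\<close>
definition fdring :: "'b::field set \<Rightarrow> 'b set \<Rightarrow> bool" where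
  "fdring K R \<longleftrightarrow> K \<subseteq> R \<and> (\<forall>x\<in>R. \<forall>y\<in>R. x + y \<in> R \<and> x * y \<in> R) \<and> (\<exists>B. finite B \<and> R \<subseteq> spanK K B)"

text \<open>There are \<open>card B + 1\<close> powers of \<open>z\<close> in a span of
  \<open>card B\<close> elements, and a linear relation between them is an equation for
  \<open>z\<close>.\<close>

lemma fdring_algover:
  assumes K: "subfld K" and R: "fdring K R" and z: "z \<in> R"
  shows "z \<in> algover K"
proof -
  from R obtain B where B: "finite B" "R \<subseteq> spanK K B" unfolding fdring_def by blast
  have 1: "z ^ i \<in> R" for i using z R K by (induction i) (auto simp: fdring_def subfldD)
  obtain k where k: "\<forall>j. k j \<in> K" "\<exists>j\<in>{..card B}. k j \<noteq> 0" "(\<Sum>j\<in>{..card B}. k j * z ^ j) = 0"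
    using linear_dependence[OF K B(1), of "{..card B}" "\<lambda>i. z ^ i"] 1 B by auto
  from k(2) obtain j where "j \<le> card B" "k j \<noteq> 0" by auto
  then show ?thesis by (rule algoverI[rotated 2]) (use k K in \<open>auto simp: subfldD\<close>)
qed

text \<open>Factors \<open>X\<close> are stripped from a polynomial vanishing at \<open>z\<close>
  until its constant term \<open>a\<close> is nonzero; then \<open>z * poly p z = - a\<close>
  exhibits the inverse as a polynomial in \<open>z\<close>. Thus finite-dimensional rings are
  fields.\<close>

lemma fdring_inverse:
  assumes K: "subfld K" and R: "fdring K R" and z: "z \<in> R"
  shows "inverse z \<in> R"
proof (cases "z = 0")
  case True then show ?thesis using z by simp
next
  case False
  obtain p where p: "p \<noteq> 0" "\<forall>i. coeff p i \<in> K" "poly p z = 0"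
    using fdring_algover[OF assms] unfolding algover_def by blast
  have RR: "0 \<in> R" "K \<subseteq> R" "\<And>x y. x \<in> R \<Longrightarrow> y \<in> R \<Longrightarrow> x + y \<in> R \<and> x * y \<in> R"
    using R K by (auto simp: fdring_def subfldD)
  from p show ?thesis
  proof (induction p)
    case 0 then show ?case by simp
  next
    case (pCons a p)
    have a: "a \<in> K" using pCons.prems(2)[rule_format, of 0] by simp
    have c: "\<forall>i. coeff p i \<in> K" using pCons.prems(2) by (metis coeff_pCons_Suc)
    show ?case
    proof (cases "a = 0")
      case True then show ?thesis using pCons c False by auto
    next
      case a0: False
      have "inverse z = (- inverse a) * poly p z" using pCons.prems(3) False a0
        by (simp add: field_simps eq_neg_iff_add_eq_0)
      moreover have "poly p z \<in> R" by (rule poly_closed) (use RR c z in auto)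
      moreover have "- inverse a \<in> R" using RR a K by (auto simp: subfldD)
      ultimately show ?thesis using RR(3) by metis
    qed
  qed
qed

text \<open>\<open>R'\<close> is the ring \<open>R[x]\<close>, written with powers of
  \<open>x\<close> below the degree \<open>n\<close> of an equation for \<open>x\<close>. The
  equation can be made monic because \<open>R\<close> has inverses, and the products of powers of
  \<open>x\<close> with generators of \<open>R\<close> span \<open>R'\<close> over
  \<open>K\<close>.\<close>

lemma fdring_extend:
  assumes K: "subfld K" and R: "fdring K R" and x: "x \<in> algover R"
  shows "\<exists>R'. fdring K R' \<and> R \<subseteq> R' \<and> x \<in> R'"
proof -
  have RR: "0 \<in> R" "1 \<in> R" "K \<subseteq> R" "\<And>x y. x \<in> R \<Longrightarrow> y \<in> R \<Longrightarrow> x + y \<in> R"  "\<And>x y. x \<in> R \<Longrightarrow> y \<in> R \<Longrightarrow> x * y \<in> R"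
    using R K by (auto simp: fdring_def subfldD)
  have neg: "- x \<in> R" if "x \<in> R" for x
    using RR(5)[of "-1" x] RR(3) K that by (auto simp: subfldD subset_iff)
  from x obtain p where p: "p \<noteq> 0" "\<forall>i. coeff p i \<in> R" "poly p x = 0" unfolding algover_def by blast
  define n where "n = degree p"
  have n: "n > 0" using p unfolding n_def by (cases "degree p = 0") (auto elim!: degree_eq_zeroE)
  define c where "c i = - (coeff p i * inverse (lead_coeff p))" for i
  have cR: "c i \<in> R" for i unfolding c_def using p RR neg fdring_inverse[OF K R] by auto
  have xn: "x ^ n = (\<Sum>i<n. c i * x ^ i)"
  proof -
    have "0 = (\<Sum>i<n. coeff p i * x ^ i) + lead_coeff p * x ^ n"
      using p(3) unfolding n_def by (simp add: poly_altdef lessThan_Suc_atMost[symmetric])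
    then have "lead_coeff p * x ^ n = - (\<Sum>i<n. coeff p i * x ^ i)" by (simp add: eq_neg_iff_add_eq_0 add.commute)
    then have "x ^ n = inverse (lead_coeff p) * (- (\<Sum>i<n. coeff p i * x ^ i))"
      using p(1) by (simp add: field_simps)
    then show ?thesis unfolding c_def by (simp add: sum_distrib_left sum_negf[symmetric] mult_ac)
  qed
  define R' where "R' = {\<Sum>i<n. r i * x ^ i | r. \<forall>i. r i \<in> R}"
  have R'I: "(\<Sum>i<n. r i * x ^ i) \<in> R'" if "\<And>i. r i \<in> R" for r using that unfolding R'_def by blast
  have add': "u + v \<in> R'" if "u \<in> R'" "v \<in> R'" for u v
  proof -
    from that obtain r s where "u = (\<Sum>i<n. r i * x ^ i)" "v = (\<Sum>i<n. s i * x ^ i)" "\<forall>i. r i \<in> R" "\<forall>i. s i \<in> R"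
      unfolding R'_def by blast
    then show ?thesis using R'I[of "\<lambda>i. r i + s i"] RR by (simp add: distrib_right sum.distrib)
  qed
  have scale': "a * u \<in> R'" if "u \<in> R'" "a \<in> R" for a u
  proof -
    from that obtain r where "u = (\<Sum>i<n. r i * x ^ i)" "\<forall>i. r i \<in> R"
      unfolding R'_def by blast
    then show ?thesis using R'I[of "\<lambda>i. a * r i"] RR that by (simp add: sum_distrib_left mult.assoc)
  qed
  have sub: "R \<subseteq> R'"
  proof
    fix a assume a: "a \<in> R"
    have "(\<Sum>i<n. (if i = 0 then a else 0) * x ^ i) = (\<Sum>i<n. if i = 0 then a else 0)" by (rule sum.cong) auto
    also have "\<dots> = a" using n by simp
    finally show "a \<in> R'" using R'I[of "\<lambda>i. if i = 0 then a else 0"] a RR by auto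
  qed
  have times_x: "x * u \<in> R'" if "u \<in> R'" for u
  proof -
    from that obtain r where r: "u = (\<Sum>i<n. r i * x ^ i)" "\<forall>i. r i \<in> R"
      unfolding R'_def by blast
    \<comment> \<open>Multiplication by \<open>x\<close> shifts the coefficients; the overflowing
      term \<open>r m * x ^ n\<close> is folded back by \<open>xn\<close>.\<close>
    obtain m where m: "n = Suc m" using n by (cases n) auto
    have "x * u = (\<Sum>i<n. r i * x ^ Suc i)" unfolding r by (simp add: sum_distrib_left mult_ac)
    also have "\<dots> = (\<Sum>i<m. r i * x ^ Suc i) + r m * x ^ n" unfolding m by simp
    also have "(\<Sum>i<m. r i * x ^ Suc i) = (\<Sum>i<n. (if i = 0 then 0 else r (i - 1)) * x ^ i)"
      unfolding m by (simp only: sum.lessThan_Suc_shift) simp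
    also have "r m * x ^ n = (\<Sum>i<n. r m * c i * x ^ i)" unfolding xn by (simp add: sum_distrib_left mult.assoc)
    finally have "x * u = (\<Sum>i<n. (if i = 0 then 0 else r (i - 1)) * x ^ i) + (\<Sum>i<n. r m * c i * x ^ i)" .
    then show ?thesis using R'I[of "\<lambda>i. if i = 0 then 0 else r (i - 1)"] R'I[of "\<lambda>i. r m * c i"] r cR RR add' by simp
  qed
  have pow_x: "x ^ i * u \<in> R'" if "u \<in> R'" for i u
    using that by (induction i) (auto simp: times_x mult.assoc)
  have mult': "u * v \<in> R'" if "u \<in> R'" "v \<in> R'" for u v
  proof -
    from that obtain r where r: "u = (\<Sum>i<n. r i * x ^ i)" "\<forall>i. r i \<in> R"
      unfolding R'_def by blast
    have "u * v = (\<Sum>i<n. r i * (x ^ i * v))" unfolding r by (simp add: sum_distrib_right mult.assoc)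
    also have "\<dots> \<in> R'" by (rule sum_closed) (use sub RR add' r scale' pow_x that in auto)
    finally show ?thesis .
  qed
  from R obtain B where B: "finite B" "R \<subseteq> spanK K B" unfolding fdring_def by blast
  define B' where "B' = (\<lambda>(i, b). x ^ i * b) ` ({..<n} \<times> B)"
  have fin: "finite B'" using B unfolding B'_def by auto
  have "R' \<subseteq> spanK K B'"
  proof
    fix u assume "u \<in> R'"
    then obtain r where r: "u = (\<Sum>i<n. r i * x ^ i)" "\<forall>i. r i \<in> R"
      unfolding R'_def by blast
    have "r i * x ^ i \<in> spanK K B'" if "i < n" for i
    proof -
      have "r i \<in> spanK K B" using r B by auto
      then obtain k where k: "\<forall>b. k b \<in> K" "r i = (\<Sum>b\<in>B. k b * b)" unfolding spanK_def by blast
      have "r i * x ^ i = (\<Sum>b\<in>B. k b * (x ^ i * b))" unfolding k by (simp add: sum_distrib_left mult_ac)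
      also have "\<dots> \<in> spanK K B'"
      proof (rule sum_closed)
        fix b assume "b \<in> B"
        then have "x ^ i * b \<in> B'" using that unfolding B'_def by force
        then show "k b * (x ^ i * b) \<in> spanK K B'" using k by (intro spanK_scale spanK_base K fin) auto
      qed (auto simp: spanK_0 spanK_add K)
      finally show ?thesis .
    qed
    then show "u \<in> spanK K B'" unfolding r by (intro sum_closed) (auto simp: spanK_0 spanK_add K)
  qed
  moreover have "K \<subseteq> R'" using RR(3) sub by (rule subset_trans)
  ultimately have "fdring K R'" unfolding fdring_def using add' mult' fin by blast
  moreover have "x \<in> R'" using times_x[of 1] sub RR by auto
  ultimately show ?thesis using sub by blast
qed

lemma fdring_refl: "subfld K \<Longrightarrow> fdring K K"
proof -
  assume K: "subfld K"
  have "x \<in> spanK K {1}" if "x \<in> K" for x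
    using spanK_scale[OF K that spanK_base[OF K, of "{1}" 1]] by simp
  then show ?thesis unfolding fdring_def using K by (auto simp: subfldD intro!: exI[of _ "{1}"])
qed

lemma algover_mono: "K \<subseteq> L \<Longrightarrow> algover K \<subseteq> algover L"
  unfolding algover_def by blast

lemma fdring_finite:
  assumes K: "subfld K" and "finite Y" "Y \<subseteq> algover K"
  shows "\<exists>R. fdring K R \<and> Y \<subseteq> R"
  using assms(2,3)
proof (induction Y rule: finite_induct)
  case empty then show ?case using fdring_refl[OF K] by blast
next
  case (insert y Y)
  then obtain R where R: "fdring K R" "Y \<subseteq> R" by blast
  then have "y \<in> algover R" using insert algover_mono[of K R] by (auto simp: fdring_def)
  from fdring_extend[OF K R(1) this] R show ?case by blast
qed

lemma subset_algover: "subfld K \<Longrightarrow> K \<subseteq> algover K"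
  using fdring_algover fdring_refl by blast

lemma subfld_algover:
  assumes K: "subfld K" shows "subfld (algover K)"
proof -
  have "x + y \<in> algover K \<and> x * y \<in> algover K" if xy: "x \<in> algover K" "y \<in> algover K" for x y
  proof -
    obtain R where R: "fdring K R" "{x, y} \<subseteq> R" using fdring_finite[OF K, of "{x, y}"] xy by auto
    then have "x + y \<in> R" "x * y \<in> R" by (auto simp: fdring_def)
    then show ?thesis using fdring_algover[OF K R(1)] by blast
  qed
  moreover have "inverse x \<in> algover K" if xy: "x \<in> algover K" for x
    using fdring_finite[OF K, of "{x}"] xy fdring_inverse[OF K] fdring_algover[OF K] by (metis empty_subsetI finite.emptyI finite.insertI insert_subset)
  moreover have "0 \<in> algover K" "1 \<in> algover K" "-1 \<in> algover K" using subset_algover[OF K] K by (auto simp: subfldD subset_iff)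
  ultimately show ?thesis unfolding subfld_def by (metis mult_minus1)
qed

text \<open>The finitely many coefficients of an equation over \<open>algover K\<close> lie in one
  finite-dimensional ring, and adjoining the root keeps the dimension finite.\<close>

lemma algover_idem:
  assumes K: "subfld K" shows "algover (algover K) = algover K"
proof
  show "algover (algover K) \<subseteq> algover K"
  proof
    fix x assume "x \<in> algover (algover K)"
    then obtain p where p: "p \<noteq> 0" "\<forall>i. coeff p i \<in> algover K" "poly p x = 0" unfolding algover_def by blast
    obtain R where R: "fdring K R" "coeff p ` {..degree p} \<subseteq> R"
      using fdring_finite[OF K, of "coeff p ` {..degree p}"] p(2) by blast
    have "0 \<in> R" using R K by (auto simp: fdring_def subfldD)
    then have "coeff p i \<in> R" for i using R(2)
      by (cases "i \<le> degree p") (auto simp: coeff_eq_0)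
    then have "x \<in> algover R" unfolding algover_def using p by blast
    with fdring_extend[OF K R(1)] show "x \<in> algover K" using fdring_algover[OF K] by blast
  qed
  show "algover K \<subseteq> algover (algover K)" by (rule subset_algover[OF subfld_algover[OF K]])
qed

section \<open>The closure operator \<open>acl\<close>\<close>

lemma subfld_acl: "subfld (acl S)"
  unfolding acl_eq by (rule subfld_algover[OF subfld_subfield_gen])

lemma acl_superset: "S \<subseteq> acl S"
  unfolding acl_eq using subset_algover[OF subfld_subfield_gen] subfield_gen_superset by blast

lemma acl_mono: "S \<subseteq> T \<Longrightarrow> acl S \<subseteq> acl T"
  unfolding acl_eq by (intro algover_mono subfield_gen_mono)

lemma notin_acl_mono: "x \<notin> acl T \<Longrightarrow> S \<subseteq> T \<Longrightarrow> x \<notin> acl S"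
  using acl_mono[of S T] by blast

lemma acl_idem: "acl (acl S) = acl S"
proof -
  have "subfield_gen (acl S) = acl S"
    using subfield_gen_least[OF subfld_acl] subfield_gen_superset by blast
  then show ?thesis using algover_idem[OF subfld_subfield_gen] unfolding acl_eq by simp
qed

lemma acl_least: "S \<subseteq> acl T \<Longrightarrow> acl S \<subseteq> acl T"
  using acl_mono[of S "acl T"] by (simp add: acl_idem)

lemma acl_finite:
  assumes "x \<in> acl S" shows "\<exists>S0. finite S0 \<and> S0 \<subseteq> S \<and> x \<in> acl S0"
proof -
  from assms obtain p where p: "p \<noteq> 0" "\<forall>i. coeff p i \<in> subfield_gen S" "poly p x = 0" unfolding acl_def by blast
  from p(2) obtain f where f: "\<And>i. finite (f i) \<and> f i \<subseteq> S \<and> coeff p i \<in> subfield_gen (f i)"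
    using subfield_gen_finite[of "coeff p _" S] by metis
  let ?S = "\<Union>i\<le>degree p. f i"
  have "coeff p i \<in> subfield_gen ?S" for i
  proof (cases "i \<le> degree p")
    case True then show ?thesis using f[of i] subfield_gen_mono[of "f i" ?S] by auto
  next
    case False then show ?thesis by (simp add: coeff_eq_0 subfield_gen.zero)
  qed
  then have "x \<in> acl ?S" using p unfolding acl_def by blast
  then show ?thesis using f by (intro exI[of _ ?S]) auto
qed

text \<open>Only the part from \<open>S\<close> is made finite; \<open>A\<close> is a base such as
  \<open>range e\<close> or a whole closed domain, which stays in place.\<close>

lemma acl_finite_Un:
  assumes "x \<in> acl (A \<union> S)" shows "\<exists>S0. finite S0 \<and> S0 \<subseteq> S \<and> x \<in> acl (A \<union> S0)"
proof -
  obtain T where T: "finite T" "T \<subseteq> A \<union> S" "x \<in> acl T" using acl_finite[OF assms] by blast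
  then have "x \<in> acl (A \<union> (T \<inter> S))" using acl_mono[of T "A \<union> (T \<inter> S)"] by auto
  then show ?thesis using T by blast
qed

text \<open>\<open>R\<close> is left abstract because three rings of numerators occur: polynomials
  in one element for \<open>acl_exchange\<close>, values of closed terms for
  \<open>acl_term\<close>, and the ring generated by \<open>range e\<close> and a field of constants
  for \<open>free_from_range\<close>.\<close>

lemma clear_denominators:
  fixes p :: "'b::field poly"
  assumes R: "0 \<in> R" "1 \<in> R" "\<And>x y. x \<in> R \<Longrightarrow> y \<in> R \<Longrightarrow> x * y \<in> R"
    and L: "\<And>x. x \<in> L \<Longrightarrow> \<exists>a\<in>R. \<exists>b\<in>R. b \<noteq> 0 \<and> x = a / b" and p: "\<forall>i. coeff p i \<in> L"
  shows "\<exists>D\<in>R. D \<noteq> 0 \<and> (\<forall>i. D * coeff p i \<in> R)"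
  using p
proof (induction p)
  case 0 then show ?case using R by (intro bexI[of _ 1]) auto
next
  case (pCons a p)
  have "\<forall>i. coeff p i \<in> L" using pCons.prems by (metis coeff_pCons_Suc)
  with pCons.IH obtain D where D: "D \<in> R" "D \<noteq> 0" "\<forall>i. D * coeff p i \<in> R" by blast
  have "a \<in> L" using pCons.prems[rule_format, of 0] by simp
  then obtain u v where uv: "u \<in> R" "v \<in> R" "v \<noteq> 0" "a = u / v" using L by blast
  have "v * D * coeff (pCons a p) i \<in> R" for i
  proof (cases i)
    case 0 then show ?thesis using uv D R(3)[of D u] by (simp add: mult.commute)
  next
    case (Suc j) then show ?thesis using R(3)[of v "D * coeff p j"] D uv by (simp add: mult.assoc)
  qed
  then show ?case using D uv R by (intro bexI[of _ "v * D"]) auto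
qed

lemma subfield_gen_fraction:
  assumes S: "S \<subseteq> R" and R: "0 \<in> R" "1 \<in> R" "\<And>x y. x \<in> R \<Longrightarrow> y \<in> R \<Longrightarrow> x + y \<in> R"
    "\<And>x y. x \<in> R \<Longrightarrow> y \<in> R \<Longrightarrow> x * y \<in> R" "\<And>x. x \<in> R \<Longrightarrow> - x \<in> R"
    and z: "z \<in> subfield_gen S"
  shows "\<exists>a\<in>R. \<exists>b\<in>R. b \<noteq> 0 \<and> z = a / b"
  using z
proof induction
  case (base z)
  then show ?case using S R by (intro bexI[of _ z] bexI[of _ 1]) auto
next
  case zero show ?case using R by (intro bexI[of _ 0] bexI[of _ 1]) auto
next
  case one show ?case using R by (intro bexI[of _ 1]) auto
next
  case (add z w)
  then obtain a b c d where *: "a \<in> R" "b \<in> R" "b \<noteq> 0" "z = a / b" "c \<in> R" "d \<in> R" "d \<noteq> 0" "w = c / d" by blast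
  then show ?case by (intro bexI[of _ "a * d + c * b"] bexI[of _ "b * d"]) (auto simp: add_frac_eq intro!: R)
next
  case (neg z)
  then obtain a b where *: "a \<in> R" "b \<in> R" "b \<noteq> 0" "z = a / b" by blast
  then show ?case by (intro bexI[of _ "- a"] bexI[of _ b]) (auto intro: R)
next
  case (mult z w)
  then obtain a b c d where *: "a \<in> R" "b \<in> R" "b \<noteq> 0" "z = a / b" "c \<in> R" "d \<in> R" "d \<noteq> 0" "w = c / d" by blast
  then show ?case by (intro bexI[of _ "a * c"] bexI[of _ "b * d"]) (auto intro!: R)
next
  case (inv z)
  then obtain a b where *: "a \<in> R" "b \<in> R" "b \<noteq> 0" "z = a / b" by blast
  show ?case
  proof (cases "a = 0")
    case True then show ?thesis using * R by (intro bexI[of _ 0] bexI[of _ 1]) auto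
  next
    case False then show ?thesis using * by (intro bexI[of _ b] bexI[of _ a]) auto
  qed
qed

text \<open>After clearing denominators, the equation of \<open>x\<close> over \<open>K(y)\<close>
  is a polynomial in two variables over \<open>K\<close>. Sorted by powers of \<open>y\<close>, its
  coefficients \<open>r j\<close> vanish if \<open>y\<close> is transcendental over
  \<open>K(x)\<close>. Each \<open>r j = 0\<close> is an equation for \<open>x\<close> over
  \<open>K\<close>, so all coefficients vanish, against the nonzero leading coefficient.\<close>

lemma acl_exchange:
  assumes x: "x \<in> acl (insert y S)" "x \<notin> acl S" shows "y \<in> acl (insert x S)"
proof (rule ccontr)
  assume y: "y \<notin> acl (insert x S)"
  let ?K = "subfield_gen S"
  let ?P = "\<lambda>p. \<forall>i. coeff p i \<in> ?K"
  define R where "R = {poly p y | p. ?P p}"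
  note K = subfldD[OF subfld_subfield_gen[of S]]
  have RI: "poly p y \<in> R" if "?P p" for p using that unfolding R_def by blast
  have R01: "0 \<in> R" "1 \<in> R" using RI[of 0] RI[of 1] K by (auto simp: coeff_1)
  have Ra: "a + b \<in> R" and Rm: "a * b \<in> R" if ab: "a \<in> R" "b \<in> R" for a b
  proof -
    from ab obtain p q where pq: "?P p" "?P q" "a = poly p y" "b = poly q y" unfolding R_def by blast
    have "?P (p + q)" using pq K by auto
    then show "a + b \<in> R" using RI[of "p + q"] pq by simp
    have "?P (p * q)" using pq K by (auto simp: coeff_mult intro!: subfld_sum subfld_subfield_gen)
    then show "a * b \<in> R" using RI[of "p * q"] pq by simp
  qed
  have Rn: "- a \<in> R" if "a \<in> R" for a
  proof -
    from that obtain p where p: "?P p" "a = poly p y" unfolding R_def by blast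
    then have "?P (- p)" using K by auto
    then show ?thesis using RI[of "- p"] p by simp
  qed
  have "y \<in> R" using RI[of "[:0, 1:]"] K by (auto simp: coeff_pCons split: nat.splits)
  moreover have "s \<in> R" if "s \<in> S" for s
    using RI[of "[:s:]"] K subfield_gen.base[OF that] by (auto simp: coeff_pCons split: nat.splits)
  ultimately have SR: "insert y S \<subseteq> R" by blast
  from x obtain p where p: "p \<noteq> 0" "\<forall>i. coeff p i \<in> subfield_gen (insert y S)" "poly p x = 0" unfolding acl_def by blast
  from clear_denominators[OF R01 Rm subfield_gen_fraction[OF SR R01 Ra Rm Rn] p(2)] obtain D where D: "D \<in> R" "D \<noteq> 0" "\<forall>i. D * coeff p i \<in> R" by blast
  then obtain q where q: "\<And>i. ?P (q i)" "\<And>i. D * coeff p i = poly (q i) y" unfolding R_def by simp metis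
  define n where "n = degree p"
  define N where "N = (\<Sum>i\<le>n. degree (q i))"
  have N: "degree (q i) \<le> N" if "i \<le> n" for i unfolding N_def by (rule member_le_sum) (use that in auto)
  define r where "r j = (\<Sum>i\<le>n. coeff (q i) j * x ^ i)" for j
  have py: "poly (q i) y = (\<Sum>j\<le>N. coeff (q i) j * y ^ j)" if "i \<le> n" for i
    unfolding poly_altdef by (rule sum.mono_neutral_left) (use N[OF that] in \<open>auto simp: coeff_eq_0\<close>)
  have "0 = D * poly p x" using p by simp
  also have "\<dots> = (\<Sum>i\<le>n. poly (q i) y * x ^ i)" unfolding n_def
    by (simp add: poly_altdef[of p] sum_distrib_left q(2)[symmetric] mult.assoc)
  also have "\<dots> = (\<Sum>i\<le>n. \<Sum>j\<le>N. coeff (q i) j * x ^ i * y ^ j)" by (simp add: py sum_distrib_left mult_ac)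
  also have "\<dots> = (\<Sum>j\<le>N. r j * y ^ j)" unfolding r_def by (subst sum.swap) (simp add: sum_distrib_right)
  finally have sum0: "(\<Sum>j\<le>N. r j * y ^ j) = 0" by simp
  have xi: "x \<in> subfield_gen (insert x S)" by (rule subfield_gen.base) simp
  have xp: "x ^ i \<in> subfield_gen (insert x S)" for i
    by (induction i) (auto intro: subfield_gen.intros xi)
  have KK: "?K \<subseteq> subfield_gen (insert x S)" by (rule subfield_gen_mono) blast
  have rK: "r j \<in> subfield_gen (insert x S)" for j unfolding r_def
    by (rule subfld_sum[OF subfld_subfield_gen], rule subfield_gen.mult) (use q KK xp in auto)
  have r0: "r j = 0" if "j \<le> N" for j
  proof (rule ccontr)
    assume "r j \<noteq> 0"
    have "y \<in> algover (subfield_gen (insert x S))"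
      by (rule algoverI[OF _ _ that \<open>r j \<noteq> 0\<close> sum0]) (auto intro: rK subfield_gen.zero)
    with y show False unfolding acl_eq by simp
  qed
  have q0: "coeff (q i) j = 0" if "j \<le> N" "i \<le> n" for i j
  proof (rule ccontr)
    assume "coeff (q i) j \<noteq> 0"
    have "x \<in> algover ?K"
      by (rule algoverI[OF _ _ that(2), of _ "\<lambda>i. coeff (q i) j"])
        (use q r0[OF that(1)] \<open>coeff (q i) j \<noteq> 0\<close> in \<open>auto intro: subfield_gen.zero simp: r_def\<close>)
    with x show False unfolding acl_eq by simp
  qed
  have "poly (q n) y = 0" using py[of n] q0[of _ n] by simp
  then have "D * lead_coeff p = 0" using q(2)[of n] unfolding n_def by simp
  then show False using D p by simp
qed

text \<open>Implicit differentiation: applying \<open>\<delta>\<close> to an equation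
  \<open>poly p x = 0\<close> of minimal degree expresses \<open>\<delta> x\<close> through
  derivatives of the coefficients, and characteristic zero keeps the cofactor
  \<open>poly (pderiv p) x\<close> from vanishing. The target \<open>E\<close> is any space over
  \<open>acl S\<close>: the zero space shows that constants are algebraically closed,
  \<open>acl S\<close> itself that a closure is stable under \<open>\<delta>\<close>.\<close>

lemma acl_derivation_closed:
  fixes \<delta> :: "'b::field \<Rightarrow> 'b"
  assumes d: "is_derivation \<delta>" and ch: "\<And>n. n > 0 \<Longrightarrow> (of_nat n :: 'b) \<noteq> 0"
    and E: "0 \<in> E" "\<And>a b. a \<in> E \<Longrightarrow> b \<in> E \<Longrightarrow> a + b \<in> E" "\<And>k a. k \<in> acl S \<Longrightarrow> a \<in> E \<Longrightarrow> k * a \<in> E"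
    and S: "\<delta> ` S \<subseteq> E" and x: "x \<in> acl S"
  shows "\<delta> x \<in> E"
proof -
  let ?K = "subfield_gen S"
  note A = subfldD[OF subfld_acl[of S]]
  have da: "\<delta> (x + y) = \<delta> x + \<delta> y" and dm: "\<delta> (x * y) = x * \<delta> y + \<delta> x * y" for x y
    using d unfolding is_derivation_def by auto
  have d0: "\<delta> 0 = 0" using da[of 0 0] by (metis add_cancel_right_right)
  have d1: "\<delta> 1 = 0" using dm[of 1 1] by (metis add_cancel_right_right mult_1 mult_1_right)
  have dn: "\<delta> (- x) = - \<delta> x" for x using da[of x "- x"] d0 by (simp add: eq_neg_iff_add_eq_0 add.commute)
  have di: "\<delta> (inverse x) = - (inverse x * inverse x * \<delta> x)" for x
  proof (cases "x = 0")
    case False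
    then have "x * \<delta> (inverse x) + \<delta> x * inverse x = 0" using dm[of x "inverse x"] d1 by simp
    then have "\<delta> (inverse x) = inverse x * (- (\<delta> x * inverse x))"
      using False by (simp add: field_simps eq_neg_iff_add_eq_0)
    then show ?thesis by simp
  qed (simp add: d0)
  have KA: "?K \<subseteq> acl S" by (rule subfield_gen_least[OF subfld_acl acl_superset])
  have E': "a * k \<in> E" if "k \<in> acl S" "a \<in> E" for k a using E(3)[OF that] by (simp add: mult.commute)
  have neg: "- a \<in> E" if "a \<in> E" for a using E(3)[of "- 1" a] A that by auto
  have dK: "\<delta> k \<in> E" if "k \<in> ?K" for k
    using that
  proof induction
    case (base x) then show ?case using S by auto
  next
    case (inv x)
    then have "inverse x * inverse x \<in> acl S" using KA A by auto
    then show ?case unfolding di using inv by (intro neg E)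
  next
    case (mult x y)
    then have "x * \<delta> y \<in> E" "\<delta> x * y \<in> E" using KA by (auto intro: E(3) E')
    then show ?case unfolding dm by (rule E(2))
  qed (auto simp: d0 d1 da dn intro: E neg)
  define P where "P p \<longleftrightarrow> p \<noteq> 0 \<and> (\<forall>i. coeff p i \<in> ?K) \<and> poly p x = 0" for p
  have "\<exists>p. P p" using x unfolding acl_def P_def by blast
  then obtain p where p: "P p" "\<And>q. P q \<Longrightarrow> degree p \<le> degree q"
    using exists_least_iff[of "\<lambda>n. \<exists>p. P p \<and> degree p = n"] by (metis linorder_not_less)
  have deg: "degree p > 0" using p(1) unfolding P_def by (cases "degree p = 0") (auto elim!: degree_eq_zeroE)
  have nz: "poly (pderiv p) x \<noteq> 0"
  proof
    assume "poly (pderiv p) x = 0"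
    moreover have "coeff (pderiv p) (degree p - 1) \<noteq> 0"
      using deg ch[of "degree p"] p(1) unfolding P_def by (simp add: coeff_pderiv del: of_nat_Suc)
    then have "pderiv p \<noteq> 0" by (metis coeff_0)
    moreover have "of_nat n \<in> ?K" for n by (induction n) (auto intro: subfield_gen.intros)
    then have "coeff (pderiv p) i \<in> ?K" for i using p(1) unfolding P_def
      by (auto simp: coeff_pderiv simp del: of_nat_Suc intro: subfield_gen.mult)
    ultimately have "P (pderiv p)" unfolding P_def by blast
    then have "degree p \<le> degree (pderiv p)" by (rule p(2))
    moreover have "degree (pderiv p) < degree p"
      by (rule degree_lessI) (use deg in \<open>auto simp: coeff_pderiv coeff_eq_0\<close>)
    ultimately show False by simp
  qed
  \<comment> \<open>\<open>e\<close> is the value at \<open>x\<close> of \<open>q\<close> with its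
    coefficients differentiated.\<close>
  have key: "\<exists>e\<in>E. \<delta> (poly q x) = e + poly (pderiv q) x * \<delta> x" if "\<forall>i. coeff q i \<in> ?K" for q
    using that
  proof (induction q)
    case 0 then show ?case using E d0 by (intro bexI[of _ 0]) auto
  next
    case (pCons a q)
    have a: "a \<in> ?K" using pCons.prems[rule_format, of 0] by simp
    have c: "\<forall>i. coeff q i \<in> ?K" using pCons.prems by (metis coeff_pCons_Suc)
    from pCons.IH[OF c] obtain e where e: "e \<in> E" "\<delta> (poly q x) = e + poly (pderiv q) x * \<delta> x" by blast
    have "\<delta> (poly (pCons a q) x) = (\<delta> a + x * e) + poly (pderiv (pCons a q)) x * \<delta> x"
      using e by (simp add: da dm pderiv_pCons algebra_simps)
    moreover have "\<delta> a + x * e \<in> E" using dK[OF a] e x E by auto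
    ultimately show ?case by blast
  qed
  obtain e where e: "e \<in> E" "\<delta> (poly p x) = e + poly (pderiv p) x * \<delta> x" using key p(1) unfolding P_def by blast
  then have "\<delta> x = inverse (poly (pderiv p) x) * - e" using p(1) nz d0 unfolding P_def
    by (simp add: field_simps eq_neg_iff_add_eq_0)
  moreover have "poly (pderiv p) x \<in> acl S"
  proof (rule poly_closed)
    have "of_nat n \<in> acl S" for n by (induction n) (use A in auto)
    then show "\<forall>i. coeff (pderiv p) i \<in> acl S" using p(1) KA unfolding P_def
      by (auto simp: coeff_pderiv simp del: of_nat_Suc intro!: A(4))
  qed (use A x in auto)
  ultimately show ?thesis using e A by (auto intro!: E(3) neg)
qed

section \<open>Partial isomorphisms of fields\<close>

text \<open>Partial isomorphisms between two fields, given by their graphs.\<close>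
definition fgraph :: "('b::field \<times> 'c::field) set \<Rightarrow> bool" where
  "fgraph G \<longleftrightarrow> (0, 0) \<in> G \<and> (1, 1) \<in> G \<and>
     (\<forall>x y u v. (x, y) \<in> G \<longrightarrow> (u, v) \<in> G \<longrightarrow> (x + u, y + v) \<in> G \<and> (x * u, y * v) \<in> G) \<and>
     (\<forall>x y. (x, y) \<in> G \<longrightarrow> (- x, - y) \<in> G \<and> (inverse x, inverse y) \<in> G \<and> (x = 0 \<longleftrightarrow> y = 0))"

lemma fgraphD:
  assumes "fgraph G"
  shows "(0, 0) \<in> G" "(1, 1) \<in> G" "(x, y) \<in> G \<Longrightarrow> (u, v) \<in> G \<Longrightarrow> (x + u, y + v) \<in> G"
    "(x, y) \<in> G \<Longrightarrow> (u, v) \<in> G \<Longrightarrow> (x * u, y * v) \<in> G" "(x, y) \<in> G \<Longrightarrow> (- x, - y) \<in> G"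
    "(x, y) \<in> G \<Longrightarrow> (inverse x, inverse y) \<in> G" "(x, y) \<in> G \<Longrightarrow> x = 0 \<longleftrightarrow> y = 0"
    "(x, y) \<in> G \<Longrightarrow> (u, v) \<in> G \<Longrightarrow> (x - u, y - v) \<in> G"
proof -
  show *: "(0, 0) \<in> G" "(1, 1) \<in> G" "(x, y) \<in> G \<Longrightarrow> (u, v) \<in> G \<Longrightarrow> (x + u, y + v) \<in> G"
    "(x, y) \<in> G \<Longrightarrow> (u, v) \<in> G \<Longrightarrow> (x * u, y * v) \<in> G" "(x, y) \<in> G \<Longrightarrow> (- x, - y) \<in> G"
    "(x, y) \<in> G \<Longrightarrow> (inverse x, inverse y) \<in> G" "(x, y) \<in> G \<Longrightarrow> x = 0 \<longleftrightarrow> y = 0" for x y u v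
    using assms unfolding fgraph_def by blast+
  show "(x, y) \<in> G \<Longrightarrow> (u, v) \<in> G \<Longrightarrow> (x - u, y - v) \<in> G" using *(3)[of x y "- u" "- v"] *(5) by simp
qed

lemma fgraph_eq: "fgraph G \<Longrightarrow> (x, y) \<in> G \<Longrightarrow> (u, v) \<in> G \<Longrightarrow> x = u \<longleftrightarrow> y = v"
  using fgraphD(7)[of G "x - u" "y - v"] fgraphD(8)[of G x y u v] by auto

lemma fgraph_converse: "fgraph G \<Longrightarrow> fgraph (G\<inverse>)"
  unfolding fgraph_def converse_iff by blast

lemma subfld_Domain: "fgraph G \<Longrightarrow> subfld (Domain G)"
  unfolding subfld_def by (auto simp: Domain_iff Bex_def Ball_def) (blast dest: fgraphD)+

lemma subfld_Range: "fgraph G \<Longrightarrow> subfld (Range G)"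
  using subfld_Domain[OF fgraph_converse] by simp

lemma fgraph_sum:
  assumes "fgraph G" "\<And>i. i \<in> I \<Longrightarrow> (f i, g i) \<in> G" shows "(sum f I, sum g I) \<in> G"
  using assms(2) by (induction I rule: infinite_finite_induct) (auto simp: fgraphD[OF assms(1)])

section \<open>Polynomials corresponding under a partial isomorphism\<close>

definition prel :: "('b::field \<times> 'c::field) set \<Rightarrow> 'b poly \<Rightarrow> 'c poly \<Rightarrow> bool" where
  "prel G p q \<longleftrightarrow> (\<forall>i. (coeff p i, coeff q i) \<in> G)"

lemma prel_converse: "prel (G\<inverse>) q p \<longleftrightarrow> prel G p q"
  unfolding prel_def by simp

lemma prel_pCons: "prel G (pCons a p) (pCons b q) \<longleftrightarrow> (a, b) \<in> G \<and> prel G p q"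
  unfolding prel_def by (metis coeff_pCons_0 coeff_pCons_Suc not0_implies_Suc)

lemma prel_intros:
  assumes G: "fgraph G"
  shows "prel G 0 0" "prel G 1 1" "prel G p q \<Longrightarrow> prel G r s \<Longrightarrow> prel G (p + r) (q + s)"
    "prel G p q \<Longrightarrow> prel G r s \<Longrightarrow> prel G (p - r) (q - s)"
    "prel G p q \<Longrightarrow> prel G r s \<Longrightarrow> prel G (p * r) (q * s)"
    "prel G p q \<Longrightarrow> prel G (- p) (- q)"
    "prel G p q \<Longrightarrow> (a, b) \<in> G \<Longrightarrow> prel G (smult a p) (smult b q)"
  unfolding prel_def by (auto simp: coeff_1 coeff_mult fgraphD[OF G] intro!: fgraph_sum[OF G])

lemma prel_coeff_0:
  assumes G: "fgraph G" and pq: "prel G p q"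
  shows "coeff p i = 0 \<longleftrightarrow> coeff q i = 0"
  using pq fgraphD(7)[OF G] unfolding prel_def by blast

lemma prel_0: "fgraph G \<Longrightarrow> prel G p q \<Longrightarrow> p = 0 \<longleftrightarrow> q = 0"
  using prel_coeff_0 by (metis coeff_0 poly_eqI)

lemma prel_degree: "fgraph G \<Longrightarrow> prel G p q \<Longrightarrow> degree p = degree q"
  by (intro antisym degree_le) (metis coeff_eq_0 prel_coeff_0)+

lemma prel_exists:
  assumes G: "fgraph G" and p: "\<forall>i. coeff p i \<in> Domain G"
  shows "\<exists>q. prel G p q"
proof -
  define h where "h a = (SOME b. (a, b) \<in> G)" for a
  have h: "(a, h a) \<in> G" if "a \<in> Domain G" for a unfolding h_def using that by (metis DomainE someI)
  \<comment> \<open>\<open>map_poly\<close> acts as \<open>h\<close> on all coefficients, including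
    those beyond the degree, only if \<open>h 0 = 0\<close>.\<close>
  have "h 0 = 0" using h[of 0] fgraphD(1,7)[OF G] by blast
  then have "prel G p (map_poly h p)" unfolding prel_def using h p by (simp add: coeff_map_poly)
  then show ?thesis by blast
qed

text \<open>\<open>H\<close> sends fractions of polynomials in \<open>x\<close> to the corresponding
  fractions in \<open>y\<close>; that the same polynomials vanish at \<open>x\<close> and
  \<open>y\<close> makes it single-valued and injective. The last two clauses make domain and range
  as small as possible, in the form needed to bound them by an algebraic closure.\<close>

lemma fgraph_adjoin:
  assumes G: "fgraph G" and xy: "\<And>p q. prel G p q \<Longrightarrow> poly p x = 0 \<longleftrightarrow> poly q y = 0"
  shows "\<exists>H. fgraph H \<and> G \<subseteq> H \<and> (x, y) \<in> H \<and>
     (\<forall>A. subfld A \<longrightarrow> Domain G \<subseteq> A \<longrightarrow> x \<in> A \<longrightarrow> Domain H \<subseteq> A) \<and>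
     (\<forall>A. subfld A \<longrightarrow> Range G \<subseteq> A \<longrightarrow> y \<in> A \<longrightarrow> Range H \<subseteq> A)"
proof -
  define H where "H = {(poly p x / poly r x, poly q y / poly s y) | p q r s. prel G p q \<and> prel G r s \<and> poly r x \<noteq> 0}"
  note P = prel_intros[OF G]
  have HI: "(poly p x / poly r x, poly q y / poly s y) \<in> H" if "prel G p q" "prel G r s" "poly r x \<noteq> 0" for p q r s
    using that unfolding H_def by blast
  have HE: "\<exists>p q r s. prel G p q \<and> prel G r s \<and> poly r x \<noteq> 0 \<and> poly s y \<noteq> 0 \<and> u = poly p x / poly r x \<and> v = poly q y / poly s y"
    if "(u, v) \<in> H" for u v using that xy unfolding H_def by blast
  have c: "prel G [:a:] [:b:]" if "(a, b) \<in> G" for a b using that P(1) by (simp add: prel_pCons)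
  have GH: "(a, b) \<in> H" if "(a, b) \<in> G" for a b using HI[OF c[OF that] P(2)] by simp
  have "fgraph H" unfolding fgraph_def
  proof (intro conjI allI impI)
    show "(0, 0) \<in> H" "(1, 1) \<in> H" using GH fgraphD[OF G] by auto
    fix a b assume ab: "(a, b) \<in> H"
    then obtain p q r s where 1: "prel G p q" "prel G r s" "poly r x \<noteq> 0" "poly s y \<noteq> 0" "a = poly p x / poly r x" "b = poly q y / poly s y"
      using HE by metis
    show z: "a = 0 \<longleftrightarrow> b = 0" using 1 xy by simp
    show "(- a, - b) \<in> H" using HI[OF P(6)[OF 1(1)] 1(2,3)] 1 by simp
    show "(inverse a, inverse b) \<in> H"
    proof (cases "poly p x = 0")
      case True then show ?thesis using 1 ab z by simp
    next
      case False then show ?thesis using HI[OF 1(2,1)] 1 by simp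
    qed
    fix c d assume "(c, d) \<in> H"
    then obtain p' q' r' s' where 2: "prel G p' q'" "prel G r' s'" "poly r' x \<noteq> 0" "poly s' y \<noteq> 0" "c = poly p' x / poly r' x" "d = poly q' y / poly s' y"
      using HE by metis
    show "(a * c, b * d) \<in> H" using HI[OF P(5)[OF 1(1) 2(1)] P(5)[OF 1(2) 2(2)]] 1 2 by simp
    show "(a + c, b + d) \<in> H"
      using HI[OF P(3)[OF P(5)[OF 1(1) 2(2)] P(5)[OF 2(1) 1(2)]] P(5)[OF 1(2) 2(2)]] 1 2 by (simp add: add_frac_eq)
  qed
  moreover have "G \<subseteq> H" using GH by auto
  moreover have "(x, y) \<in> H"
    using HI[of "[:0,1:]" "[:0,1:]" 1 1] fgraphD[OF G] P(1,2) by (simp add: prel_pCons)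
  moreover have "Domain H \<subseteq> A" if A: "subfld A" "Domain G \<subseteq> A" "x \<in> A" for A
  proof -
    have "poly p x \<in> A" if "prel G p q" for p q
      by (rule poly_closed) (use A that in \<open>auto simp: subfldD prel_def\<close>)
    then show ?thesis using A by (auto dest!: HE intro!: subfldD)
  qed
  moreover have "Range H \<subseteq> A" if A: "subfld A" "Range G \<subseteq> A" "y \<in> A" for A
  proof -
    have "poly q y \<in> A" if "prel G p q" for p q
      by (rule poly_closed) (use A that in \<open>auto simp: subfldD prel_def\<close>)
    then show ?thesis using A by (auto dest!: HE intro!: subfldD)
  qed
  ultimately show ?thesis by (intro exI[of _ H]) blast
qed

text \<open>Long division runs on both sides at once, so that quotients and remainders correspond
  again. The remainder is bounded by vanishing coefficients rather than by its degree, which covers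
  the zero remainder without a case distinction.\<close>

lemma prel_divide:
  assumes G: "fgraph G" and m: "prel G m m'" "lead_coeff m = 1"
  shows "prel G p q \<Longrightarrow> \<exists>s s' t t'. prel G s s' \<and> prel G t t' \<and> p = s * m + t \<and> q = s' * m' + t' \<and> (\<forall>i\<ge>degree m. coeff t i = 0)"
proof (induction p arbitrary: q)
  case 0
  then have "q = 0" using prel_0[OF G] by blast
  then show ?case using prel_intros(1)[OF G] by (intro exI[of _ 0]) auto
next
  case (pCons a p)
  obtain b q' where q: "q = pCons b q'" by (rule pCons_cases)
  with pCons.prems have ab: "(a, b) \<in> G" "prel G p q'" by (auto simp: prel_pCons)
  from pCons.IH[OF ab(2)] obtain s s' t t' where st: "prel G s s'" "prel G t t'" "p = s * m + t" "q' = s' * m' + t'" "\<forall>i\<ge>degree m. coeff t i = 0" by blast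
  define n where "n = degree m"
  \<comment> \<open>Only this coefficient of \<open>pCons a t\<close> can violate the bound on the
    remainder; since \<open>m\<close> is monic, subtracting \<open>smult c m\<close> removes
    it.\<close>
  define c where "c = coeff (pCons a t) n"
  define d where "d = coeff (pCons b t') n"
  have at: "prel G (pCons a t) (pCons b t')" using ab st by (simp add: prel_pCons)
  then have cd: "(c, d) \<in> G" unfolding c_def d_def prel_def by blast
  have "pCons a p = pCons c s * m + (pCons a t - smult c m)"
    unfolding st by (simp add: algebra_simps)
  moreover have "q = pCons d s' * m' + (pCons b t' - smult d m')"
    unfolding q st by (simp add: algebra_simps)
  moreover have "prel G (pCons c s) (pCons d s')" using cd st by (simp add: prel_pCons)
  moreover have "prel G (pCons a t - smult c m) (pCons b t' - smult d m')"
    by (intro prel_intros[OF G] at m cd)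
  moreover have "coeff (pCons a t - smult c m) i = 0" if "i \<ge> degree m" for i
  proof (cases "i = n")
    case True then show ?thesis using m unfolding c_def n_def by simp
  next
    case False
    then have "i > degree m" using that unfolding n_def by simp
    then obtain j where "i = Suc j" "j \<ge> degree m" by (cases i) auto
    then show ?thesis using st(5) \<open>i > degree m\<close> by (simp add: coeff_eq_0)
  qed
  ultimately show ?case by blast
qed

lemma prel_minimal:
  assumes G: "fgraph G" and ex: "prel G p q" "p \<noteq> 0" "poly p x = 0"
  obtains m m' where "prel G m m'" "lead_coeff m = 1" "poly m x = 0"
    "\<And>p q. prel G p q \<Longrightarrow> poly p x = 0 \<Longrightarrow> (\<forall>i\<ge>degree m. coeff p i = 0) \<Longrightarrow> p = 0"
proof -
  define P where "P n \<longleftrightarrow> (\<exists>p q. prel G p q \<and> p \<noteq> 0 \<and> poly p x = 0 \<and> degree p = n)" for n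
  have "P (degree p)" unfolding P_def using ex by blast
  then obtain n where n: "P n" "\<And>k. k < n \<Longrightarrow> \<not> P k" using exists_least_iff[of P] by blast
  then obtain r s where r: "prel G r s" "r \<noteq> 0" "poly r x = 0" "degree r = n" unfolding P_def by blast
  let ?a = "inverse (lead_coeff r)" and ?b = "inverse (coeff s (degree r))"
  have "(?a, ?b) \<in> G" using r(1) fgraphD(6)[OF G] unfolding prel_def by blast
  then have 1: "prel G (smult ?a r) (smult ?b s)" using prel_intros(7)[OF G r(1)] by blast
  show ?thesis
  proof (rule that[OF 1])
    show "lead_coeff (smult ?a r) = 1" "poly (smult ?a r) x = 0" using r by auto
    fix p q assume p: "prel G p q" "poly p x = 0" "\<forall>i\<ge>degree (smult ?a r). coeff p i = 0"
    show "p = 0"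
    proof (rule ccontr)
      assume p0: "p \<noteq> 0"
      have "degree p < n"
      proof (rule ccontr)
        assume "\<not> degree p < n"
        then have "lead_coeff p = 0" using p(3) r by simp
        then show False using p0 by simp
      qed
      moreover have "P (degree p)" unfolding P_def using p p0 by blast
      ultimately show False using n by blast
    qed
  qed
qed

text \<open>The partner \<open>y\<close> is any root of the image \<open>m'\<close> of the minimal
  polynomial \<open>m\<close> of \<open>x\<close>. It satisfies no further equations, because its
  own minimal polynomial pulls back to a factor of \<open>m\<close>. Division by \<open>m\<close>
  then decides at the same time whether a polynomial vanishes at \<open>x\<close> and its image at
  \<open>y\<close>.\<close>

lemma fgraph_adjoin_algebraic:
  fixes G :: "('b::field \<times> 'c::field) set"
  assumes G: "fgraph G" and ac: "alg_closed_field TYPE('c)" and x: "x \<in> algover (Domain G)"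
  shows "\<exists>H. fgraph H \<and> G \<subseteq> H \<and> x \<in> Domain H \<and> Domain H \<subseteq> algover (Domain G) \<and> Range H \<subseteq> algover (Range G)"
proof -
  from x obtain p where p: "p \<noteq> 0" "\<forall>i. coeff p i \<in> Domain G" "poly p x = 0" unfolding algover_def by blast
  obtain q where q: "prel G p q" using prel_exists[OF G p(2)] by blast
  from prel_minimal[OF G q p(1,3)] obtain m m' where m: "prel G m m'" "lead_coeff m = 1" "poly m x = 0"
    and mmin: "\<And>p q. prel G p q \<Longrightarrow> poly p x = 0 \<Longrightarrow> (\<forall>i\<ge>degree m. coeff p i = 0) \<Longrightarrow> p = 0" by metis
  have deg: "degree m' = degree m" using prel_degree[OF G m(1)] by simp
  have m0: "m \<noteq> 0" using m(2) by auto
  have dm: "degree m > 0" using m(3) m0 by (cases "degree m = 0") (auto elim!: degree_eq_zeroE)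
  then obtain y where y: "poly m' y = 0" using ac deg unfolding alg_closed_field_def by metis
  have m'0: "m' \<noteq> 0" using prel_0[OF G m(1)] m0 by blast
  have ymin: "t = 0" if t: "prel G t t'" "poly t' y = 0" "\<forall>i\<ge>degree m. coeff t i = 0" for t t'
  proof -
    have "prel (G\<inverse>) m' m" using m by (simp add: prel_converse)
    from prel_minimal[OF fgraph_converse[OF G] this m'0 y] obtain w' w where
      w: "prel G w w'" "lead_coeff w' = 1" "poly w' y = 0" and
      wmin: "\<And>p q. prel (G\<inverse>) q p \<Longrightarrow> poly q y = 0 \<Longrightarrow> (\<forall>i\<ge>degree w'. coeff q i = 0) \<Longrightarrow> q = 0"
      unfolding prel_converse by metis
    have dw: "degree w = degree w'" using prel_degree[OF G w(1)] .
    have "(lead_coeff w, 1) \<in> G" using w(1,2) dw unfolding prel_def by metis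
    then have lw: "lead_coeff w = 1" using fgraph_eq[OF G _ fgraphD(2)[OF G]] by blast
    obtain s s' r r' where sr: "prel G s s'" "prel G r r'" "m = s * w + r" "m' = s' * w' + r'" "\<forall>i\<ge>degree w. coeff r i = 0"
      using prel_divide[OF G w(1) lw m(1)] by blast
    have "r' = 0" by (rule wmin[of _ r]) (use sr y w prel_coeff_0[OF G sr(2)] dw in \<open>auto simp: prel_converse\<close>)
    then have "r = 0" using prel_0[OF G sr(2)] by simp
    then have mw: "m = s * w" using sr by simp
    then have sw: "s \<noteq> 0" "w \<noteq> 0" "degree m = degree s + degree w" using m0 by (auto simp: degree_mult_eq)
    have w'0: "w' \<noteq> 0" using w(2) by auto
    \<comment> \<open>As \<open>w\<close> is not constant, the cofactor \<open>s\<close> has smaller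
      degree than \<open>m\<close> and cannot vanish at \<open>x\<close>. Hence \<open>w\<close>
      does, and minimality of \<open>m\<close> gives \<open>w\<close> the full degree.\<close>
    have "degree w > 0" using w(3) w'0 unfolding dw by (cases "degree w' = 0") (auto elim!: degree_eq_zeroE)
    then have "poly s x \<noteq> 0" using mmin[OF sr(1)] sw by (auto simp: coeff_eq_0)
    then have "poly w x = 0" using m(3) mw by simp
    then have "degree m \<le> degree w" using mmin[OF w(1)] sw(2) by (metis coeff_eq_0 le_less_trans linorder_not_less order.strict_trans1)
    then have "t' = 0" using wmin[of t' t] t sw dw prel_coeff_0[OF G t(1)] by (auto simp: prel_converse)
    then show ?thesis using prel_0[OF G t(1)] by simp
  qed
  have "poly r x = 0 \<longleftrightarrow> poly r' y = 0" if r: "prel G r r'" for r r'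
  proof -
    obtain s s' t t' where st: "prel G s s'" "prel G t t'" "r = s * m + t" "r' = s' * m' + t'" "\<forall>i\<ge>degree m. coeff t i = 0"
      using prel_divide[OF G m(1,2) r] by blast
    have "poly r x = poly t x" "poly r' y = poly t' y" using st m y by auto
    moreover have "poly t x = 0 \<longleftrightarrow> t = 0" using mmin[OF st(2)] st(5) by auto
    moreover have "poly t' y = 0 \<longleftrightarrow> t = 0" using ymin[OF st(2)] st(5) prel_0[OF G st(2)] by auto
    ultimately show ?thesis by simp
  qed
  from fgraph_adjoin[OF G this] obtain H where H: "fgraph H" "G \<subseteq> H" "(x, y) \<in> H"
     "\<And>A. subfld A \<Longrightarrow> Domain G \<subseteq> A \<Longrightarrow> x \<in> A \<Longrightarrow> Domain H \<subseteq> A"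
     "\<And>A. subfld A \<Longrightarrow> Range G \<subseteq> A \<Longrightarrow> y \<in> A \<Longrightarrow> Range H \<subseteq> A" by blast
  have D: "subfld (Domain G)" "subfld (Range G)" using G by (auto simp: subfld_Domain subfld_Range)
  have "y \<in> algover (Range G)" unfolding algover_def using m'0 y m(1) unfolding prel_def by blast
  then have "Range H \<subseteq> algover (Range G)" by (intro H subfld_algover D subset_algover)
  moreover have "Domain H \<subseteq> algover (Domain G)" by (intro H subfld_algover D subset_algover x)
  ultimately show ?thesis using H(1-3) by blast
qed

lemma acl_subfld_eq: "subfld K \<Longrightarrow> acl K = algover K"
  unfolding acl_eq using subfield_gen_least[of K K] subfield_gen_superset[of K] by (metis order_refl subset_antisym)

text \<open>Zorn's lemma for the extensions inside the two closures. A maximal one misses no element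
  of the left closure by \<open>fgraph_adjoin_algebraic\<close>, and none of the right closure by
  the same lemma for the converse, so each field in turn has to supply roots.\<close>

lemma fgraph_extend_acl:
  fixes G :: "('b::field \<times> 'c::field) set"
  assumes G: "fgraph G" and ac: "alg_closed_field TYPE('b)" "alg_closed_field TYPE('c)"
  shows "\<exists>H. fgraph H \<and> G \<subseteq> H \<and> Domain H = acl (Domain G) \<and> Range H = acl (Range G)"
proof -
  define \<A> where "\<A> = {H. fgraph H \<and> G \<subseteq> H \<and> Domain H \<subseteq> acl (Domain G) \<and> Range H \<subseteq> acl (Range G)}"
  have "G \<in> \<A>" using G acl_superset[of "Domain G"] acl_superset[of "Range G"] unfolding \<A>_def by blast
  then have "\<A> \<noteq> {}" by blast
  moreover have "\<Union>\<C> \<in> \<A>" if C: "\<C> \<noteq> {}" "subset.chain \<A> \<C>" for \<C>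
  proof -
    have CA: "H \<in> \<A>" if "H \<in> \<C>" for H using C that unfolding subset.chain_def by blast
    have one: "\<exists>H\<in>\<C>. a \<in> H \<and> b \<in> H" if ab: "a \<in> \<Union>\<C>" "b \<in> \<Union>\<C>" for a b
      using C(2) ab unfolding subset_chain_def by blast
    have "fgraph (\<Union>\<C>)" unfolding fgraph_def
    proof (intro conjI allI impI)
      show "(0, 0) \<in> \<Union>\<C>" "(1, 1) \<in> \<Union>\<C>" using C(1) CA unfolding \<A>_def by (blast dest: fgraphD)+
      fix a b assume ab: "(a, b) \<in> \<Union>\<C>"
      then obtain H where H: "H \<in> \<C>" "(a, b) \<in> H" "fgraph H" using CA unfolding \<A>_def by blast
      show "(- a, - b) \<in> \<Union>\<C>" "(inverse a, inverse b) \<in> \<Union>\<C>" "a = 0 \<longleftrightarrow> b = 0"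
        using UnionI[OF H(1)] fgraphD(5-7)[OF H(3,2)] by auto
      fix c d assume "(c, d) \<in> \<Union>\<C>"
      from one[OF ab this] obtain H where H: "H \<in> \<C>" "(a, b) \<in> H" "(c, d) \<in> H" "fgraph H" using CA unfolding \<A>_def by blast
      show "(a + c, b + d) \<in> \<Union>\<C>" "(a * c, b * d) \<in> \<Union>\<C>"
        using UnionI[OF H(1)] fgraphD(3,4)[OF H(4,2,3)] by auto
    qed
    moreover have "G \<subseteq> \<Union>\<C>" using C(1) CA unfolding \<A>_def by blast
    moreover have "Domain (\<Union>\<C>) \<subseteq> acl (Domain G)" "Range (\<Union>\<C>) \<subseteq> acl (Range G)" using CA unfolding \<A>_def by blast+
    ultimately show ?thesis unfolding \<A>_def by blast
  qed
  ultimately obtain H where H: "H \<in> \<A>" "\<And>H'. H' \<in> \<A> \<Longrightarrow> H \<subseteq> H' \<Longrightarrow> H' = H"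
    using subset_Zorn_nonempty[of \<A>] by blast
  then have HA: "fgraph H" "G \<subseteq> H" "Domain H \<subseteq> acl (Domain G)" "Range H \<subseteq> acl (Range G)" unfolding \<A>_def by auto
  have D: "algover (Domain H) = acl (Domain G)" "algover (Range H) = acl (Range G)"
  proof -
    show "algover (Domain H) = acl (Domain G)"
      using acl_least[OF HA(3)] acl_mono[OF Domain_mono[OF HA(2)]] acl_subfld_eq[OF subfld_Domain[OF HA(1)]] by auto
    show "algover (Range H) = acl (Range G)"
      using acl_least[OF HA(4)] acl_mono[OF Range_mono[OF HA(2)]] acl_subfld_eq[OF subfld_Range[OF HA(1)]] by auto
  qed
  have "x \<in> Domain H" if "x \<in> acl (Domain G)" for x
  proof -
    from that D have "x \<in> algover (Domain H)" by simp
    from fgraph_adjoin_algebraic[OF HA(1) ac(2) this] obtain H' where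
      H': "fgraph H'" "H \<subseteq> H'" "x \<in> Domain H'" "Domain H' \<subseteq> acl (Domain G)" "Range H' \<subseteq> acl (Range G)" unfolding D by blast
    then have "H' \<in> \<A>" using HA unfolding \<A>_def by blast
    then show ?thesis using H(2) H' by blast
  qed
  moreover have "y \<in> Range H" if "y \<in> acl (Range G)" for y
  proof -
    from that D have "y \<in> algover (Domain (H\<inverse>))" by simp
    from fgraph_adjoin_algebraic[OF fgraph_converse[OF HA(1)] ac(1) this] obtain H' where
      H': "fgraph H'" "H\<inverse> \<subseteq> H'" "y \<in> Domain H'" "Domain H' \<subseteq> acl (Range G)" "Range H' \<subseteq> acl (Domain G)" by (auto simp: D)
    then have "H'\<inverse> \<in> \<A>" using HA fgraph_converse[OF H'(1)] unfolding \<A>_def by auto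
    moreover have "H \<subseteq> H'\<inverse>" using H' by auto
    ultimately have "H'\<inverse> = H" using H(2) by blast
    then show ?thesis using H'(3) by auto
  qed
  ultimately show ?thesis using HA by blast
qed

text \<open>Two transcendental elements satisfy the same equations, namely the trivial one. Domain
  and range are closed off at once, so that the next step again starts from closed sets.\<close>

lemma fgraph_adjoin_transcendental:
  fixes G :: "('b::field \<times> 'c::field) set"
  assumes G: "fgraph G" and ac: "alg_closed_field TYPE('b)" "alg_closed_field TYPE('c)"
    and x: "x \<notin> acl (Domain G)" and y: "y \<notin> acl (Range G)"
  shows "\<exists>H. fgraph H \<and> G \<subseteq> H \<and> (x, y) \<in> H \<and> Domain H = acl (insert x (Domain G)) \<and> Range H = acl (insert y (Range G))"
proof -
  have "poly p x = 0 \<longleftrightarrow> poly q y = 0" if pq: "prel G p q" for p q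
  proof -
    have "poly p x = 0 \<longleftrightarrow> p = 0"
      using x pq unfolding acl_subfld_eq[OF subfld_Domain[OF G]] algover_def prel_def by auto
    moreover have "poly q y = 0 \<longleftrightarrow> q = 0"
      using y pq unfolding acl_subfld_eq[OF subfld_Range[OF G]] algover_def prel_def by auto
    ultimately show ?thesis using prel_0[OF G pq] by simp
  qed
  from fgraph_adjoin[OF G this] obtain H where H: "fgraph H" "G \<subseteq> H" "(x, y) \<in> H"
     "\<And>A. subfld A \<Longrightarrow> Domain G \<subseteq> A \<Longrightarrow> x \<in> A \<Longrightarrow> Domain H \<subseteq> A"
     "\<And>A. subfld A \<Longrightarrow> Range G \<subseteq> A \<Longrightarrow> y \<in> A \<Longrightarrow> Range H \<subseteq> A" by blast
  have "acl (Domain H) = acl (insert x (Domain G))"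
  proof
    show "acl (Domain H) \<subseteq> acl (insert x (Domain G))"
      by (rule acl_least, rule H(4)[OF subfld_acl]) (use acl_superset[of "insert x (Domain G)"] in auto)
    show "acl (insert x (Domain G)) \<subseteq> acl (Domain H)" by (rule acl_mono) (use H in blast)
  qed
  moreover have "acl (Range H) = acl (insert y (Range G))"
  proof
    show "acl (Range H) \<subseteq> acl (insert y (Range G))"
      by (rule acl_least, rule H(5)[OF subfld_acl]) (use acl_superset[of "insert y (Range G)"] in auto)
    show "acl (insert y (Range G)) \<subseteq> acl (Range H)" by (rule acl_mono) (use H in blast)
  qed
  ultimately show ?thesis using fgraph_extend_acl[OF H(1) ac] H(2,3) by blast
qed

section \<open>Back-and-forth between pairs of fields\<close>

text \<open>\<open>A\<close> is independent from \<open>P\<close> over \<open>A \<inter> P\<close>.\<close>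
definition free_from :: "'b::field set \<Rightarrow> 'b set \<Rightarrow> bool" where
  "free_from P A \<longleftrightarrow> (\<forall>S\<subseteq>P. acl (A \<union> S) \<inter> P \<subseteq> acl ((A \<inter> P) \<union> S))"

text \<open>Everything the back-and-forth asks of an extension. Elementarity gives all clauses but
  the last two; these carry what is used of saturation, one for new constants and one for elements
  generic over the constants.\<close>

definition good_pair :: "'a::field set \<Rightarrow> ('a \<Rightarrow> 'b::field) \<Rightarrow> 'b set \<Rightarrow> bool" where
  "good_pair C e P \<longleftrightarrow> alg_closed_field TYPE('b) \<and> e 0 = 0 \<and> e 1 = 1 \<and>
     (\<forall>x y. e (x + y) = e x + e y \<and> e (x * y) = e x * e y) \<and> (\<forall>x. e x \<in> P \<longleftrightarrow> x \<in> C) \<and>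
     acl (range e) = range e \<and> acl P = P \<and> free_from P (range e) \<and>
     (\<forall>T. finite T \<longrightarrow> (\<exists>y\<in>P. y \<notin> acl (range e \<union> T))) \<and>
     (\<forall>T. finite T \<longrightarrow> (\<exists>y. y \<notin> acl (range e \<union> T \<union> P)))"

text \<open>Domain and range are closures of finite sets over \<open>F\<close>, so the last two
  clauses of \<open>good_pair\<close> always find an element outside.\<close>

definition bf :: "('a \<Rightarrow> 'b::field) \<Rightarrow> 'b set \<Rightarrow> ('a \<Rightarrow> 'c::field) \<Rightarrow> 'c set \<Rightarrow> ('b \<times> 'c) set \<Rightarrow> bool" where
  "bf e1 P1 e2 P2 G \<longleftrightarrow> fgraph G \<and> (\<forall>a. (e1 a, e2 a) \<in> G) \<and> (\<forall>x y. (x, y) \<in> G \<longrightarrow> (x \<in> P1 \<longleftrightarrow> y \<in> P2)) \<and>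
     (\<exists>T. finite T \<and> Domain G = acl (range e1 \<union> T)) \<and> (\<exists>T. finite T \<and> Range G = acl (range e2 \<union> T)) \<and>
     free_from P1 (Domain G) \<and> free_from P2 (Range G)"

lemma free_fromD: "free_from P A \<Longrightarrow> S \<subseteq> P \<Longrightarrow> u \<in> acl (A \<union> S) \<Longrightarrow> u \<in> P \<Longrightarrow> u \<in> acl ((A \<inter> P) \<union> S)"
  unfolding free_from_def by blast

lemma bf_converse: "bf e1 P1 e2 P2 G \<Longrightarrow> bf e2 P2 e1 P1 (G\<inverse>)"
  unfolding bf_def Domain_converse Range_converse converse_iff using fgraph_converse[of G] by blast

lemma acl_Un_acl: "acl (acl A \<union> S) = acl (A \<union> S)"
proof
  show "acl (acl A \<union> S) \<subseteq> acl (A \<union> S)"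
    using acl_mono[of A "A \<union> S"] acl_superset[of "A \<union> S"] by (intro acl_least) auto
  show "acl (A \<union> S) \<subseteq> acl (acl A \<union> S)" using acl_superset[of A] by (intro acl_mono) auto
qed

lemma prel_poly:
  assumes G: "fgraph G" and uv: "(u, v) \<in> G"
  shows "prel G p q \<Longrightarrow> (poly p u, poly q v) \<in> G"
proof (induction p arbitrary: q)
  case 0
  then have "q = 0" using prel_0[OF G] by blast
  then show ?case using fgraphD[OF G] by simp
next
  case (pCons a p)
  obtain b q' where q: "q = pCons b q'" by (rule pCons_cases)
  with pCons.prems have ab: "(a, b) \<in> G" "prel G p q'" by (auto simp: prel_pCons)
  then show ?case unfolding q using pCons.IH[OF ab(2)] by (auto intro!: fgraphD[OF G] uv)
qed

text \<open>An equation over the field generated by \<open>S\<close> is transported coefficient by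
  coefficient. This locates the partner of an element that is algebraic over given
  constants.\<close>

lemma fgraph_acl_image:
  assumes G: "fgraph G" and S: "S \<subseteq> Domain G" and uv: "u \<in> acl S" "(u, v) \<in> G"
  shows "v \<in> acl (G `` S)"
proof -
  have 1: "\<exists>w'. (w, w') \<in> G \<and> w' \<in> subfield_gen (G `` S)" if "w \<in> subfield_gen S" for w
    using that
  proof induction
    case (base x) then show ?case using S by (blast intro: subfield_gen.base)
  next
    case zero then show ?case using fgraphD[OF G] by (blast intro: subfield_gen.zero)
  next
    case one then show ?case using fgraphD[OF G] by (blast intro: subfield_gen.one)
  next
    case (add x y) then show ?case using fgraphD(3)[OF G] by (blast intro: subfield_gen.add)
  next
    case (neg x) then show ?case using fgraphD(5)[OF G] by (blast intro: subfield_gen.neg)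
  next
    case (mult x y) then show ?case using fgraphD(4)[OF G] by (blast intro: subfield_gen.mult)
  next
    case (inv x) then show ?case using fgraphD(6)[OF G] by (blast intro: subfield_gen.inv)
  qed
  from uv obtain p where p: "p \<noteq> 0" "\<forall>i. coeff p i \<in> subfield_gen S" "poly p u = 0" unfolding acl_def by blast
  have "\<forall>i. coeff p i \<in> Domain G" using 1 p(2) by blast
  then obtain q where q: "prel G p q" using prel_exists[OF G] by blast
  have "coeff q i \<in> subfield_gen (G `` S)" for i
  proof -
    obtain w where w: "(coeff p i, w) \<in> G" "w \<in> subfield_gen (G `` S)" using 1 p(2) by blast
    moreover have "(coeff p i, coeff q i) \<in> G" using q unfolding prel_def by blast
    ultimately show ?thesis using fgraph_eq[OF G] by blast
  qed
  moreover have "poly q v = 0" using prel_poly[OF G uv(2) q] p(3) fgraphD(7)[OF G] by metis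
  moreover have "q \<noteq> 0" using prel_0[OF G q] p by simp
  ultimately show ?thesis unfolding acl_def by blast
qed

text \<open>If \<open>u\<close> were not already algebraic over \<open>A\<close> and
  \<open>S\<close>, exchange would make \<open>x\<close> algebraic over \<open>A\<close> and
  constants.\<close>

lemma free_from_generic:
  assumes free: "free_from P A" and x: "x \<notin> acl (A \<union> P)" and S: "S \<subseteq> P" and u: "u \<in> P" "u \<in> acl (insert x A \<union> S)"
  shows "u \<in> acl ((A \<inter> P) \<union> S)"
proof (cases "u \<in> acl (A \<union> S)")
  case True then show ?thesis using free S u unfolding free_from_def by blast
next
  case False
  then have "x \<in> acl (insert u (A \<union> S))" using acl_exchange[of u x "A \<union> S"] u by simp
  then show ?thesis using x acl_mono[of "insert u (A \<union> S)" "A \<union> P"] S u by auto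
qed

lemma free_from_generic_extension:
  assumes free: "free_from P A" and x: "x \<notin> acl (A \<union> P)"
  shows "free_from P (acl (insert x A))"
  unfolding free_from_def acl_Un_acl
proof clarify
  fix S u assume "S \<subseteq> P" "u \<in> acl (insert x A \<union> S)" "u \<in> P"
  then have "u \<in> acl ((A \<inter> P) \<union> S)" using free_from_generic[OF free x] by blast
  moreover have "A \<inter> P \<union> S \<subseteq> acl (insert x A) \<inter> P \<union> S" using acl_superset[of "insert x A"] by blast
  ultimately show "u \<in> acl (acl (insert x A) \<inter> P \<union> S)" using notin_acl_mono by blast
qed

text \<open>\<open>free_from\<close> quantifies over all sets of constants, so the new constant can
  be counted with \<open>S\<close> when the freeness of \<open>A\<close> is applied.\<close>

lemma free_from_constant_extension:
  assumes free: "free_from P A" and x: "x \<in> P"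
  shows "free_from P (acl (insert x A))"
  unfolding free_from_def acl_Un_acl
proof clarify
  fix S u assume "S \<subseteq> P" "u \<in> acl (insert x A \<union> S)" "u \<in> P"
  then have "u \<in> acl ((A \<inter> P) \<union> insert x S)" using x by (intro free_fromD[OF free]) auto
  moreover have "A \<inter> P \<union> insert x S \<subseteq> acl (insert x A) \<inter> P \<union> S" using acl_superset[of "insert x A"] x by blast
  ultimately show "u \<in> acl (acl (insert x A) \<inter> P \<union> S)" using notin_acl_mono by blast
qed

text \<open>By freeness a constant \<open>u\<close> of the new domain is algebraic over
  \<open>x\<close> and the old constants. All of these have constants as partners, hence so does
  \<open>u\<close>, because \<open>acl P2 = P2\<close>.\<close>

lemma fgraph_constant_extension:
  assumes H: "fgraph H" "G \<subseteq> H" "(x, y) \<in> H" "Domain H = acl (insert x (Domain G))" and free: "free_from P1 (Domain G)"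
    and G: "\<And>a b. (a, b) \<in> G \<Longrightarrow> a \<in> P1 \<Longrightarrow> b \<in> P2" and xy: "x \<in> P1" "y \<in> P2" "acl P2 = P2"
    and uv: "(u, v) \<in> H" "u \<in> P1"
  shows "v \<in> P2"
proof -
  have "u \<in> acl (Domain G \<union> {x})" using uv H by auto
  then have "u \<in> acl ((Domain G \<inter> P1) \<union> {x})" using xy uv by (intro free_fromD[OF free]) auto
  then have "v \<in> acl (H `` ((Domain G \<inter> P1) \<union> {x}))"
    by (rule fgraph_acl_image[OF H(1) _ _ uv(1), rotated]) (use H in auto)
  moreover have "H `` ((Domain G \<inter> P1) \<union> {x}) \<subseteq> P2"
  proof
    fix b assume "b \<in> H `` ((Domain G \<inter> P1) \<union> {x})"
    then obtain a where a: "(a, b) \<in> H" "a = x \<or> a \<in> Domain G \<and> a \<in> P1" by blast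
    show "b \<in> P2"
    proof (cases "a = x")
      case True then show ?thesis using fgraph_eq[OF H(1) a(1) H(3)] xy by simp
    next
      case False
      then obtain b' where "(a, b') \<in> G" "a \<in> P1" using a by blast
      then show ?thesis using fgraph_eq[OF H(1) a(1), of a b'] H(2) G[of a b'] by blast
    qed
  qed
  ultimately show ?thesis using acl_mono[of _ P2] xy(3) by auto
qed

lemma good_pairD:
  fixes e :: "'a::field \<Rightarrow> 'b::field"
  assumes "good_pair C e P"
  shows "alg_closed_field TYPE('b)" "e 0 = 0" "e 1 = 1" "e (x + y) = e x + e y" "e (x * y) = e x * e y"
    "e x \<in> P \<longleftrightarrow> x \<in> C" "acl (range e) = range e" "acl P = P" "free_from P (range e)"
    "finite T \<Longrightarrow> \<exists>y\<in>P. y \<notin> acl (range e \<union> T)" "finite T \<Longrightarrow> \<exists>y. y \<notin> acl (range e \<union> T \<union> P)"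
  using assms unfolding good_pair_def by simp_all

lemma bfD:
  assumes "bf e1 P1 e2 P2 G"
  shows "fgraph G" "(e1 a, e2 a) \<in> G" "(x, y) \<in> G \<Longrightarrow> x \<in> P1 \<longleftrightarrow> y \<in> P2"
    "\<exists>T. finite T \<and> Domain G = acl (range e1 \<union> T)" "\<exists>T. finite T \<and> Range G = acl (range e2 \<union> T)"
     "free_from P1 (Domain G)" "free_from P2 (Range G)" "acl (Domain G) = Domain G" "acl (Range G) = Range G"
proof -
  show "fgraph G" "(e1 a, e2 a) \<in> G" "(x, y) \<in> G \<Longrightarrow> x \<in> P1 \<longleftrightarrow> y \<in> P2"
    "free_from P1 (Domain G)" "free_from P2 (Range G)"
    using assms unfolding bf_def by blast+
  show 1: "\<exists>T. finite T \<and> Domain G = acl (range e1 \<union> T)" "\<exists>T. finite T \<and> Range G = acl (range e2 \<union> T)"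
    using assms unfolding bf_def by blast+
  show "acl (Domain G) = Domain G" "acl (Range G) = Range G" using 1 acl_idem by metis+
qed

lemma acl_insert_eq: "acl (insert x (acl (A \<union> T))) = acl (A \<union> insert x T)"
  using acl_Un_acl[of "A \<union> T" "{x}"] by simp

lemma finite_generation_insert:
  assumes "\<exists>T. finite T \<and> D = acl (A \<union> T)"
  shows "\<exists>T. finite T \<and> acl (insert x D) = acl (A \<union> T)"
  using assms acl_insert_eq by (metis finite.insertI)

section \<open>The initial isomorphism and its extension steps\<close>

lemma bf_initial:
  fixes e1 :: "'a::field \<Rightarrow> 'b::field" and e2 :: "'a \<Rightarrow> 'c::field"
  assumes g1: "good_pair C e1 P1" and g2: "good_pair C e2 P2"
  shows "bf e1 P1 e2 P2 (range (\<lambda>a. (e1 a, e2 a)))"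
proof -
  let ?G = "range (\<lambda>a. (e1 a, e2 a))"
  note 1 = good_pairD(2-6)[OF g1] and 2 = good_pairD(2-6)[OF g2]
  have n1: "e1 (- a) = - e1 a" and n2: "e2 (- a) = - e2 a" for a
    using 1(3)[of a "- a"] 2(3)[of a "- a"] 1(1) 2(1) by (simp_all add: eq_neg_iff_add_eq_0 add.commute)
  have z1: "e1 a = 0 \<longleftrightarrow> a = 0" and z2: "e2 a = 0 \<longleftrightarrow> a = 0" for a
    using 1(4)[of a "inverse a"] 2(4)[of a "inverse a"] 1(1,2) 2(1,2) by (cases "a = 0", auto)+
  have i1: "e1 (inverse a) = inverse (e1 a)" and i2: "e2 (inverse a) = inverse (e2 a)" for a
    using 1(4)[of a "inverse a"] 2(4)[of a "inverse a"] 1(1,2) 2(1,2) z1[of a] z2[of a]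
    by (cases "a = 0", auto simp: field_simps)+
  have "fgraph ?G" unfolding fgraph_def
  proof (intro conjI allI impI)
    show "(0, 0) \<in> ?G" "(1, 1) \<in> ?G" using 1 2 by (auto simp: image_iff)
    fix x y assume "(x, y) \<in> ?G"
    then obtain a where a: "x = e1 a" "y = e2 a" by auto
    show "(- x, - y) \<in> ?G" "(inverse x, inverse y) \<in> ?G" "x = 0 \<longleftrightarrow> y = 0"
      unfolding a by (auto simp: image_iff n1[symmetric] n2[symmetric] i1[symmetric] i2[symmetric] z1 z2)
    fix u v assume "(u, v) \<in> ?G"
    then obtain b where b: "u = e1 b" "v = e2 b" by auto
    show "(x + u, y + v) \<in> ?G" "(x * u, y * v) \<in> ?G" unfolding a b
      using 1(3,4)[symmetric] 2(3,4)[symmetric] by (auto simp: image_iff)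
  qed
  moreover have "Domain ?G = range e1" "Range ?G = range e2" by auto
  ultimately show ?thesis unfolding bf_def
    using good_pairD(6,7,9)[OF g1] good_pairD(6,7,9)[OF g2] by (auto intro!: exI[of _ "{}"])
qed

text \<open>A generic step adds no constants: a constant of the new domain is algebraic over old
  ones and so lies in the old domain, which is closed. The partner \<open>y\<close> can therefore be
  prescribed freely among generic elements.\<close>

lemma bf_step_generic:
  fixes e1 :: "'a::field \<Rightarrow> 'b::field" and e2 :: "'a \<Rightarrow> 'c::field"
  assumes ac: "alg_closed_field TYPE('b)" "alg_closed_field TYPE('c)" and G: "bf e1 P1 e2 P2 G"
    and x: "x \<notin> acl (Domain G \<union> P1)" and y: "y \<notin> acl (Range G \<union> P2)"
  shows "\<exists>H. bf e1 P1 e2 P2 H \<and> G \<subseteq> H \<and> (x, y) \<in> H \<and> Domain H = acl (insert x (Domain G)) \<and> Range H = acl (insert y (Range G))"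
proof -
  note B = bfD[OF G]
  have "x \<notin> acl (Domain G)" "y \<notin> acl (Range G)" using x y acl_mono[of "Domain G" "Domain G \<union> P1"] acl_mono[of "Range G" "Range G \<union> P2"] by auto
  from fgraph_adjoin_transcendental[OF B(1) ac this] obtain H where
    H: "fgraph H" "G \<subseteq> H" "(x, y) \<in> H" "Domain H = acl (insert x (Domain G))" "Range H = acl (insert y (Range G))" by blast
  have f: "free_from P1 (Domain H)" "free_from P2 (Range H)"
    unfolding H by (rule free_from_generic_extension[OF B(6) x], rule free_from_generic_extension[OF B(7) y])
  have P: "u \<in> P1 \<longleftrightarrow> v \<in> P2" if uv: "(u, v) \<in> H" for u v
  proof
    assume u: "u \<in> P1"
    have "u \<in> acl ((Domain G \<inter> P1) \<union> {})" by (rule free_from_generic[OF B(6) x _ u]) (use uv H in auto)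
    then have "u \<in> Domain G" using acl_mono[of "Domain G \<inter> P1" "Domain G"] B(8) by auto
    then obtain v' where "(u, v') \<in> G" by blast
    then show "v \<in> P2" using fgraph_eq[OF H(1) uv, of u v'] H(2) B(3)[of u v'] u by blast
  next
    assume v: "v \<in> P2"
    have "v \<in> acl ((Range G \<inter> P2) \<union> {})" by (rule free_from_generic[OF B(7) y _ v]) (use uv H in auto)
    then have "v \<in> Range G" using acl_mono[of "Range G \<inter> P2" "Range G"] B(9) by auto
    then obtain u' where "(u', v) \<in> G" by blast
    then show "u \<in> P1" using fgraph_eq[OF H(1) uv, of u' v] H(2) B(3)[of u' v] v by blast
  qed
  have "bf e1 P1 e2 P2 H" unfolding bf_def
  proof (intro conjI allI impI)
    show "\<exists>T. finite T \<and> Domain H = acl (range e1 \<union> T)" unfolding H by (rule finite_generation_insert[OF B(4)])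
    show "\<exists>T. finite T \<and> Range H = acl (range e2 \<union> T)" unfolding H by (rule finite_generation_insert[OF B(5)])
  qed (use H B(2) f P in auto)
  then show ?thesis using H by blast
qed

lemma bf_step_constant:
  fixes e1 :: "'a::field \<Rightarrow> 'b::field" and e2 :: "'a \<Rightarrow> 'c::field"
  assumes g1: "good_pair C e1 P1" and g2: "good_pair C e2 P2" and G: "bf e1 P1 e2 P2 G"
    and x: "x \<in> P1"
  shows "\<exists>H. bf e1 P1 e2 P2 H \<and> G \<subseteq> H \<and> x \<in> Domain H"
proof (cases "x \<in> Domain G")
  case True then show ?thesis using G by blast
next
  case False
  note B = bfD[OF G]
  obtain T where T: "finite T" "Range G = acl (range e2 \<union> T)" using B(5) by blast
  \<comment> \<open>The range is generated by finitely many elements over \<open>F\<close>, so some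
    constant lies outside it.\<close>
  obtain y where y: "y \<in> P2" "y \<notin> Range G" using good_pairD(10)[OF g2 T(1)] unfolding T by blast
  have "x \<notin> acl (Domain G)" "y \<notin> acl (Range G)" using False y B(8,9) by auto
  from fgraph_adjoin_transcendental[OF B(1) good_pairD(1)[OF g1] good_pairD(1)[OF g2] this] obtain H where
    H: "fgraph H" "G \<subseteq> H" "(x, y) \<in> H" "Domain H = acl (insert x (Domain G))" "Range H = acl (insert y (Range G))" by blast
  have f: "free_from P1 (Domain H)" "free_from P2 (Range H)"
    unfolding H by (rule free_from_constant_extension[OF B(6) x], rule free_from_constant_extension[OF B(7) y(1)])
  have P: "u \<in> P1 \<longleftrightarrow> v \<in> P2" if uv: "(u, v) \<in> H" for u v
  proof
    show "v \<in> P2" if "u \<in> P1"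
      by (rule fgraph_constant_extension[OF H(1-4) B(6) _ x y(1) good_pairD(8)[OF g2] uv that]) (use B(3) in auto)
    show "u \<in> P1" if "v \<in> P2"
      by (rule fgraph_constant_extension[OF fgraph_converse[OF H(1)], of "G\<inverse>" y x P2 P1 v])
        (use H B(3,7) x y uv that good_pairD(8)[OF g1] in auto)
  qed
  have "bf e1 P1 e2 P2 H" unfolding bf_def
  proof (intro conjI allI impI)
    show "\<exists>T. finite T \<and> Domain H = acl (range e1 \<union> T)" unfolding H by (rule finite_generation_insert[OF B(4)])
    show "\<exists>T. finite T \<and> Range H = acl (range e2 \<union> T)" unfolding H by (rule finite_generation_insert[OF B(5)])
  qed (use H B(2) f P in auto)
  then show ?thesis using H by blast
qed

text \<open>Either \<open>x\<close> is algebraic over the domain and finitely many constants;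
  adjoining these constants puts \<open>x\<close> into the new domain, which is closed. Or
  \<open>x\<close> is generic over the constants, and any generic element serves as partner.\<close>

lemma bf_forth:
  fixes e1 :: "'a::field \<Rightarrow> 'b::field" and e2 :: "'a \<Rightarrow> 'c::field"
  assumes g1: "good_pair C e1 P1" and g2: "good_pair C e2 P2" and G: "bf e1 P1 e2 P2 G"
  shows "\<exists>H. bf e1 P1 e2 P2 H \<and> G \<subseteq> H \<and> x \<in> Domain H"
proof (cases "x \<in> acl (Domain G \<union> P1)")
  case True
  from acl_finite_Un[OF this] obtain S where S: "finite S" "S \<subseteq> P1" "x \<in> acl (Domain G \<union> S)" by blast
  from S(1,2) have "\<exists>H. bf e1 P1 e2 P2 H \<and> G \<subseteq> H \<and> S \<subseteq> Domain H"
  proof (induction S rule: finite_induct)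
    case empty then show ?case using G by blast
  next
    case (insert c S)
    then obtain H where H: "bf e1 P1 e2 P2 H" "G \<subseteq> H" "S \<subseteq> Domain H" by auto
    from bf_step_constant[OF g1 g2 H(1), of c] insert obtain H' where "bf e1 P1 e2 P2 H'" "H \<subseteq> H'" "c \<in> Domain H'" by auto
    then show ?case using H by (intro exI[of _ H']) blast
  qed
  then obtain H where H: "bf e1 P1 e2 P2 H" "G \<subseteq> H" "S \<subseteq> Domain H" by blast
  then have "x \<in> acl (Domain H)" using S(3) acl_mono[of "Domain G \<union> S" "Domain H"] by blast
  then show ?thesis using H bfD(8)[OF H(1)] by auto
next
  case False
  obtain T where T: "finite T" "Range G = acl (range e2 \<union> T)" using bfD(5)[OF G] by blast
  obtain y where "y \<notin> acl (range e2 \<union> T \<union> P2)" using good_pairD(11)[OF g2 T(1)] by blast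
  then have "y \<notin> acl (Range G \<union> P2)" unfolding T acl_Un_acl .
  from bf_step_generic[OF good_pairD(1)[OF g1] good_pairD(1)[OF g2] G False this] show ?thesis by blast
qed

section \<open>Preservation of formulas and transfer of independent tuples\<close>

lemma bf_eval_tm:
  assumes G: "bf e1 P1 e2 P2 G"
  shows "nodev_tm t \<Longrightarrow> (\<And>i. i \<in> fv_tm t \<Longrightarrow> (v i, w i) \<in> G) \<Longrightarrow> (eval_tm id e1 v t, eval_tm id e2 w t) \<in> G"
  by (induction t) (auto intro!: bfD(2)[OF G] fgraphD(1-5)[OF bfD(1)[OF G]])

lemma bf_sat:
  fixes e1 :: "'a::field \<Rightarrow> 'b::field" and e2 :: "'a \<Rightarrow> 'c::field"
  assumes g1: "good_pair C e1 P1" and g2: "good_pair C e2 P2"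
  shows "bf e1 P1 e2 P2 G \<Longrightarrow> pair_fm \<phi> \<Longrightarrow> (\<And>i. i \<in> fv \<phi> \<Longrightarrow> (v i, w i) \<in> G) \<Longrightarrow>
    sat id P1 e1 v \<phi> \<longleftrightarrow> sat id P2 e2 w \<phi>"
proof (induction \<phi> arbitrary: G v w)
  case (Eq s t)
  have "(eval_tm id e1 v s, eval_tm id e2 w s) \<in> G" "(eval_tm id e1 v t, eval_tm id e2 w t) \<in> G"
    using Eq by (auto intro!: bf_eval_tm)
  from fgraph_eq[OF bfD(1)[OF Eq(1)] this] show ?case unfolding sat.simps .
next
  case (Pc t)
  have "(eval_tm id e1 v t, eval_tm id e2 w t) \<in> G" using Pc by (auto intro!: bf_eval_tm)
  from bfD(3)[OF Pc(1) this] show ?case unfolding sat.simps .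
next
  case (Not \<phi>) then show ?case by auto
next
  case (Conj \<phi> \<psi>)
  have "sat id P1 e1 v \<phi> \<longleftrightarrow> sat id P2 e2 w \<phi>" using Conj.prems by (intro Conj.IH(1)[of G]) auto
  moreover have "sat id P1 e1 v \<psi> \<longleftrightarrow> sat id P2 e2 w \<psi>" using Conj.prems by (intro Conj.IH(2)[of G]) auto
  ultimately show ?case unfolding sat.simps by blast
next
  case (Ex n \<phi>)
  have "\<exists>y. sat id P2 e2 (w(n := y)) \<phi>" if x: "sat id P1 e1 (v(n := x)) \<phi>" for x
  proof -
    obtain H y where H: "bf e1 P1 e2 P2 H" "G \<subseteq> H" "(x, y) \<in> H" using bf_forth[OF g1 g2 Ex.prems(1)] by blast
    have "sat id P1 e1 (v(n := x)) \<phi> \<longleftrightarrow> sat id P2 e2 (w(n := y)) \<phi>"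
      by (rule Ex.IH[OF H(1)]) (use Ex.prems H in auto)
    then show ?thesis using x by blast
  qed
  moreover have "\<exists>x. sat id P1 e1 (v(n := x)) \<phi>" if y: "sat id P2 e2 (w(n := y)) \<phi>" for y
  proof -
    obtain H x where H: "bf e2 P2 e1 P1 H" "G\<inverse> \<subseteq> H" "(y, x) \<in> H"
      using bf_forth[OF g2 g1 bf_converse[OF Ex.prems(1)]] by blast
    have "sat id P1 e1 (v(n := x)) \<phi> \<longleftrightarrow> sat id P2 e2 (w(n := y)) \<phi>"
      by (rule Ex.IH[OF bf_converse[OF H(1)]]) (use Ex.prems H in auto)
    then show ?thesis using y by blast
  qed
  ultimately show ?case unfolding sat.simps by blast
qed

text \<open>On \<open>I\<close> the partners are prescribed: independence lets both tuples be
  adjoined in parallel by generic steps. The other coordinates of \<open>v\<close> receive partners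
  from \<open>bf_forth\<close>, which is why \<open>w\<close> has to be changed to \<open>w'\<close>
  off \<open>I\<close>.\<close>

lemma generic_transfer:
  fixes e1 :: "'a::field \<Rightarrow> 'b::field" and e2 :: "'a \<Rightarrow> 'c::field" and I :: "nat set"
  assumes g1: "good_pair C e1 P1" and g2: "good_pair C e2 P2" and \<phi>: "pair_fm \<phi>" "fv \<phi> \<subseteq> N" "finite N" and I: "I \<subseteq> N"
    and v: "\<And>i. i \<in> I \<Longrightarrow> v i \<notin> clF e1 P1 (v ` (I - {i}))"
    and w: "\<And>i. i \<in> I \<Longrightarrow> w i \<notin> clF e2 P2 (w ` (I - {i}))" and sat: "sat id P1 e1 v \<phi>"
  shows "\<exists>w'. (\<forall>i\<in>I. w' i = w i) \<and> sat id P2 e2 w' \<phi>"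
proof -
  have "finite I" using \<phi>(3) I by (rule finite_subset[rotated])
  have "\<exists>G. bf e1 P1 e2 P2 G \<and> (\<forall>i\<in>J. (v i, w i) \<in> G) \<and> Domain G = acl (range e1 \<union> v ` J) \<and> Range G = acl (range e2 \<union> w ` J)"
    if "finite J" "J \<subseteq> I" for J
    using that
  proof (induction J rule: finite_induct)
    case empty
    then show ?case using bf_initial[OF g1 g2] good_pairD(7)[OF g1] good_pairD(7)[OF g2]
      by (intro exI[of _ "range (\<lambda>a. (e1 a, e2 a))"]) auto
  next
    case (insert i J)
    then obtain G where G: "bf e1 P1 e2 P2 G" "\<forall>i\<in>J. (v i, w i) \<in> G" "Domain G = acl (range e1 \<union> v ` J)" "Range G = acl (range e2 \<union> w ` J)" by auto
    have "v i \<notin> acl (range e1 \<union> v ` J \<union> P1)"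
      using v[of i] insert acl_mono[of "range e1 \<union> v ` J \<union> P1" "v ` (I - {i}) \<union> range e1 \<union> P1"] unfolding clF_def by blast
    then have 1: "v i \<notin> acl (Domain G \<union> P1)" unfolding G acl_Un_acl .
    have "w i \<notin> acl (range e2 \<union> w ` J \<union> P2)"
      using w[of i] insert acl_mono[of "range e2 \<union> w ` J \<union> P2" "w ` (I - {i}) \<union> range e2 \<union> P2"] unfolding clF_def by blast
    then have 2: "w i \<notin> acl (Range G \<union> P2)" unfolding G acl_Un_acl .
    from bf_step_generic[OF good_pairD(1)[OF g1] good_pairD(1)[OF g2] G(1) 1 2] obtain H where
      "bf e1 P1 e2 P2 H" "G \<subseteq> H" "(v i, w i) \<in> H" "Domain H = acl (insert (v i) (Domain G))" "Range H = acl (insert (w i) (Range G))" by blast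
    then show ?case using G(2) unfolding G(3,4) acl_insert_eq by (intro exI[of _ H]) auto
  qed
  from this[OF \<open>finite I\<close> order_refl] obtain G where G: "bf e1 P1 e2 P2 G" "\<forall>i\<in>I. (v i, w i) \<in> G" by blast
  have "\<exists>H. bf e1 P1 e2 P2 H \<and> G \<subseteq> H \<and> v ` N \<subseteq> Domain H"
    using \<phi>(3)
  proof (induction N rule: finite_induct)
    case empty then show ?case using G by blast
  next
    case (insert i N)
    then obtain H where H: "bf e1 P1 e2 P2 H" "G \<subseteq> H" "v ` N \<subseteq> Domain H" by auto
    from bf_forth[OF g1 g2 H(1), of "v i"] obtain H' where "bf e1 P1 e2 P2 H'" "H \<subseteq> H'" "v i \<in> Domain H'" by auto
    then show ?case using H by (intro exI[of _ H']) blast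
  qed
  then obtain H where H: "bf e1 P1 e2 P2 H" "G \<subseteq> H" "v ` N \<subseteq> Domain H" by blast
  define w' where "w' i = (SOME y. (v i, y) \<in> H)" for i
  have w': "(v i, w' i) \<in> H" if "i \<in> N" for i using H(3) that unfolding w'_def by (auto intro: someI)
  have "w' i = w i" if "i \<in> I" for i
    using fgraph_eq[OF bfD(1)[OF H(1)] w', of i "v i" "w i"] G(2) H(2) I that by blast
  moreover have "sat id P2 e2 w' \<phi>"
    using bf_sat[OF g1 g2 H(1) \<phi>(1), of v w'] w' \<phi>(2) sat by blast
  ultimately show ?thesis by blast
qed

section \<open>Terms and formulas\<close>

text \<open>The simplifier eta-expands function arguments when it applies the recursion equations; the weak
  congruence rules keep it from turning arguments such as \<open>id\<close> into abstractions.\<close>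
lemma eval_tm_weak_cong [cong]: "t = t' \<Longrightarrow> eval_tm D par v t = eval_tm D par v t'" by simp
lemma sat_weak_cong [cong]: "\<phi> = \<phi>' \<Longrightarrow> sat D P par v \<phi> = sat D P par v \<phi>'" by simp

text \<open>Parameters are substituted as well, and their type may change: replacing parameters from
  an extension by variables is how a statement about the extension becomes one over
  \<open>F\<close>.\<close>

primrec tsub :: "(nat \<Rightarrow> 'q tm) \<Rightarrow> ('p \<Rightarrow> 'q tm) \<Rightarrow> 'p tm \<Rightarrow> 'q tm" where
  "tsub \<sigma> \<pi> (Var i) = \<sigma> i" | "tsub \<sigma> \<pi> (Par p) = \<pi> p" | "tsub \<sigma> \<pi> Zero = Zero" | "tsub \<sigma> \<pi> One = One"
| "tsub \<sigma> \<pi> (Add s t) = Add (tsub \<sigma> \<pi> s) (tsub \<sigma> \<pi> t)" | "tsub \<sigma> \<pi> (Mul s t) = Mul (tsub \<sigma> \<pi> s) (tsub \<sigma> \<pi> t)"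
| "tsub \<sigma> \<pi> (Neg s) = Neg (tsub \<sigma> \<pi> s)" | "tsub \<sigma> \<pi> (Der s) = Der (tsub \<sigma> \<pi> s)"

lemma eval_tsub:
  "eval_tm D par v (tsub \<sigma> \<pi> t) = eval_tm D (\<lambda>p. eval_tm D par v (\<pi> p)) (\<lambda>i. eval_tm D par v (\<sigma> i)) t"
  by (induction t) auto

lemma fv_tsub: "fv_tm (tsub \<sigma> \<pi> t) = (\<Union>i\<in>fv_tm t. fv_tm (\<sigma> i)) \<union> (\<Union>p\<in>params_tm t. fv_tm (\<pi> p))"
  by (induction t) auto

lemma params_tsub: "params_tm (tsub \<sigma> \<pi> t) = (\<Union>i\<in>fv_tm t. params_tm (\<sigma> i)) \<union> (\<Union>p\<in>params_tm t. params_tm (\<pi> p))"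
  by (induction t) auto

lemma nodev_tsub:
  "nodev_tm t \<Longrightarrow> (\<And>i. i \<in> fv_tm t \<Longrightarrow> nodev_tm (\<sigma> i)) \<Longrightarrow> (\<And>p. p \<in> params_tm t \<Longrightarrow> nodev_tm (\<pi> p)) \<Longrightarrow> nodev_tm (tsub \<sigma> \<pi> t)"
  by (induction t) auto

lemma eval_tm_cong:
  "(\<And>i. i \<in> fv_tm t \<Longrightarrow> v i = w i) \<Longrightarrow> (\<And>p. p \<in> params_tm t \<Longrightarrow> par p = par' p) \<Longrightarrow> eval_tm D par v t = eval_tm D par' w t"
  by (induction t) auto

lemma eval_tm_nodev: "nodev_tm t \<Longrightarrow> eval_tm D par v t = eval_tm D' par v t"
  by (induction t) auto

lemma sat_cong: "(\<And>i. i \<in> fv \<phi> \<Longrightarrow> v i = w i) \<Longrightarrow> sat D P par v \<phi> \<longleftrightarrow> sat D P par w \<phi>"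
proof (induction \<phi> arbitrary: v w)
  case (Eq s t)
  then have "eval_tm D par v s = eval_tm D par w s" "eval_tm D par v t = eval_tm D par w t" by (auto intro: eval_tm_cong)
  then show ?case by simp
next
  case (Pc t)
  then have "eval_tm D par v t = eval_tm D par w t" by (auto intro: eval_tm_cong)
  then show ?case by simp
next
  case (Not \<phi>)
  then have "sat D P par v \<phi> \<longleftrightarrow> sat D P par w \<phi>" by (intro Not.IH) auto
  then show ?case by simp
next
  case (Conj \<phi> \<psi>)
  have "sat D P par v \<phi> \<longleftrightarrow> sat D P par w \<phi>" "sat D P par v \<psi> \<longleftrightarrow> sat D P par w \<psi>"
    using Conj.prems by (intro Conj.IH; auto)+
  then show ?case by simp
next
  case (Ex n \<phi>)
  have "sat D P par (v(n := x)) \<phi> \<longleftrightarrow> sat D P par (w(n := x)) \<phi>" for x using Ex.prems by (intro Ex.IH) auto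
  then show ?case by simp
qed

lemma finite_fv_tm [simp]: "finite (fv_tm t)" by (induction t) auto
lemma finite_params_tm [simp]: "finite (params_tm t)" by (induction t) auto
lemma finite_fv [simp]: "finite (fv \<phi>)" by (induction \<phi>) auto

definition Exs :: "nat list \<Rightarrow> 'p fm \<Rightarrow> 'p fm" where "Exs xs \<phi> = foldr Ex xs \<phi>"
definition Conjs :: "'p fm list \<Rightarrow> 'p fm" where "Conjs \<phi>s = foldr Conj \<phi>s (Eq Zero Zero)"

lemma sat_Exs: "sat D P par v (Exs xs \<phi>) \<longleftrightarrow> (\<exists>v'. (\<forall>i. i \<notin> set xs \<longrightarrow> v' i = v i) \<and> sat D P par v' \<phi>)"
proof (induction xs arbitrary: v)
  case Nil
  have "v' = v" if "\<forall>i. v' i = v i" for v' using that by auto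
  then show ?case unfolding Exs_def by auto
next
  case (Cons x xs)
  have "sat D P par v (Exs (x # xs) \<phi>) \<longleftrightarrow> (\<exists>a. sat D P par (v(x := a)) (Exs xs \<phi>))" by (simp add: Exs_def)
  also have "\<dots> \<longleftrightarrow> (\<exists>a v'. (\<forall>i. i \<notin> set xs \<longrightarrow> v' i = (v(x := a)) i) \<and> sat D P par v' \<phi>)" by (simp add: Cons.IH)
  also have "\<dots> \<longleftrightarrow> (\<exists>v'. (\<forall>i. i \<notin> set (x # xs) \<longrightarrow> v' i = v i) \<and> sat D P par v' \<phi>)"
  proof
    assume "\<exists>a v'. (\<forall>i. i \<notin> set xs \<longrightarrow> v' i = (v(x := a)) i) \<and> sat D P par v' \<phi>"
    then obtain a v' where *: "\<forall>i. i \<notin> set xs \<longrightarrow> v' i = (v(x := a)) i" "sat D P par v' \<phi>" by blast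
    show "\<exists>v'. (\<forall>i. i \<notin> set (x # xs) \<longrightarrow> v' i = v i) \<and> sat D P par v' \<phi>"
      by (rule exI[of _ v']) (use * in auto)
  next
    assume "\<exists>v'. (\<forall>i. i \<notin> set (x # xs) \<longrightarrow> v' i = v i) \<and> sat D P par v' \<phi>"
    then obtain v' where *: "\<forall>i. i \<notin> set (x # xs) \<longrightarrow> v' i = v i" "sat D P par v' \<phi>" by blast
    show "\<exists>a v'. (\<forall>i. i \<notin> set xs \<longrightarrow> v' i = (v(x := a)) i) \<and> sat D P par v' \<phi>"
      by (rule exI[of _ "v' x"], rule exI[of _ v']) (use * in auto)
  qed
  finally show ?case .
qed

lemma sat_Conjs: "sat D P par v (Conjs \<phi>s) \<longleftrightarrow> (\<forall>\<phi>\<in>set \<phi>s. sat D P par v \<phi>)"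
  by (induction \<phi>s) (auto simp: Conjs_def)

lemma Exs_simps [simp]: "fv (Exs xs \<phi>) = fv \<phi> - set xs" "params (Exs xs \<phi>) = params \<phi>"
    "pair_fm (Exs xs \<phi>) = pair_fm \<phi>" "diff_fm (Exs xs \<phi>) = diff_fm \<phi>"
  unfolding Exs_def by (induction xs) auto

lemma Conjs_simps [simp]: "fv (Conjs \<phi>s) = (\<Union>\<phi>\<in>set \<phi>s. fv \<phi>)" "params (Conjs \<phi>s) = (\<Union>\<phi>\<in>set \<phi>s. params \<phi>)"
    "pair_fm (Conjs \<phi>s) = (\<forall>\<phi>\<in>set \<phi>s. pair_fm \<phi>)" "diff_fm (Conjs \<phi>s) = (\<forall>\<phi>\<in>set \<phi>s. diff_fm \<phi>)"
  unfolding Conjs_def by (induction \<phi>s) auto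

lemma sat_closure:
  assumes "fv \<phi> \<subseteq> set xs"
  shows "sat D P par v (Exs xs \<phi>) \<longleftrightarrow> (\<exists>v'. sat D P par v' \<phi>)"
proof
  assume "\<exists>v'. sat D P par v' \<phi>"
  then obtain v' where v': "sat D P par v' \<phi>" by blast
  have "sat D P par (\<lambda>i. if i \<in> set xs then v' i else v i) \<phi>"
    by (subst sat_cong[where w = v']) (use v' assms in auto)
  then show "sat D P par v (Exs xs \<phi>)" unfolding sat_Exs
    by (intro exI[of _ "\<lambda>i. if i \<in> set xs then v' i else v i"]) auto
qed (auto simp: sat_Exs)

text \<open>Elementarity speaks only about valuations coming from \<open>F\<close>. Passing to a
  sentence by quantifying all variables gives validity at arbitrary valuations in the
  extension.\<close>

lemma pair_transfer:
  fixes \<phi> :: "'a::field fm"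
  assumes "pair_elem_ext C e P" "pair_fm \<phi>"
  shows "(\<forall>v. sat id C id v \<phi>) \<longleftrightarrow> (\<forall>w. sat id P e w \<phi>)"
proof -
  obtain xs where xs: "set xs = fv \<phi>" using finite_list[OF finite_fv] by blast
  let ?\<psi> = "Exs xs (Not \<phi>)"
  have "sat id C id (\<lambda>_. 0) ?\<psi> \<longleftrightarrow> sat id P e (e \<circ> (\<lambda>_. 0)) ?\<psi>"
    using assms unfolding pair_elem_ext_def by simp
  then show ?thesis by (simp only: sat_closure[of "Not \<phi>" xs, simplified xs, simplified] sat.simps) blast
qed

lemma K_transfer:
  fixes \<phi> :: "'a::field fm"
  assumes "K_elem_ext d e ds" "diff_fm \<phi>"
  shows "(\<forall>v. sat d {} id v \<phi>) \<longleftrightarrow> (\<forall>w. sat ds {} e w \<phi>)"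
proof -
  obtain xs where xs: "set xs = fv \<phi>" using finite_list[OF finite_fv] by blast
  let ?\<psi> = "Exs xs (Not \<phi>)"
  have "sat d {} id (\<lambda>_. 0) ?\<psi> \<longleftrightarrow> sat ds {} e (e \<circ> (\<lambda>_. 0)) ?\<psi>"
    using assms unfolding K_elem_ext_def by simp
  then show ?thesis by (simp only: sat_closure[of "Not \<phi>" xs, simplified xs, simplified] sat.simps) blast
qed

section \<open>The pair as a reduct of the differential field\<close>

primrec elim_Pc :: "'p fm \<Rightarrow> 'p fm" where
  "elim_Pc (Eq s t) = Eq s t" | "elim_Pc (Pc t) = Eq (Der t) Zero" | "elim_Pc (Not \<phi>) = Not (elim_Pc \<phi>)"
| "elim_Pc (Conj \<phi> \<psi>) = Conj (elim_Pc \<phi>) (elim_Pc \<psi>)" | "elim_Pc (Ex n \<phi>) = Ex n (elim_Pc \<phi>)"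

lemma elim_Pc_simps [simp]: "fv (elim_Pc \<phi>) = fv \<phi>" "params (elim_Pc \<phi>) = params \<phi>" "diff_fm (elim_Pc \<phi>)"
  by (induction \<phi>) auto

lemma sat_elim_Pc: "pair_fm \<phi> \<Longrightarrow> sat D {} par v (elim_Pc \<phi>) \<longleftrightarrow> sat id {x. D x = 0} par v \<phi>"
proof (induction \<phi> arbitrary: v)
  case (Eq s t)
  then show ?case using eval_tm_nodev[of s D par v id] eval_tm_nodev[of t D par v id] by auto
next
  case (Pc t)
  then show ?case using eval_tm_nodev[of t D par v id] by auto
qed auto

lemma K_reduct_elem_ext: "K_elem_ext d e ds \<Longrightarrow> pair_elem_ext {x. d x = 0} e {x. ds x = 0}"
  unfolding pair_elem_ext_def K_elem_ext_def by (metis elim_Pc_simps(3) sat_elim_Pc)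

text \<open>Translation by \<open>elim_Pc\<close> keeps free variables and parameters, so a type of
  the pair becomes a differential type over the same parameters.\<close>

lemma K_reduct_saturated:
  assumes "K_saturated F ds" shows "pair_saturated F {x. ds x = 0}"
  unfolding pair_saturated_def
proof (intro allI impI)
  fix \<Phi> :: "'b fm set"
  assume 1: "\<forall>\<phi>\<in>\<Phi>. pair_fm \<phi> \<and> fv \<phi> \<subseteq> {0}" and 2: "(card_of (\<Union>\<phi>\<in>\<Phi>. params \<phi>), card_of F) \<in> ordLeq"
    and 3: "\<forall>\<Psi>\<subseteq>\<Phi>. finite \<Psi> \<longrightarrow> (\<exists>v. \<forall>\<phi>\<in>\<Psi>. sat id {x. ds x = 0} id v \<phi>)"
  have "\<exists>v. \<forall>\<phi>\<in>elim_Pc ` \<Phi>. sat ds {} id v \<phi>"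
  proof (rule assms[unfolded K_saturated_def, rule_format])
    show "diff_fm \<phi> \<and> fv \<phi> \<subseteq> {0}" if "\<phi> \<in> elim_Pc ` \<Phi>" for \<phi> using that 1 by fastforce
    show "(card_of (\<Union>\<phi>\<in>elim_Pc ` \<Phi>. params \<phi>), card_of F) \<in> ordLeq" using 2 by simp
    fix \<Psi> assume "\<Psi> \<subseteq> elim_Pc ` \<Phi>" "finite \<Psi>"
    then obtain \<Psi>' where p: "\<Psi>' \<subseteq> \<Phi>" "finite \<Psi>'" "\<Psi> = elim_Pc ` \<Psi>'" by (meson finite_subset_image)
    then obtain v where v: "\<forall>\<phi>\<in>\<Psi>'. sat id {x. ds x = 0} id v \<phi>" using 3 by blast
    have "sat ds {} id v (elim_Pc \<phi>)" if "\<phi> \<in> \<Psi>'" for \<phi>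
      using sat_elim_Pc[of \<phi> ds id v] 1 p(1) v that by blast
    then show "\<exists>v. \<forall>\<phi>\<in>\<Psi>. sat ds {} id v \<phi>" unfolding p(3) by blast
  qed
  then obtain v where v: "\<forall>\<phi>\<in>\<Phi>. sat ds {} id v (elim_Pc \<phi>)" by blast
  have "sat id {x. ds x = 0} id v \<phi>" if "\<phi> \<in> \<Phi>" for \<phi>
    using sat_elim_Pc[of \<phi> ds id v] 1 v that by blast
  then show "\<exists>v. \<forall>\<phi>\<in>\<Phi>. sat id {x. ds x = 0} id v \<phi>" by blast
qed

text \<open>Variable 0 is the indeterminate; parameters and the values of the other variables enter
  the coefficients.\<close>

lemma term_poly:
  assumes "nodev_tm t"
  shows "\<exists>p. (\<forall>u. poly p u = eval_tm id id (w(0 := u)) t) \<and> (\<forall>i. coeff p i \<in> subfield_gen (params_tm t \<union> w ` (fv_tm t - {0})))"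
proof -
  have "\<exists>p. (\<forall>u. poly p u = eval_tm id id (w(0 := u)) t) \<and> (\<forall>i. coeff p i \<in> K)"
    if K: "subfld K" "params_tm t \<subseteq> K" "w ` (fv_tm t - {0}) \<subseteq> K" "nodev_tm t" for K
    using K(2-)
  proof (induction t)
    case (Var i)
    show ?case
    proof (cases "i = 0")
      case True
      then show ?thesis by (intro exI[of _ "[:0, 1:]"]) (auto simp: coeff_pCons subfldD[OF K(1)] split: nat.splits)
    next
      case False
      then show ?thesis using Var by (intro exI[of _ "[:w i:]"]) (auto simp: coeff_pCons subfldD[OF K(1)] split: nat.splits)
    qed
  next
    case (Par a)
    then show ?case by (intro exI[of _ "[:a:]"]) (auto simp: coeff_pCons subfldD[OF K(1)] split: nat.splits)
  next
    case Zero then show ?case by (intro exI[of _ 0]) (auto simp: subfldD[OF K(1)])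
  next
    case One then show ?case by (intro exI[of _ 1]) (auto simp: subfldD[OF K(1)] coeff_1)
  next
    case (Add s t)
    then have "w ` (fv_tm s - {0}) \<subseteq> K" "w ` (fv_tm t - {0}) \<subseteq> K" by auto
    then obtain p q where "\<forall>u. poly p u = eval_tm id id (w(0 := u)) s" "\<forall>i. coeff p i \<in> K"
      "\<forall>u. poly q u = eval_tm id id (w(0 := u)) t" "\<forall>i. coeff q i \<in> K" using Add by auto
    then show ?case by (intro exI[of _ "p + q"]) (auto simp: subfldD[OF K(1)])
  next
    case (Mul s t)
    then have "w ` (fv_tm s - {0}) \<subseteq> K" "w ` (fv_tm t - {0}) \<subseteq> K" by auto
    then obtain p q where "\<forall>u. poly p u = eval_tm id id (w(0 := u)) s" "\<forall>i. coeff p i \<in> K"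
      "\<forall>u. poly q u = eval_tm id id (w(0 := u)) t" "\<forall>i. coeff q i \<in> K" using Mul by auto
    then show ?case by (intro exI[of _ "p * q"]) (auto simp: subfldD[OF K(1)] coeff_mult intro!: subfld_sum[OF K(1)])
  next
    case (Neg s)
    then obtain p where "\<forall>u. poly p u = eval_tm id id (w(0 := u)) s" "\<forall>i. coeff p i \<in> K" by auto
    then show ?case by (intro exI[of _ "- p"]) (auto simp: subfldD[OF K(1)])
  qed auto
  from this[OF subfld_subfield_gen _ _ assms, of "params_tm t \<union> w ` (fv_tm t - {0})"] subfield_gen_superset[of "params_tm t \<union> w ` (fv_tm t - {0})"]
  show ?thesis by auto
qed

lemma term_root_in_acl:
  assumes t: "nodev_tm t" and S: "params_tm t \<subseteq> S" "\<And>i. i \<in> fv_tm t \<Longrightarrow> i \<noteq> 0 \<Longrightarrow> w i \<in> S"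
    and x: "eval_tm id id (w(0 := x)) t = 0" and u: "eval_tm id id (w(0 := u)) t \<noteq> 0"
  shows "x \<in> acl S"
proof -
  obtain p where p: "\<forall>u. poly p u = eval_tm id id (w(0 := u)) t" "\<forall>i. coeff p i \<in> subfield_gen (params_tm t \<union> w ` (fv_tm t - {0}))"
    using term_poly[OF t] by blast
  have "params_tm t \<union> w ` (fv_tm t - {0}) \<subseteq> S" using S by auto
  from subfield_gen_mono[OF this] p(2) have "\<forall>i. coeff p i \<in> subfield_gen S" by blast
  moreover have "p \<noteq> 0" using p(1) u by force
  moreover have "poly p x = 0" using p(1) x by simp
  ultimately show ?thesis unfolding acl_def by blast
qed

text \<open>Terms have no division, so denominators are cleared in the ring \<open>R\<close> of
  values of closed terms. That the polynomial is nonzero is replaced by a point where the term does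
  not vanish, which exists in an infinite field.\<close>

lemma acl_term:
  fixes x :: "'b::field"
  assumes inf: "infinite (UNIV :: 'b set)" and x: "x \<in> acl S"
  shows "\<exists>t. nodev_tm t \<and> params_tm t \<subseteq> S \<and> fv_tm t \<subseteq> {0} \<and> eval_tm id id (\<lambda>_. x) t = 0 \<and> (\<exists>u. eval_tm id id (\<lambda>_. u) t \<noteq> 0)"
proof -
  define R where "R = {eval_tm id id (\<lambda>_. 0) t | t. nodev_tm t \<and> params_tm t \<subseteq> S \<and> fv_tm t = {}}"
  have RI: "eval_tm id id (\<lambda>_. 0) t \<in> R" if "nodev_tm t" "params_tm t \<subseteq> S" "fv_tm t = {}" for t
    using that unfolding R_def by blast
  have R0: "0 \<in> R" and R1: "1 \<in> R" using RI[of Zero] RI[of One] by simp_all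
  have Ra: "a + b \<in> R" and Rm: "a * b \<in> R" if ab: "a \<in> R" "b \<in> R" for a b
  proof -
    from ab obtain s t where st: "nodev_tm s" "params_tm s \<subseteq> S" "fv_tm s = {}" "a = eval_tm id id (\<lambda>_. 0) s"
       "nodev_tm t" "params_tm t \<subseteq> S" "fv_tm t = {}" "b = eval_tm id id (\<lambda>_. 0) t" unfolding R_def by blast
    show "a + b \<in> R" "a * b \<in> R" using RI[of "Add s t"] RI[of "Mul s t"] st by simp_all
  qed
  have Rn: "- a \<in> R" if ab: "a \<in> R" for a
  proof -
    from ab obtain s where st: "nodev_tm s" "params_tm s \<subseteq> S" "fv_tm s = {}" "a = eval_tm id id (\<lambda>_. 0) s" unfolding R_def by blast
    show "- a \<in> R" using RI[of "Neg s"] st by simp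
  qed
  have "z \<in> R" if "z \<in> S" for z using RI[of "Par z"] that by simp
  then have SR: "S \<subseteq> R" by blast
  from x obtain p where p: "p \<noteq> 0" "\<forall>i. coeff p i \<in> subfield_gen S" "poly p x = 0" unfolding acl_def by blast
  from clear_denominators[OF R0 R1 Rm subfield_gen_fraction[OF SR R0 R1 Ra Rm Rn] p(2)] obtain D where D: "D \<noteq> 0" "\<forall>i. D * coeff p i \<in> R" by blast
  define q where "q = smult D p"
  have q: "q \<noteq> 0" "\<forall>i. coeff q i \<in> R" "poly q x = 0" using p D unfolding q_def by auto
  have "\<exists>t. nodev_tm t \<and> params_tm t \<subseteq> S \<and> fv_tm t \<subseteq> {0} \<and> (\<forall>u. eval_tm id id (\<lambda>_. u) t = poly q u)" using q(2)
  proof (induction q)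
    case 0 show ?case by (intro exI[of _ Zero]) auto
  next
    case (pCons a q)
    have "\<forall>i. coeff q i \<in> R" using pCons.prems by (metis coeff_pCons_Suc)
    then obtain t where t: "nodev_tm t" "params_tm t \<subseteq> S" "fv_tm t \<subseteq> {0}" "\<forall>u. eval_tm id id (\<lambda>_. u) t = poly q u"
      using pCons.IH by blast
    have "a \<in> R" using pCons.prems[rule_format, of 0] by simp
    then obtain s where s: "nodev_tm s" "params_tm s \<subseteq> S" "fv_tm s = {}" "a = eval_tm id id (\<lambda>_. 0) s" unfolding R_def by blast
    have "eval_tm id id (\<lambda>_. u) s = a" for u unfolding s(4) using s(3) by (intro eval_tm_cong) auto
    then show ?case using s t by (intro exI[of _ "Add s (Mul (Var 0) t)"]) auto
  qed
  then obtain t where t: "nodev_tm t" "params_tm t \<subseteq> S" "fv_tm t \<subseteq> {0}" "\<forall>u. eval_tm id id (\<lambda>_. u) t = poly q u" by blast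
  have "\<exists>u. poly q u \<noteq> 0" using poly_roots_finite[OF q(1)] inf by (metis (mono_tags, lifting) UNIV_eq_I mem_Collect_eq)
  then show ?thesis using t q(3) by (intro exI[of _ t]) auto
qed

section \<open>Elementary extensions of the pair\<close>

lemma pair_elem_extD: "pair_elem_ext C e P \<Longrightarrow> pair_fm \<phi> \<Longrightarrow> sat id C id v \<phi> \<longleftrightarrow> sat id P e (e \<circ> v) \<phi>"
  unfolding pair_elem_ext_def by blast

lemma pair_transferD:
  fixes \<phi> :: "'a::field fm"
  shows "pair_elem_ext C e P \<Longrightarrow> (\<And>v. sat id C id v \<phi>) \<Longrightarrow> pair_fm \<phi> \<Longrightarrow> sat id P e w \<phi>"
  using pair_transfer by blast

lemma pair_elem_ext_hom:
  assumes E: "pair_elem_ext C e P"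
  shows "e 0 = 0" "e 1 = 1" "e (x + y) = e x + e y" "e (x * y) = e x * e y" "e (- x) = - e x"
    "e x = e y \<longleftrightarrow> x = y" "e x \<in> P \<longleftrightarrow> x \<in> C"
  using pair_elem_extD[OF E, of "Eq (Par 0) Zero"] pair_elem_extD[OF E, of "Eq (Par 1) One"]
    pair_elem_extD[OF E, of "Eq (Par (x + y)) (Add (Par x) (Par y))"]
    pair_elem_extD[OF E, of "Eq (Par (x * y)) (Mul (Par x) (Par y))"]
    pair_elem_extD[OF E, of "Eq (Par (- x)) (Neg (Par x))"]
    pair_elem_extD[OF E, of "Eq (Par x) (Par y)"] pair_elem_extD[OF E, of "Pc (Par x)"] by simp_all

lemma pair_elem_ext_of_nat:
  fixes e :: "'a::field_char_0 \<Rightarrow> 'b::field"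
  assumes E: "pair_elem_ext C e P"
  shows "e (of_nat n) = of_nat n" "(of_nat m :: 'b) = of_nat n \<longleftrightarrow> m = n"
proof -
  have *: "e (of_nat n) = of_nat n" for n
    by (induction n) (auto simp: pair_elem_ext_hom[OF E])
  show "e (of_nat n) = of_nat n" by (rule *)
  show "(of_nat m :: 'b) = of_nat n \<longleftrightarrow> m = n" unfolding *[symmetric] pair_elem_ext_hom(6)[OF E] by simp
qed

section \<open>Properties inherited by elementarity\<close>

primrec horner :: "nat \<Rightarrow> nat \<Rightarrow> 'p tm" where
  "horner 0 j = Var j" | "horner (Suc n) j = Add (Var j) (Mul (Var 0) (horner n (Suc j)))"

lemma eval_horner: "eval_tm D par v (horner n j) = (\<Sum>i\<le>n. v (j + i) * v 0 ^ i)"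
  by (induction n arbitrary: j) (simp_all add: sum.atMost_Suc_shift sum_distrib_left mult_ac del: sum.atMost_Suc)

lemma nodev_horner [simp]: "nodev_tm (horner n j)"
  by (induction n arbitrary: j) auto

lemma pair_elem_ext_alg_closed:
  fixes e :: "'a::field \<Rightarrow> 'b::field"
  assumes E: "pair_elem_ext C e P" and ac: "alg_closed_field TYPE('a)"
  shows "alg_closed_field TYPE('b)"
  unfolding alg_closed_field_def
proof (intro allI impI)
  fix p :: "'b poly" assume p: "degree p > 0"
  define n where "n = degree p"
  \<comment> \<open>Variable 0 is the unknown, so coefficient \<open>i\<close> sits at variable
    \<open>i + 1\<close> and the leading one at \<open>Var (Suc n)\<close>.\<close>
  let ?\<phi> = "Not (Conj (Not (Eq (Var (Suc n)) Zero)) (Not (Ex 0 (Eq (horner n 1) Zero)))) :: 'a fm"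
  have "sat id P e (\<lambda>i. coeff p (i - 1)) ?\<phi>"
  proof (rule pair_transferD[OF E])
    fix v :: "nat \<Rightarrow> 'a"
    show "sat id C id v ?\<phi>"
    proof (cases "v (Suc n) = 0")
      case False
      let ?q = "\<Sum>i\<le>n. monom (v (Suc i)) i"
      have c: "coeff ?q i = (if i \<le> n then v (Suc i) else 0)" for i by (simp add: coeff_sum)
      then have "coeff ?q n \<noteq> 0" using False by simp
      then have "degree ?q \<ge> n" by (rule le_degree)
      then obtain x where x: "poly ?q x = 0" using ac p unfolding alg_closed_field_def n_def[symmetric]
        by (metis less_le_trans)
      then show ?thesis by (auto simp: eval_horner poly_sum poly_monom)
    qed simp
  qed simp
  moreover have "coeff p n \<noteq> 0" using p unfolding n_def by auto
  ultimately show "\<exists>x. poly p x = 0" by (auto simp: eval_horner poly_altdef n_def)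
qed

lemma pair_elem_ext_subfld:
  assumes E: "pair_elem_ext C e P" and C: "subfld C"
  shows "subfld P"
proof -
  let ?a = "Not (Conj (Pc (Var 0)) (Conj (Pc (Var 1)) (Not (Pc (Add (Var 0) (Var 1))))))"
  let ?m = "Not (Conj (Pc (Var 0)) (Conj (Pc (Var 1)) (Not (Pc (Mul (Var 0) (Var 1))))))"
  let ?n = "Not (Conj (Pc (Var 0)) (Not (Pc (Neg (Var 0)))))"
  \<comment> \<open>The language has no inverse; it is described by a product equal to 1.\<close>
  let ?i = "Not (Conj (Pc (Var 0)) (Conj (Eq (Mul (Var 0) (Var 1)) One) (Not (Pc (Var 1)))))"
  note CC = subfldD[OF C]
  have 0: "0 \<in> P" "1 \<in> P" using pair_elem_ext_hom[OF E] CC by metis+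
  have 1: "sat id P e v ?a" "sat id P e v ?m" "sat id P e v ?n" for v
    by (rule pair_transferD[OF E]; use CC in auto)+
  have "x \<in> C \<Longrightarrow> x * y = 1 \<Longrightarrow> y \<in> C" for x y using CC(6)[of x] inverse_unique[of x y] by simp
  then have 2: "sat id P e v ?i" for v by (intro pair_transferD[OF E]) auto
  have 3: "x + y \<in> P" "x * y \<in> P" if "x \<in> P" "y \<in> P" for x y
    using 1(1)[of "(\<lambda>_. y)(0 := x)"] 1(2)[of "(\<lambda>_. y)(0 := x)"] that by auto
  have 4: "- x \<in> P" if "x \<in> P" for x using 1(3)[of "\<lambda>_. x"] that by auto
  have 5: "inverse x \<in> P" if "x \<in> P" for x
  proof (cases "x = 0")
    case False then show ?thesis using 2[of "(\<lambda>_. inverse x)(0 := x)"] that by auto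
  qed (simp add: 0)
  show ?thesis unfolding subfld_def using 0 3 4 5 by auto
qed

lemma pair_elem_ext_acl:
  assumes E: "pair_elem_ext C e P" and C: "acl C = C"
  shows "acl P = P"
proof -
  have sC: "subfld C" using subfld_acl[of C] C by simp
  note sP = pair_elem_ext_subfld[OF E sC]
  have "x \<in> P" if "x \<in> acl P" for x
  proof -
    from that have "x \<in> algover P" using acl_subfld_eq[OF sP] by simp
    then obtain N k j where k: "\<And>i. k i \<in> P" "j \<le> N" "k j \<noteq> 0" "(\<Sum>i\<le>N. k i * x ^ i) = 0" using algoverE by metis
    let ?\<phi> = "Not (Conj (Conjs (map (\<lambda>i. Pc (Var (Suc i))) [0..<Suc N])) (Conj (Not (Eq (Var (Suc j)) Zero))
       (Conj (Eq (horner N 1) Zero) (Not (Pc (Var 0))))))"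
    have "sat id P e (\<lambda>i. if i = 0 then x else k (i - 1)) ?\<phi>"
    proof (rule pair_transferD[OF E])
      fix v
      have "v (Suc j) = 0 \<or> v 0 \<in> C" if "\<forall>i<Suc N. v (Suc i) \<in> C" "(\<Sum>i\<le>N. v (Suc i) * v 0 ^ i) = 0"
        using algoverI[of C N "\<lambda>i. v (Suc i)" j "v 0"] that k(2) subfldD[OF sC] acl_subfld_eq[OF sC] C by auto
      then show "sat id C id v ?\<phi>" by (auto simp: sat_Conjs eval_horner simp del: upt_Suc)
    qed auto
    then show ?thesis using k by (auto simp: sat_Conjs eval_horner)
  qed
  then show ?thesis using acl_superset[of P] by blast
qed

text \<open>Linear factors are split off in \<open>F\<close>, and the factorization is carried over
  to the extension, so a root of the image is the image of a root. The embedding is treated as a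
  partial isomorphism \<open>G\<close> defined everywhere, so that \<open>prel_divide\<close>
  applies.\<close>

lemma acl_range_alg_closed:
  fixes e :: "'a::field \<Rightarrow> 'b::field"
  assumes E: "pair_elem_ext C e P" and ac: "alg_closed_field TYPE('a)"
  shows "acl (range e) = range e"
proof -
  note H = pair_elem_ext_hom[OF E]
  have inv: "e (inverse x) = inverse (e x)" for x
    using H(4)[of x "inverse x"] H(1,2) H(6)[of x 0] by (cases "x = 0") (auto simp: field_simps)
  define G where "G = range (\<lambda>a. (a, e a))"
  have G: "fgraph G" unfolding fgraph_def G_def using H(6)[of _ 0] by (auto simp: image_iff H(1-5) inv)
  have R: "Range G = range e" "Domain G = UNIV" unfolding G_def by auto
  have main: "prel G q p \<Longrightarrow> p \<noteq> 0 \<Longrightarrow> poly p x = 0 \<Longrightarrow> x \<in> range e" for q p x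
  proof (induction "degree q" arbitrary: q p rule: less_induct)
    case less
    have q0: "q \<noteq> 0" using less prel_0[OF G] by blast
    have "degree p > 0" using less by (cases "degree p = 0") (auto elim!: degree_eq_zeroE)
    then have "degree q > 0" using prel_degree[OF G less(2)] by simp
    then obtain a where a: "poly q a = 0" using ac unfolding alg_closed_field_def by blast
    let ?m = "[:- a, 1:]" and ?m' = "[:- e a, 1:]"
    have m: "prel G ?m ?m'" using fgraphD[OF G] prel_intros[OF G] by (auto simp: prel_pCons G_def H)
    obtain s s' t t' where st: "prel G s s'" "prel G t t'" "q = s * ?m + t" "p = s' * ?m' + t'" "\<forall>i\<ge>degree ?m. coeff t i = 0"
      using prel_divide[OF G m _ less(2)] by auto
    have "degree t \<le> 0" by (rule degree_le) (use st(5) in auto)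
    then have "degree t = 0" by simp
    then obtain c where "t = [:c:]" by (rule degree_eq_zeroE)
    then have "t = 0" using a st(3) by simp
    then have "t' = 0" using prel_0[OF G st(2)] by simp
    with st \<open>t = 0\<close> have q: "q = s * ?m" "p = s' * ?m'" by auto
    have s: "s \<noteq> 0" "s' \<noteq> 0" using q q0 less by auto
    then have dq: "degree q = degree s + 1" unfolding q(1) by (subst degree_mult_eq) auto
    show ?case
    proof (cases "x = e a")
      case False
      then have "poly s' x = 0" using less(4) q by simp
      then show ?thesis using less(1)[OF _ st(1) s(2)] dq by simp
    qed simp
  qed
  have "x \<in> range e" if "x \<in> acl (range e)" for x
  proof -
    have "subfld (range e)" using subfld_Range[OF G] R by simp
    with that have "x \<in> algover (range e)" using acl_subfld_eq by blast
    then obtain p where p: "p \<noteq> 0" "\<forall>i. coeff p i \<in> Domain (G\<inverse>)" "poly p x = 0" unfolding algover_def using R by auto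
    obtain q where "prel (G\<inverse>) p q" using prel_exists[OF fgraph_converse[OF G] p(2)] by blast
    then show ?thesis using main p by (auto simp: prel_converse)
  qed
  then show ?thesis using acl_superset[of "range e"] by blast
qed

text \<open>This is the linear disjointness of \<open>F\<close> and the new constants over
  \<open>C\<close>. The coefficients are quantified and only the \<open>f k\<close> from
  \<open>F\<close> are named, so the relation is a sentence over \<open>F\<close>. Keeping the index
  \<open>j\<close> of a nonzero coefficient allows \<open>f j\<close> to be eliminated
  later.\<close>

lemma linear_dependence_descends:
  fixes e :: "'a::field \<Rightarrow> 'b::field"
  assumes E: "pair_elem_ext C e P" and L: "finite (L :: nat set)" "j \<in> L"
    and c: "\<And>k. k \<in> L \<Longrightarrow> c k \<in> P" "c j \<noteq> 0" "(\<Sum>k\<in>L. c k * e (f k)) = 0"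
  shows "\<exists>\<kappa>. (\<forall>k\<in>L. \<kappa> k \<in> C) \<and> \<kappa> j \<noteq> 0 \<and> (\<Sum>k\<in>L. \<kappa> k * f k) = 0"
proof -
  obtain xs where xs: "set xs = L" "distinct xs" using finite_distinct_list[OF L(1)] by blast
  define s where "s = foldr (\<lambda>k t. Add (Mul (Var k) (Par (f k))) t) xs Zero"
  have s: "nodev_tm s" unfolding s_def by (induction xs) auto
  have "eval_tm D par v (foldr (\<lambda>k t. Add (Mul (Var k) (Par (f k))) t) ys Zero) = (\<Sum>k\<leftarrow>ys. v k * par (f k))" for D v par ys
    by (induction ys) auto
  then have ev: "eval_tm D par v s = (\<Sum>k\<in>L. v k * par (f k))" for D v par
    unfolding s_def xs(1)[symmetric] sum_list_distinct_conv_sum_set[OF xs(2), symmetric] .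
  let ?\<phi> = "Conj (Conjs (map (\<lambda>k. Pc (Var k)) xs)) (Conj (Not (Eq (Var j) Zero)) (Eq s Zero))"
  have p: "pair_fm ?\<phi>" using s by auto
  have "\<not> (\<forall>v. sat id P e v (Not ?\<phi>))" using c xs(1) by (auto simp: sat_Conjs ev intro!: exI[of _ c])
  then have "\<not> (\<forall>v. sat id C id v (Not ?\<phi>))" using pair_transfer[OF E, of "Not ?\<phi>"] p by simp
  then obtain v where "sat id C id v ?\<phi>" by auto
  then show ?thesis using xs(1) by (intro exI[of _ v]) (auto simp: sat_Conjs ev)
qed

text \<open>For a field embedding \<open>e\<close> and a subfield \<open>R\<close> this is the ring
  generated by \<open>range e\<close> and \<open>R\<close>.\<close>

inductive_set lincomb :: "('a \<Rightarrow> 'b::field) \<Rightarrow> 'b set \<Rightarrow> 'b set" for e R where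
  "0 \<in> lincomb e R" | "t \<in> lincomb e R \<Longrightarrow> s \<in> R \<Longrightarrow> e f * s + t \<in> lincomb e R"

lemma lincomb_add: "x \<in> lincomb e R \<Longrightarrow> y \<in> lincomb e R \<Longrightarrow> x + y \<in> lincomb e R"
  by (induction rule: lincomb.induct) (auto simp: add.assoc intro: lincomb.intros)

lemma lincomb_mult:
  assumes e: "\<And>x y. e (x * y) = e x * e y" and R: "subfld R"
  shows "x \<in> lincomb e R \<Longrightarrow> y \<in> lincomb e R \<Longrightarrow> x * y \<in> lincomb e R"
proof (induction rule: lincomb.induct)
  case 1 show ?case by (simp add: lincomb.intros)
next
  case (2 t s f)
  have "(e f * s) * y \<in> lincomb e R" using \<open>y \<in> lincomb e R\<close>
  proof (induction rule: lincomb.induct)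
    case 1 show ?case by (simp add: lincomb.intros)
  next
    case (2 t s' f')
    have "e (f * f') * (s * s') + e f * s * t \<in> lincomb e R"
      using 2 \<open>s \<in> R\<close> subfldD[OF R] by (intro lincomb.intros) auto
    then show ?case by (simp add: e algebra_simps)
  qed
  then show ?case using 2 by (simp add: distrib_right lincomb_add)
qed

text \<open>A polynomial over that ring is regrouped by the elements of \<open>F\<close>, so that
  each \<open>q k\<close> has its coefficients in \<open>R\<close>.\<close>

lemma lincomb_poly:
  assumes R: "subfld R" and p: "\<forall>i. coeff p i \<in> lincomb e R"
  shows "\<exists>n f q. (\<forall>k i. coeff (q k) i \<in> R) \<and> p = (\<Sum>k<(n::nat). smult (e (f k)) (q k))"
proof -
  define T where "T = {p. \<exists>n f q. (\<forall>k i. coeff (q k) i \<in> R) \<and> p = (\<Sum>k<(n::nat). smult (e (f k)) (q k))}"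
  note RR = subfldD[OF R]
  have T0: "0 \<in> T" unfolding T_def using RR by (auto intro!: exI[of _ 0] exI[of _ "\<lambda>_. 0"])
  have TS: "smult (e g) r + p \<in> T" if "p \<in> T" "\<forall>i. coeff r i \<in> R" for p g r
  proof -
    from that obtain n f q where q: "\<forall>k i. coeff (q k) i \<in> R" "p = (\<Sum>k<(n::nat). smult (e (f k)) (q k))" unfolding T_def by blast
    show ?thesis unfolding T_def
      by (rule CollectI, rule exI[of _ "Suc n"], rule exI[of _ "f(n := g)"], rule exI[of _ "q(n := r)"])
        (use q that(2) in \<open>auto simp: add.commute intro!: arg_cong2[where f = "(+)"] sum.cong\<close>)
  qed
  have Tp: "pCons 0 p \<in> T" if "p \<in> T" for p
  proof -
    from that obtain n f q where q: "\<forall>k i. coeff (q k) i \<in> R" "p = (\<Sum>k<(n::nat). smult (e (f k)) (q k))" unfolding T_def by blast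
    have "pCons 0 (\<Sum>k<m. smult (e (f k)) (q k)) = (\<Sum>k<m. smult (e (f k)) (pCons 0 (q k)))" for m
    proof (induction m)
      case (Suc m)
      have "pCons 0 (a + b) = pCons 0 a + pCons 0 b" for a b :: "'a poly" by simp
      then show ?case using Suc.IH by (simp only: sum.lessThan_Suc) simp
    qed simp
    moreover have "coeff (pCons 0 (q k)) i \<in> R" for k i using q(1) RR by (cases i) auto
    ultimately show ?thesis unfolding T_def q(2) by (intro CollectI exI[of _ n] exI[of _ f] exI[of _ "\<lambda>k. pCons 0 (q k)"]) auto
  qed
  have Tc: "[:a:] + p \<in> T" if "a \<in> lincomb e R" "p \<in> T" for a p
    using that
  proof (induction rule: lincomb.induct)
    case (2 t s f)
    have "smult (e f) [:s:] + ([:t:] + p) \<in> T" by (rule TS) (use 2 RR in \<open>auto simp: coeff_pCons split: nat.splits\<close>)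
    then show ?case by (simp add: add.assoc[symmetric])
  qed simp
  have "p \<in> T" using p
  proof (induction p)
    case 0 show ?case by (rule T0)
  next
    case (pCons a p)
    have "\<forall>i. coeff p i \<in> lincomb e R" using pCons.prems by (metis coeff_pCons_Suc)
    then have "[:a:] + pCons 0 p \<in> T" using Tc[OF _ Tp[OF pCons.IH], of a] pCons.prems[rule_format, of 0] by simp
    then show ?case by simp
  qed
  then show ?thesis unfolding T_def by blast
qed

text \<open>If all \<open>poly (q k) u\<close> vanish, a nonzero \<open>q k\<close> makes
  \<open>u\<close> algebraic over \<open>R\<close>. Otherwise these values are constants and form a
  linear relation between the \<open>e (f k)\<close>. It descends to \<open>C\<close>, so some
  \<open>f j\<close> is a combination of the others, and substituting it shortens the sum without
  changing the polynomial.\<close>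

lemma lincomb_root:
  fixes e :: "'a::field \<Rightarrow> 'b::field"
  assumes E: "pair_elem_ext C e P" and C: "subfld C" and R: "subfld R" "R \<subseteq> P" "\<And>c. c \<in> C \<Longrightarrow> e c \<in> R"
    and u: "u \<in> P" and L: "finite (L :: nat set)"
    and q: "\<And>k i. k \<in> L \<Longrightarrow> coeff (q k) i \<in> R"
    and nz: "(\<Sum>k\<in>L. smult (e (f k)) (q k)) \<noteq> 0" and z: "(\<Sum>k\<in>L. e (f k) * poly (q k) u) = 0"
  shows "u \<in> algover R"
  using L q nz z
proof (induction L arbitrary: q rule: finite_psubset_induct)
  case (psubset L)
  note RR = subfldD[OF R(1)] and CC = subfldD[OF C] and H = pair_elem_ext_hom[OF E]
  have sP: "subfld P" by (rule pair_elem_ext_subfld[OF E C])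
  show ?case
  proof (cases "\<exists>j\<in>L. poly (q j) u \<noteq> 0")
    case False
    have "\<exists>j\<in>L. q j \<noteq> 0"
    proof (rule ccontr)
      assume "\<not> (\<exists>j\<in>L. q j \<noteq> 0)"
      then have "(\<Sum>k\<in>L. smult (e (f k)) (q k)) = 0" by (intro sum.neutral) auto
      then show False using psubset.prems(2) by simp
    qed
    then obtain j where j: "j \<in> L" "q j \<noteq> 0" by blast
    then show ?thesis using False psubset.prems(1) unfolding algover_def by blast
  next
    case True
    then obtain j where j: "j \<in> L" "poly (q j) u \<noteq> 0" by blast
    have "poly (q k) u \<in> P" if "k \<in> L" for k
      by (rule poly_closed) (use psubset.prems(1)[OF that] subfldD[OF sP] R u in auto)
    then obtain \<kappa> where \<kappa>: "\<forall>k\<in>L. \<kappa> k \<in> C" "\<kappa> j \<noteq> 0" "(\<Sum>k\<in>L. \<kappa> k * f k) = 0"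
      using linear_dependence_descends[OF E psubset.hyps j(1), of "\<lambda>k. poly (q k) u" f] j(2) psubset.prems(3) by (auto simp: mult.commute)
    define L' where "L' = L - {j}"
    define \<mu> where "\<mu> k = - \<kappa> k / \<kappa> j" for k
    have L: "L = insert j L'" "j \<notin> L'" "finite L'" "L' \<subset> L" using j(1) psubset.hyps unfolding L'_def by auto
    have \<mu>: "\<mu> k \<in> C" if "k \<in> L" for k unfolding \<mu>_def using \<kappa>(1) that j CC by auto
    have "\<kappa> j * f j = - (\<Sum>k\<in>L'. \<kappa> k * f k)" using \<kappa>(3) L by (simp add: eq_neg_iff_add_eq_0)
    then have "f j = (\<Sum>k\<in>L'. \<mu> k * f k)" using \<kappa>(2) unfolding \<mu>_def
      by (simp add: field_simps sum_divide_distrib[symmetric] sum_negf)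
    moreover have "e (\<Sum>k\<in>A. \<mu> k * f k) = (\<Sum>k\<in>A. e (\<mu> k) * e (f k))" for A
      by (induction A rule: infinite_finite_induct) (auto simp: H)
    ultimately have fj: "e (f j) = (\<Sum>k\<in>L'. e (\<mu> k) * e (f k))" by simp
    \<comment> \<open>The summand at \<open>j\<close> is distributed over the others; coefficients
      stay in \<open>R\<close> because \<open>e\<close> maps \<open>C\<close> into
      \<open>R\<close>.\<close>
    let ?q = "\<lambda>k. q k + smult (e (\<mu> k)) (q j)"
    have "(\<Sum>k\<in>L. smult (e (f k)) (q k)) = (\<Sum>k\<in>L'. smult (e (\<mu> k) * e (f k)) (q j)) + (\<Sum>k\<in>L'. smult (e (f k)) (q k))"
      using L by (simp add: fj smult_sum)
    also have "\<dots> = (\<Sum>k\<in>L'. smult (e (f k)) (?q k))" by (simp add: sum.distrib smult_add_right mult.commute)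
    finally have 1: "(\<Sum>k\<in>L'. smult (e (f k)) (?q k)) \<noteq> 0" using psubset.prems(2) by simp
    have "(\<Sum>k\<in>L. e (f k) * poly (q k) u) = (\<Sum>k\<in>L'. e (\<mu> k) * e (f k) * poly (q j) u) + (\<Sum>k\<in>L'. e (f k) * poly (q k) u)"
      using L by (simp add: fj sum_distrib_right)
    also have "\<dots> = (\<Sum>k\<in>L'. e (f k) * poly (?q k) u)" by (simp add: sum.distrib algebra_simps)
    finally have 2: "(\<Sum>k\<in>L'. e (f k) * poly (?q k) u) = 0" using psubset.prems(3) by simp
    show ?thesis
    proof (rule psubset.IH[OF L(4) _ 1 2])
      fix k i assume "k \<in> L'"
      then show "coeff (?q k) i \<in> R" using psubset.prems(1)[of k i] psubset.prems(1)[of j i] L R(3)[OF \<mu>[of k]] RR by auto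
    qed
  qed
qed

text \<open>After clearing denominators, an equation for \<open>u\<close> over
  \<open>range e\<close> and \<open>S\<close> has coefficients in the ring generated by
  \<open>range e\<close> and the field \<open>R\<close> of constants; \<open>lincomb_root\<close>
  replaces it by an equation over \<open>R\<close>.\<close>

lemma free_from_range:
  assumes E: "pair_elem_ext C e P" and C: "acl C = C"
  shows "free_from P (range e)"
  unfolding free_from_def
proof clarify
  fix S u assume S: "S \<subseteq> P" and u: "u \<in> acl (range e \<union> S)" "u \<in> P"
  have sC: "subfld C" using subfld_acl[of C] C by simp
  have sP: "subfld P" by (rule pair_elem_ext_subfld[OF E sC])
  note H = pair_elem_ext_hom[OF E]
  define R where "R = subfield_gen (range e \<inter> P \<union> S)"
  have R: "subfld R" unfolding R_def by (rule subfld_subfield_gen)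
  note RR = subfldD[OF R]
  have RP: "R \<subseteq> P" unfolding R_def by (rule subfield_gen_least[OF sP]) (use S in auto)
  have eR: "e c \<in> R" if "c \<in> C" for c unfolding R_def using that H(7) by (intro subfield_gen.base) auto
  let ?T = "lincomb e R"
  have T1: "e f * s \<in> ?T" if "s \<in> R" for f s using lincomb.intros(2)[OF lincomb.intros(1) that] by simp
  have Te: "e f \<in> ?T" for f using T1[of 1 f] RR by simp
  have TR: "s \<in> ?T" if "s \<in> R" for s using T1[OF that, of 1] H by simp
  note Tm = lincomb_mult[OF H(4) R]
  have Tn: "- x \<in> ?T" if "x \<in> ?T" for x using Tm[OF TR[of "-1"] that] RR by simp
  have T01: "0 \<in> ?T" "1 \<in> ?T" using TR RR by auto
  have "z \<in> ?T" if "z \<in> S" for z by (rule TR) (use that in \<open>auto simp: R_def intro: subfield_gen.base\<close>)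
  then have ST: "range e \<union> S \<subseteq> ?T" using Te by auto
  from u obtain p where p: "p \<noteq> 0" "\<forall>i. coeff p i \<in> subfield_gen (range e \<union> S)" "poly p u = 0" unfolding acl_def by blast
  from clear_denominators[OF T01 Tm subfield_gen_fraction[OF ST T01 lincomb_add Tm Tn] p(2)] obtain D where D: "D \<noteq> 0" "\<forall>i. D * coeff p i \<in> ?T" by blast
  have "\<forall>i. coeff (smult D p) i \<in> ?T" using D by simp
  from lincomb_poly[OF R this] obtain n f q where q: "\<forall>k i. coeff (q k) i \<in> R" "smult D p = (\<Sum>k<(n::nat). smult (e (f k)) (q k))"
    by blast
  have "poly (smult D p) u = 0" using p by simp
  then have "(\<Sum>k<n. e (f k) * poly (q k) u) = 0" unfolding q(2) by (simp add: poly_sum)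
  moreover have "(\<Sum>k<n. smult (e (f k)) (q k)) \<noteq> 0" unfolding q(2)[symmetric] using p D by simp
  ultimately have "u \<in> algover R"
    using lincomb_root[OF E sC R RP eR u(2), of "{..<n}" q f] q(1) by auto
  then show "u \<in> acl (range e \<inter> P \<union> S)" unfolding acl_eq R_def .
qed

section \<open>Generic elements in saturated pairs\<close>

lemma card_range_Un:
  fixes e :: "'a::field_char_0 \<Rightarrow> 'b"
  assumes "(card_of T, card_of (UNIV :: 'a set)) \<in> ordLeq" "S \<subseteq> range e \<union> T"
  shows "(card_of S, card_of (UNIV :: 'a set)) \<in> ordLeq"
proof -
  have "(card_of (range e \<union> T), card_of (UNIV :: 'a set)) \<in> ordLeq"
    by (rule card_of_Un_ordLeq_infinite_Field[OF _ card_of_image assms(1) card_of_Card_order])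
      (simp add: Field_card_of infinite_UNIV_char_0)
  then show ?thesis using card_of_mono1[OF assms(2)] ordLeq_transitive by blast
qed

lemma countable_card_le:
  assumes "countable T" shows "(card_of T, card_of (UNIV :: 'a::field_char_0 set)) \<in> ordLeq"
proof (rule card_of_ordLeqI)
  show "inj_on (\<lambda>x. of_nat (to_nat_on T x) :: 'a) T"
    using inj_on_to_nat_on[OF assms] by (auto simp: inj_on_def)
qed simp

lemma pair_elem_ext_infinite:
  fixes e :: "'a::field_char_0 \<Rightarrow> 'b::field"
  assumes E: "pair_elem_ext C e P" and C: "subfld C"
  shows "infinite P" "infinite (UNIV :: 'b set)"
proof -
  have P: "subfld P" by (rule pair_elem_ext_subfld[OF E C])
  have "of_nat n \<in> P" for n by (induction n) (auto simp: subfldD[OF P])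
  then have "range (of_nat :: nat \<Rightarrow> 'b) \<subseteq> P" by auto
  moreover have "infinite (range (of_nat :: nat \<Rightarrow> 'b))"
    by (rule range_inj_infinite) (simp add: inj_def pair_elem_ext_of_nat(2)[OF E])
  ultimately show "infinite P" by (meson infinite_super)
  then show "infinite (UNIV :: 'b set)" by (meson infinite_super subset_UNIV)
qed

text \<open>The type says that \<open>x\<close> is a constant and no root of a nonzero term over
  \<open>range e\<close> and \<open>T\<close>. Finitely many such terms have finitely many roots,
  while there are infinitely many constants.\<close>

lemma exists_transcendental_constant:
  fixes e :: "'a::field_char_0 \<Rightarrow> 'b::field"
  assumes E: "pair_elem_ext C e P" and C: "subfld C" and sat: "pair_saturated (UNIV :: 'a set) P" and T: "finite T"
  shows "\<exists>y\<in>P. y \<notin> acl (range e \<union> T)"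
proof -
  let ?S = "range e \<union> T"
  let ?good = "\<lambda>t. nodev_tm t \<and> params_tm t \<subseteq> ?S \<and> fv_tm t \<subseteq> {0} \<and> (\<exists>u. eval_tm id id (\<lambda>_. u) t \<noteq> 0)"
  define \<Phi> where "\<Phi> = insert (Pc (Var 0)) {Not (Eq t Zero) | t. ?good t}"
  have "\<exists>v. \<forall>\<phi>\<in>\<Phi>. sat id P id v \<phi>"
  proof (rule sat[unfolded pair_saturated_def, rule_format])
    show "pair_fm \<phi> \<and> fv \<phi> \<subseteq> {0}" if "\<phi> \<in> \<Phi>" for \<phi> using that unfolding \<Phi>_def by auto
    show "(card_of (\<Union>\<phi>\<in>\<Phi>. params \<phi>), card_of (UNIV :: 'a set)) \<in> ordLeq"
      by (rule card_range_Un[OF countable_card_le[OF countable_finite[OF T]]]) (auto simp: \<Phi>_def)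
    fix \<Psi> assume \<Psi>: "\<Psi> \<subseteq> \<Phi>" "finite \<Psi>"
    have "\<forall>\<phi>\<in>\<Psi>. \<exists>p. p \<noteq> 0 \<and> (\<forall>c\<in>P. poly p c \<noteq> 0 \<longrightarrow> sat id P id (\<lambda>_. c) \<phi>)"
    proof
      fix \<phi> assume "\<phi> \<in> \<Psi>"
      then consider "\<phi> = Pc (Var 0)" | t where "\<phi> = Not (Eq t Zero)" "?good t" using \<Psi> unfolding \<Phi>_def by blast
      then show "\<exists>p. p \<noteq> 0 \<and> (\<forall>c\<in>P. poly p c \<noteq> 0 \<longrightarrow> sat id P id (\<lambda>_. c) \<phi>)"
      proof cases
        case 1 then show ?thesis by (intro exI[of _ 1]) auto
      next
        case (2 t)
        obtain p where p: "\<forall>u. poly p u = eval_tm id id ((\<lambda>_. 0)(0 := u)) t" using term_poly[of t "\<lambda>_. 0"] 2 by blast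
        have p': "poly p u = eval_tm id id (\<lambda>_. u) t" for u
          unfolding p[rule_format] by (rule eval_tm_cong) (use 2 in auto)
        then show ?thesis using 2 by (intro exI[of _ p]) force
      qed
    qed
    then obtain p where p: "\<And>\<phi>. \<phi> \<in> \<Psi> \<Longrightarrow> p \<phi> \<noteq> 0" "\<And>\<phi> c. \<phi> \<in> \<Psi> \<Longrightarrow> c \<in> P \<Longrightarrow> poly (p \<phi>) c \<noteq> 0 \<Longrightarrow> sat id P id (\<lambda>_. c) \<phi>"
      by metis
    have "finite (\<Union>\<phi>\<in>\<Psi>. {c. poly (p \<phi>) c = 0})" using \<Psi>(2) p(1) poly_roots_finite by blast
    then obtain c where "c \<in> P" "c \<notin> (\<Union>\<phi>\<in>\<Psi>. {c. poly (p \<phi>) c = 0})"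
      using pair_elem_ext_infinite(1)[OF E C] by (meson finite_subset subsetI)
    then show "\<exists>v. \<forall>\<phi>\<in>\<Psi>. sat id P id v \<phi>" using p(2) by (intro exI[of _ "\<lambda>_. c"]) auto
  qed
  then obtain v where v: "\<forall>\<phi>\<in>\<Phi>. sat id P id v \<phi>" by blast
  have "v 0 \<in> P" using v unfolding \<Phi>_def by auto
  moreover have "v 0 \<notin> acl ?S"
  proof
    assume "v 0 \<in> acl ?S"
    from acl_term[OF pair_elem_ext_infinite(2)[OF E C] this] obtain t where t: "?good t" "eval_tm id id (\<lambda>_. v 0) t = 0" by blast
    have "eval_tm id id v t = eval_tm id id (\<lambda>_. v 0) t" by (rule eval_tm_cong) (use t in auto)
    moreover have "sat id P id v (Not (Eq t Zero))" using v t unfolding \<Phi>_def by blast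
    ultimately show False using t(2) by simp
  qed
  ultimately show ?thesis by blast
qed

text \<open>The variables \<open>1, \<dots>, r - 1\<close> range over the constants: \<open>Var 0\<close> is not a root of a nonzero
  specialization of \<open>t\<close>.\<close>
definition const_generic :: "nat \<Rightarrow> 'p tm \<Rightarrow> 'p fm" where
  "const_generic r t = Not (Exs [1..<r] (Conj (Conjs (map (\<lambda>i. Pc (Var i)) [1..<r]))
     (Conj (Eq t Zero) (Ex 0 (Not (Eq t Zero))))))"

lemma sat_const_generic:
  "sat id P par v (const_generic r t) \<longleftrightarrow> (\<forall>z. (\<forall>i. i \<notin> {1..<r} \<longrightarrow> z i = v i) \<longrightarrow> (\<forall>i\<in>{1..<r}. z i \<in> P) \<longrightarrow>
     eval_tm id par z t = 0 \<longrightarrow> (\<forall>u. eval_tm id par (z(0 := u)) t = 0))"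
  unfolding const_generic_def by (simp add: sat_Exs sat_Conjs) blast

text \<open>The finitely satisfiable content of genericity: one \<open>x\<close> avoids the roots of
  all nonzero specializations, at constants, of finitely many terms. Unlike the existence of a
  generic element, this is expressible by sentences.\<close>

definition large :: "'b::field set \<Rightarrow> bool" where
  "large P \<longleftrightarrow> (\<forall>Ts. finite Ts \<longrightarrow> (\<forall>t\<in>Ts. nodev_tm t) \<longrightarrow> (\<exists>x. \<forall>t\<in>Ts. \<forall>z. (\<forall>i. i \<noteq> 0 \<longrightarrow> z i \<in> P) \<longrightarrow>
     eval_tm id id (z(0 := x)) t = 0 \<longrightarrow> (\<forall>u. eval_tm id id (z(0 := u)) t = 0)))"

lemma largeI:
  assumes "\<And>T. finite T \<Longrightarrow> \<exists>y. y \<notin> acl (range e \<union> T \<union> P)"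
  shows "large P"
  unfolding large_def
proof (intro allI impI)
  fix Ts :: "'a tm set" assume Ts: "finite Ts" "\<forall>t\<in>Ts. nodev_tm t"
  obtain y where y: "y \<notin> acl (range e \<union> (\<Union>t\<in>Ts. params_tm t) \<union> P)" using assms[of "\<Union>t\<in>Ts. params_tm t"] Ts by auto
  show "\<exists>x. \<forall>t\<in>Ts. \<forall>z. (\<forall>i. i \<noteq> 0 \<longrightarrow> z i \<in> P) \<longrightarrow> eval_tm id id (z(0 := x)) t = 0 \<longrightarrow> (\<forall>u. eval_tm id id (z(0 := u)) t = 0)"
  proof (intro exI[of _ y] ballI allI impI, rule ccontr)
    fix t z u assume t: "t \<in> Ts" and z: "\<forall>i. i \<noteq> 0 \<longrightarrow> z i \<in> P" and *: "eval_tm id id (z(0 := y)) t = 0" "eval_tm id id (z(0 := u)) t \<noteq> 0"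
    have "y \<in> acl (range e \<union> (\<Union>t\<in>Ts. params_tm t) \<union> P)"
      by (rule term_root_in_acl[OF _ _ _ *]) (use Ts t z in auto)
    then show False using y by simp
  qed
qed

lemma finite_numbering:
  assumes "finite A" obtains h :: "'a \<Rightarrow> nat" and n where "inj_on h A" "\<And>a. a \<in> A \<Longrightarrow> h a < n"
proof -
  obtain n and h :: "'a \<Rightarrow> nat" where "h ` A = {i. i < n}" "inj_on h A" using finite_imp_inj_to_nat_seg[OF assms] by blast
  then show ?thesis using that[of h n] by blast
qed

text \<open>For given terms the condition becomes a sentence once their parameters, which exist only
  in the first extension, are replaced by variables. It is valid in the second extension, hence in
  \<open>F\<close>, hence in the first.\<close>

lemma large_transfer:
  fixes e1 :: "'a::field \<Rightarrow> 'b::field" and e2 :: "'a \<Rightarrow> 'c::field"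
  assumes E1: "pair_elem_ext C e1 P1" and E2: "pair_elem_ext C e2 P2" and 0: "0 \<in> P2" and L: "large P2"
  shows "large P1"
  unfolding large_def
proof (intro allI impI)
  fix Ts :: "'b tm set" assume Ts: "finite Ts" "\<forall>t\<in>Ts. nodev_tm t"
  define PP where "PP = (\<Union>t\<in>Ts. params_tm t)"
  have "finite PP" using Ts unfolding PP_def by auto
  then obtain h :: "'b \<Rightarrow> nat" and m where h: "inj_on h PP" "\<And>a. a \<in> PP \<Longrightarrow> h a < m" using finite_numbering by blast
  have "finite (\<Union>t\<in>Ts. fv_tm t)" using Ts by auto
  then obtain r0 where r0: "\<And>i t. t \<in> Ts \<Longrightarrow> i \<in> fv_tm t \<Longrightarrow> i < r0" by (metis UN_I finite_nat_set_iff_bounded)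
  \<comment> \<open>Parameters move to variables from \<open>r\<close> on, beyond all variables of
    \<open>Ts\<close>; \<open>r > 0\<close> reserves variable 0 for the unknown.\<close>
  define r where "r = Suc r0"
  have r: "\<And>i t. t \<in> Ts \<Longrightarrow> i \<in> fv_tm t \<Longrightarrow> i < r" "r > 0" using r0 unfolding r_def by (auto intro: less_SucI)
  define g :: "'b tm \<Rightarrow> 'a tm" where "g = tsub Var (\<lambda>p. Var (r + h p))"
  have g: "nodev_tm (g t)" "params_tm (g t) = {}" if "t \<in> Ts" for t using that Ts unfolding g_def by (auto simp: params_tsub intro: nodev_tsub)
  obtain ts where ts: "set ts = Ts" using finite_list[OF Ts(1)] by blast
  let ?\<theta> = "Ex 0 (Conjs (map (\<lambda>t. const_generic r (g t)) ts))"
  have p: "pair_fm ?\<theta>" using ts g by (auto simp: const_generic_def)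
  have "sat id P2 e2 w ?\<theta>" for w
  proof -
    \<comment> \<open>In the second extension the variables from \<open>r\<close> on turn into
      parameters again, with values given by \<open>w\<close>. \<open>Zero\<close> is a dummy, as
      \<open>g t\<close> has no parameters.\<close>
    define k where "k t = tsub (\<lambda>i. if i < r then Var i else Par (w i)) (\<lambda>_. Zero) (g t)" for t
    have "\<forall>t\<in>k ` Ts. nodev_tm t" using g unfolding k_def by (auto intro!: nodev_tsub)
    then obtain x where x: "\<And>t z. t \<in> Ts \<Longrightarrow> (\<forall>i. i \<noteq> 0 \<longrightarrow> z i \<in> P2) \<Longrightarrow>
        eval_tm id id (z(0 := x)) (k t) = 0 \<Longrightarrow> (\<forall>u. eval_tm id id (z(0 := u)) (k t) = 0)"
      using L[unfolded large_def, rule_format, of "k ` Ts"] Ts by blast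
    have "sat id P2 e2 (w(0 := x)) (const_generic r (g t))" if t: "t \<in> Ts" for t
      unfolding sat_const_generic
    proof (intro allI impI)
      fix z u assume z: "\<forall>i. i \<notin> {1..<r} \<longrightarrow> z i = (w(0 := x)) i" "\<forall>i\<in>{1..<r}. z i \<in> P2" "eval_tm id e2 z (g t) = 0"
      \<comment> \<open>\<open>large\<close> asks for constants at all nonzero indices, so the
        irrelevant ones are set to 0.\<close>
      define z' where "z' i = (if i \<in> {1..<r} then z i else 0)" for i
      have ev: "eval_tm id id (z'(0 := u)) (k t) = eval_tm id e2 (z(0 := u)) (g t)" for u
        unfolding k_def eval_tsub by (rule eval_tm_cong) (use g[OF t] z r in \<open>auto simp: z'_def\<close>)
      have z0: "z(0 := x) = z" using z(1) by (intro ext) auto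
      have "eval_tm id id (z'(0 := x)) (k t) = 0" unfolding ev z0 by (rule z(3))
      then have "\<forall>u. eval_tm id id (z'(0 := u)) (k t) = 0" using z(2) by (intro x[OF t]) (auto simp: z'_def 0)
      then show "eval_tm id e2 (z(0 := u)) (g t) = 0" unfolding ev by blast
    qed
    then show ?thesis using ts by (auto simp: sat_Conjs)
  qed
  then have "\<forall>v. sat id C id v ?\<theta>" using pair_transfer[OF E2 p] by blast
  then have all: "sat id P1 e1 w ?\<theta>" for w using pair_transfer[OF E1 p] by blast
  \<comment> \<open>Variable \<open>r + h p\<close> is decoded to the parameter
    \<open>p\<close>.\<close>
  define w where "w i = inv_into PP h (i - r)" for i
  from all[of w] obtain x where x: "\<And>t. t \<in> Ts \<Longrightarrow> sat id P1 e1 (w(0 := x)) (const_generic r (g t))" using ts by (auto simp: sat_Conjs)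
  show "\<exists>x. \<forall>t\<in>Ts. \<forall>z. (\<forall>i. i \<noteq> 0 \<longrightarrow> z i \<in> P1) \<longrightarrow> eval_tm id id (z(0 := x)) t = 0 \<longrightarrow> (\<forall>u. eval_tm id id (z(0 := u)) t = 0)"
  proof (intro exI[of _ x] ballI allI impI)
    fix t z u assume t: "t \<in> Ts" and z: "\<forall>i. i \<noteq> 0 \<longrightarrow> z i \<in> P1" "eval_tm id id (z(0 := x)) t = 0"
    define z' where "z' i = (if i \<in> {1..<r} then z i else (w(0 := x)) i)" for i
    have ev: "eval_tm id e1 (z'(0 := u)) (g t) = eval_tm id id (z(0 := u)) t" for u
      unfolding g_def eval_tsub
    proof (rule eval_tm_cong)
      fix i assume "i \<in> fv_tm t"
      then show "eval_tm id e1 (z'(0 := u)) (Var i) = (z(0 := u)) i" using r(1)[OF t] by (auto simp: z'_def)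
    next
      fix p assume "p \<in> params_tm t"
      then have "p \<in> PP" using t unfolding PP_def by auto
      then show "eval_tm id e1 (z'(0 := u)) (Var (r + h p)) = id p" using r(2) h(1) by (simp add: z'_def w_def)
    qed
    have "z'(0 := x) = z'" by (intro ext) (auto simp: z'_def)
    then have "eval_tm id e1 z' (g t) = 0" using ev[of x] z(2) by metis
    moreover have "\<forall>i. i \<notin> {1..<r} \<longrightarrow> z' i = (w(0 := x)) i" "\<forall>i\<in>{1..<r}. z' i \<in> P1" using z(1) by (auto simp: z'_def)
    ultimately have "eval_tm id e1 (z'(0 := u)) (g t) = 0" using x[OF t] unfolding sat_const_generic by blast
    then show "eval_tm id id (z(0 := u)) t = 0" unfolding ev .
  qed
qed

text \<open>A type may name at most |F| parameters, whereas \<open>P\<close> can be larger. The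
  constants are therefore quantified inside \<open>const_generic\<close> and not named; only
  \<open>range e\<close> and \<open>T\<close> supply parameters. \<open>large\<close> gives finite
  satisfiability.\<close>

lemma exists_generic:
  fixes e :: "'a::field_char_0 \<Rightarrow> 'b::field"
  assumes E: "pair_elem_ext C e P" and C: "subfld C" and sat: "pair_saturated (UNIV :: 'a set) P" and T: "finite T"
    and L: "large P"
  shows "\<exists>y. y \<notin> acl (range e \<union> T \<union> P)"
proof -
  let ?S = "range e \<union> T"
  let ?good = "\<lambda>(r, t). nodev_tm t \<and> params_tm t \<subseteq> ?S \<and> fv_tm t \<subseteq> {..<r}"
  have P0: "0 \<in> P" using pair_elem_ext_subfld[OF E C] by (rule subfldD)
  define \<Phi> where "\<Phi> = (\<lambda>(r, t). const_generic r t) ` {q. ?good q}"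
  have "\<exists>v. \<forall>\<phi>\<in>\<Phi>. sat id P id v \<phi>"
  proof (rule sat[unfolded pair_saturated_def, rule_format])
    show "pair_fm \<phi> \<and> fv \<phi> \<subseteq> {0}" if \<phi>: "\<phi> \<in> \<Phi>" for \<phi>
    proof -
      obtain r t where *: "\<phi> = const_generic r t" "nodev_tm t" "fv_tm t \<subseteq> {..<r}" using \<phi> unfolding \<Phi>_def by auto
      have "i \<in> {1..<r} \<or> i = 0" if "i \<in> fv_tm t" for i using *(3) that by (cases i) auto
      then show ?thesis using * unfolding const_generic_def by auto
    qed
    show "(card_of (\<Union>\<phi>\<in>\<Phi>. params \<phi>), card_of (UNIV :: 'a set)) \<in> ordLeq"
      by (rule card_range_Un[OF countable_card_le[OF countable_finite[OF T]], of _ e]) (auto simp: \<Phi>_def const_generic_def)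
    fix \<Psi> assume \<Psi>: "\<Psi> \<subseteq> \<Phi>" "finite \<Psi>"
    then obtain Q where Q: "Q \<subseteq> {q. ?good q}" "finite Q" "\<Psi> = (\<lambda>(r, t). const_generic r t) ` Q"
      unfolding \<Phi>_def by (meson finite_subset_image)
    have "\<forall>t\<in>snd ` Q. nodev_tm t" using Q(1) by auto
    then obtain x where x: "\<And>t z. t \<in> snd ` Q \<Longrightarrow> (\<forall>i. i \<noteq> 0 \<longrightarrow> z i \<in> P) \<Longrightarrow>
        eval_tm id id (z(0 := x)) t = 0 \<Longrightarrow> (\<forall>u. eval_tm id id (z(0 := u)) t = 0)"
      using L[unfolded large_def, rule_format, of "snd ` Q"] Q(2) by blast
    have "sat id P id (\<lambda>_. x) (const_generic r t)" if rt: "(r, t) \<in> Q" for r t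
      unfolding sat_const_generic
    proof (intro allI impI)
      fix z u assume z: "\<forall>i. i \<notin> {1..<r} \<longrightarrow> z i = x" "\<forall>i\<in>{1..<r}. z i \<in> P" "eval_tm id id z t = 0"
      have fv: "fv_tm t \<subseteq> {..<r}" using rt Q(1) by auto
      define z' where "z' i = (if i \<in> {1..<r} then z i else 0)" for i
      have ev: "eval_tm id id (z'(0 := u)) t = eval_tm id id (z(0 := u)) t" for u
        by (rule eval_tm_cong) (use fv in \<open>auto simp: z'_def\<close>)
      have z0: "z(0 := x) = z" using z(1) by (intro ext) auto
      have "eval_tm id id (z'(0 := x)) t = 0" unfolding ev z0 by (rule z(3))
      then have "\<forall>u. eval_tm id id (z'(0 := u)) t = 0" using z(2) rt by (intro x) (force simp: z'_def P0)+
      then show "eval_tm id id (z(0 := u)) t = 0" unfolding ev by blast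
    qed
    then show "\<exists>v. \<forall>\<phi>\<in>\<Psi>. sat id P id v \<phi>" unfolding Q(3) by (intro exI[of _ "\<lambda>_. x"]) auto
  qed
  then obtain v where v: "\<And>r t. ?good (r, t) \<Longrightarrow> sat id P id v (const_generic r t)" unfolding \<Phi>_def by blast
  have "v 0 \<notin> acl (?S \<union> P)"
  proof
    assume "v 0 \<in> acl (?S \<union> P)"
    from acl_term[OF pair_elem_ext_infinite(2)[OF E C] this] obtain t u where t: "nodev_tm t" "params_tm t \<subseteq> ?S \<union> P"
      "fv_tm t \<subseteq> {0}" "eval_tm id id (\<lambda>_. v 0) t = 0" "eval_tm id id (\<lambda>_. u) t \<noteq> 0" by blast
    define Q where "Q = params_tm t - ?S"
    have "finite Q" unfolding Q_def by simp
    then obtain h :: "'b \<Rightarrow> nat" and n where h: "inj_on h Q" "\<And>a. a \<in> Q \<Longrightarrow> h a < n" using finite_numbering by blast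
    \<comment> \<open>The parameters of \<open>t\<close> outside \<open>?S\<close> are constants;
      they become variables \<open>1, ..., n\<close>, over which
      \<open>const_generic (Suc n)\<close> quantifies.\<close>
    define s where "s = tsub Var (\<lambda>p. if p \<in> ?S then Par p else Var (Suc (h p))) t"
    have fvs: "fv_tm s \<subseteq> {..<Suc n}"
    proof -
      have "(\<Union>p\<in>params_tm t. fv_tm (if p \<in> ?S then Par p else Var (Suc (h p)))) \<subseteq> {..<Suc n}"
      proof clarify
        fix i p assume p: "p \<in> params_tm t" "i \<in> fv_tm (if p \<in> ?S then Par p else Var (Suc (h p)))"
        then have "p \<notin> ?S" "i = Suc (h p)" by (auto split: if_splits)
        then show "i < Suc n" using h(2)[of p] p unfolding Q_def by auto
      qed
      then show ?thesis using t(3) unfolding s_def fv_tsub by auto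
    qed
    have "params_tm s \<subseteq> ?S" unfolding s_def params_tsub by (auto split: if_splits)
    moreover have "nodev_tm s" unfolding s_def by (rule nodev_tsub) (use t in auto)
    ultimately have sat: "sat id P id v (const_generic (Suc n) s)" using fvs by (intro v) auto
    define z where "z i = (if i \<in> {1..<Suc n} then if i - 1 \<in> h ` Q then inv_into Q h (i - 1) else 0 else v i)" for i
    have QP: "Q \<subseteq> P" using t(2) unfolding Q_def by auto
    have zP: "z i \<in> P" if "i \<in> {1..<Suc n}" for i using that P0 QP inv_into_into[of "i - 1" h Q] unfolding z_def by auto
    have ev: "eval_tm id id (z(0 := u)) s = eval_tm id id (\<lambda>_. u) t" for u
      unfolding s_def eval_tsub
    proof (rule eval_tm_cong)
      fix i assume "i \<in> fv_tm t" then show "eval_tm id id (z(0 := u)) (Var i) = u" using t(3) by auto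
    next
      fix p assume "p \<in> params_tm t"
      then have "p \<in> Q \<or> p \<in> ?S" unfolding Q_def by auto
      then show "eval_tm id id (z(0 := u)) (if p \<in> ?S then Par p else Var (Suc (h p))) = id p"
        using h by (auto simp: z_def dest: inj_onD)
    qed
    have "z(0 := v 0) = z" by (intro ext) (auto simp: z_def)
    then have "eval_tm id id z s = 0" using ev[of "v 0"] t(4) by metis
    moreover have "\<forall>i. i \<notin> {1..<Suc n} \<longrightarrow> z i = v i" unfolding z_def by auto
    ultimately have "\<forall>u. eval_tm id id (z(0 := u)) s = 0" using sat zP unfolding sat_const_generic by blast
    then show False using t(5) unfolding ev by blast
  qed
  then show ?thesis by blast
qed

section \<open>Differentially transcendental elements\<close>

lemma acl_constants:
  fixes \<delta> :: "'b::field \<Rightarrow> 'b"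
  assumes d: "is_derivation \<delta>" and ch: "\<And>n. n > 0 \<Longrightarrow> (of_nat n :: 'b) \<noteq> 0"
  shows "acl {x. \<delta> x = 0} = {x. \<delta> x = 0}"
proof -
  have "\<delta> x \<in> {0}" if "x \<in> acl {x. \<delta> x = 0}" for x
    by (rule acl_derivation_closed[OF d ch _ _ _ _ that]) auto
  then show ?thesis using acl_superset[of "{x. \<delta> x = 0}"] by auto
qed

section \<open>Differential polynomials as polynomials in the derivatives\<close>

definition mon_eval :: "(nat \<Rightarrow> 'a::field) \<Rightarrow> (nat \<Rightarrow>\<^sub>0 nat) \<Rightarrow> 'a" where
  "mon_eval u m = (\<Prod>i\<in>Poly_Mapping.keys m. u i ^ Poly_Mapping.lookup m i)"

text \<open>Evaluation at arbitrary sequences, not just at the derivatives of an element: a single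
  sequence with nonzero value already shows that the polynomial is nonzero.\<close>

definition dpoly_eval :: "(nat \<Rightarrow> 'a::field) \<Rightarrow> 'a dpoly \<Rightarrow> 'a" where
  "dpoly_eval u g = (\<Sum>m\<in>Poly_Mapping.keys g. Poly_Mapping.lookup g m * mon_eval u m)"

lemma deval_eq: "deval d g a = dpoly_eval (\<lambda>i. (d ^^ i) a) g"
  unfolding deval_def dpoly_eval_def mon_eval_def ..

lemma mon_eval_superset:
  "finite A \<Longrightarrow> Poly_Mapping.keys m \<subseteq> A \<Longrightarrow> mon_eval u m = (\<Prod>i\<in>A. u i ^ Poly_Mapping.lookup m i)"
  unfolding mon_eval_def by (rule prod.mono_neutral_left) (auto simp: in_keys_iff)

lemma mon_eval_add: "mon_eval u (m + m') = mon_eval u m * mon_eval u m'"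
proof -
  let ?A = "Poly_Mapping.keys m \<union> Poly_Mapping.keys m'"
  have "mon_eval u (m + m') = (\<Prod>i\<in>?A. u i ^ Poly_Mapping.lookup (m + m') i)"
    by (rule mon_eval_superset) (simp_all add: Poly_Mapping.keys_add)
  also have "\<dots> = (\<Prod>i\<in>?A. u i ^ Poly_Mapping.lookup m i) * (\<Prod>i\<in>?A. u i ^ Poly_Mapping.lookup m' i)"
    by (simp add: lookup_add power_add prod.distrib)
  also have "\<dots> = mon_eval u m * mon_eval u m'" by (simp add: mon_eval_superset[of ?A])
  finally show ?thesis .
qed

lemma dpoly_eval_superset:
  "finite A \<Longrightarrow> Poly_Mapping.keys g \<subseteq> A \<Longrightarrow> dpoly_eval u g = (\<Sum>m\<in>A. Poly_Mapping.lookup g m * mon_eval u m)"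
  unfolding dpoly_eval_def by (rule sum.mono_neutral_left) (auto simp: in_keys_iff)

lemma dpoly_eval_add: "dpoly_eval u (g + h) = dpoly_eval u g + dpoly_eval u h"
proof -
  let ?A = "Poly_Mapping.keys g \<union> Poly_Mapping.keys h"
  have "dpoly_eval u (g + h) = (\<Sum>m\<in>?A. Poly_Mapping.lookup (g + h) m * mon_eval u m)"
    by (rule dpoly_eval_superset) (simp_all add: Poly_Mapping.keys_add)
  also have "\<dots> = dpoly_eval u g + dpoly_eval u h"
    by (simp add: lookup_add distrib_right sum.distrib dpoly_eval_superset[of ?A])
  finally show ?thesis .
qed

lemma dpoly_eval_single: "dpoly_eval u (Poly_Mapping.single m c) = c * mon_eval u m"
  unfolding dpoly_eval_def by (cases "c = 0") auto

lemma dpoly_eval_sum: "dpoly_eval u (\<Sum>j\<in>J. g j) = (\<Sum>j\<in>J. dpoly_eval u (g j))"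
  by (induction J rule: infinite_finite_induct) (auto simp: dpoly_eval_add, auto simp: dpoly_eval_def)

lemma dpoly_eval_mult: "\<exists>k. \<forall>u. dpoly_eval u k = dpoly_eval u g * dpoly_eval u h"
proof (intro exI allI)
  fix u
  let ?k = "\<Sum>m\<in>Poly_Mapping.keys g. \<Sum>m'\<in>Poly_Mapping.keys h. Poly_Mapping.single (m + m') (Poly_Mapping.lookup g m * Poly_Mapping.lookup h m')"
  show "dpoly_eval u ?k = dpoly_eval u g * dpoly_eval u h"
    unfolding dpoly_eval_sum dpoly_eval_single mon_eval_add
    by (simp add: dpoly_eval_def sum_product mult_ac)
qed

lemma term_dpoly: "nodev_tm t \<Longrightarrow> \<exists>g. \<forall>u. dpoly_eval u g = eval_tm id id u t"
proof (induction t)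
  case (Var i)
  show ?case by (intro exI[of _ "Poly_Mapping.single (Poly_Mapping.single i 1) 1"]) (simp add: dpoly_eval_single mon_eval_def)
next
  case (Par p)
  show ?case by (intro exI[of _ "Poly_Mapping.single 0 p"]) (simp add: dpoly_eval_single mon_eval_def)
next
  case Zero show ?case by (intro exI[of _ 0]) (simp add: dpoly_eval_def)
next
  case One show ?case by (intro exI[of _ "Poly_Mapping.single 0 1"]) (simp add: dpoly_eval_single mon_eval_def del: single_one)
next
  case (Add s t)
  then obtain g h where "\<forall>u. dpoly_eval u g = eval_tm id id u s" "\<forall>u. dpoly_eval u h = eval_tm id id u t" by auto
  then show ?case by (intro exI[of _ "g + h"]) (simp add: dpoly_eval_add)
next
  case (Mul s t)
  then obtain g h where "\<forall>u. dpoly_eval u g = eval_tm id id u s" "\<forall>u. dpoly_eval u h = eval_tm id id u t" by auto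
  then show ?case using dpoly_eval_mult[of g h] by auto
next
  case (Neg s)
  then obtain g where g: "\<forall>u. dpoly_eval u g = eval_tm id id u s" by auto
  have "dpoly_eval u (Poly_Mapping.single 0 (- 1)) = - 1" for u :: "nat \<Rightarrow> 'a" by (simp add: dpoly_eval_single mon_eval_def)
  then show ?case using dpoly_eval_mult[of "Poly_Mapping.single 0 (- 1)" g] g by auto
qed simp

text \<open>In Blum's axiom \<open>f\<close> is taken to be a single derivative of order above that
  of \<open>g\<close>, so that the axiom yields a point where \<open>g\<close> does not
  vanish.\<close>

lemma diff_closed_jets:
  assumes dc: "diff_closed d" and t: "nodev_tm t" "eval_tm id id u t \<noteq> 0"
  shows "\<exists>x. eval_tm id id (\<lambda>i. (d ^^ i) x) t \<noteq> 0"
proof -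
  obtain g where g: "\<And>u. dpoly_eval u g = eval_tm id id u t" using term_dpoly[OF t(1)] by blast
  have g0: "g \<noteq> 0" using g[of u] t(2) by (auto simp: dpoly_eval_def)
  \<comment> \<open>This exceeds the order of \<open>g\<close> also if \<open>g\<close> has no
    variables and order -1.\<close>
  define N where "N = Suc (nat (dord g))"
  let ?f = "Poly_Mapping.single (Poly_Mapping.single N 1) 1 :: 'a dpoly"
  have "dpoly_vars ?f = {N}" unfolding dpoly_vars_def by simp
  then have f: "dord ?f = int N" unfolding dord_def by simp
  then have "dord g < dord ?f" "dord ?f \<ge> 0" unfolding N_def by auto
  then obtain a where "deval d g a \<noteq> 0" using dc g0 unfolding diff_closed_def by blast
  then show ?thesis unfolding deval_eq g by blast
qed

lemma eval_Der_pow: "eval_tm D par v ((Der ^^ i) s) = (D ^^ i) (eval_tm D par v s)"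
  by (induction i) auto

lemma Der_pow_simps [simp]: "fv_tm ((Der ^^ i) s) = fv_tm s" "params_tm ((Der ^^ i) s) = params_tm s"
  by (induction i) auto

text \<open>Blum's scheme is not transferred as a whole: for one term, its consequence
  \<open>diff_closed_jets\<close> becomes a sentence when the parameters are replaced by variables
  from \<open>r\<close> on.\<close>

lemma K_elem_ext_jets:
  fixes d :: "'a::field \<Rightarrow> 'a" and e :: "'a \<Rightarrow> 'c::field"
  assumes dc: "diff_closed d" and E: "K_elem_ext d e ds" and t: "nodev_tm t" "eval_tm id id u t \<noteq> 0"
  shows "\<exists>x. eval_tm id id (\<lambda>i. (ds ^^ i) x) t \<noteq> 0"
proof -
  obtain h :: "'c \<Rightarrow> nat" and n where h: "inj_on h (params_tm t)" "\<And>p. p \<in> params_tm t \<Longrightarrow> h p < n"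
    using finite_numbering[OF finite_params_tm] by blast
  obtain r0 where "\<And>i. i \<in> fv_tm t \<Longrightarrow> i < r0" using finite_fv_tm[of t] by (metis finite_nat_set_iff_bounded)
  then obtain r where r: "\<And>i. i \<in> fv_tm t \<Longrightarrow> i < r" "r > 0" by (metis less_SucI zero_less_Suc)
  define g :: "'a tm" where "g = tsub Var (\<lambda>p. Var (r + h p)) t"
  have g: "nodev_tm g" "params_tm g = {}" using t unfolding g_def by (auto simp: params_tsub intro: nodev_tsub)
  \<comment> \<open>Variables below \<open>r\<close> become derivatives of \<open>Var 0\<close>; the
    others keep standing for parameters.\<close>
  define j :: "nat \<Rightarrow> 'a tm" where "j i = (if i < r then (Der ^^ i) (Var 0) else Var i)" for i
  let ?\<phi> = "Not (Conj (Not (Eq g Zero)) (Not (Ex 0 (Not (Eq (tsub j Par g) Zero)))))"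
  have jets: "eval_tm D par (w(0 := x)) (tsub j Par g) = eval_tm D par (\<lambda>i. if i < r then (D ^^ i) x else w i) g"
    for D :: "'d::field \<Rightarrow> 'd" and par w x
    unfolding eval_tsub by (rule eval_tm_cong) (use r in \<open>auto simp: j_def eval_Der_pow\<close>)
  have "sat d {} id v ?\<phi>" for v
  proof (cases "eval_tm d id v g = 0")
    case False
    define k where "k = tsub (\<lambda>i. if i < r then Var i else Par (v i)) Par g"
    have k: "nodev_tm k" unfolding k_def using g by (auto intro: nodev_tsub)
    have ev: "eval_tm id id w k = eval_tm d id (\<lambda>i. if i < r then w i else v i) g" for w
      unfolding k_def eval_tsub by (subst eval_tm_nodev[OF g(1), of id _ _ d], rule eval_tm_cong) (use g in auto)
    have "eval_tm id id v k = eval_tm d id v g" unfolding ev by (rule eval_tm_cong) auto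
    then obtain x where "eval_tm id id (\<lambda>i. (d ^^ i) x) k \<noteq> 0" using diff_closed_jets[OF dc k, of v] False by auto
    then have "eval_tm d id (v(0 := x)) (tsub j Par g) \<noteq> 0" unfolding ev jets .
    then show ?thesis by auto
  qed simp
  then have all: "sat ds {} e w ?\<phi>" for w using K_transfer[OF E, of ?\<phi>] by simp
  define w where "w i = (if i < r then u i else inv_into (params_tm t) h (i - r))" for i
  have ev: "eval_tm D e (\<lambda>i. if i < r then z i else w i) g = eval_tm D id z t" for D z
    unfolding g_def eval_tsub by (rule eval_tm_cong) (use r h in \<open>auto simp: w_def\<close>)
  have w: "(\<lambda>i. if i < r then u i else w i) = w" by (auto simp: w_def)
  have "eval_tm ds e w g \<noteq> 0" using ev[of ds u] eval_tm_nodev[OF t(1), of ds id u id] t(2) unfolding w by simp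
  then obtain x where "eval_tm ds e (w(0 := x)) (tsub j Par g) \<noteq> 0" using all[of w] by auto
  then have "eval_tm ds id (\<lambda>i. (ds ^^ i) x) t \<noteq> 0" unfolding jets ev .
  then show ?thesis using eval_tm_nodev[OF t(1), of ds id _ id] by metis
qed

text \<open>On the line through a common nonroot of \<open>Ts\<close> and a nonroot of
  \<open>t\<close>, each term is a nonzero polynomial in the line parameter, as it does not vanish
  at one of these two points. Infinitely many points on the line leave a common nonroot.\<close>

lemma common_nonroot:
  fixes Ts :: "'c::field tm set"
  assumes inf: "infinite (UNIV :: 'c set)" and "finite Ts" "\<And>t. t \<in> Ts \<Longrightarrow> nodev_tm t \<and> (\<exists>u. eval_tm id id u t \<noteq> 0)"
  shows "\<exists>u. \<forall>t\<in>Ts. eval_tm id id u t \<noteq> 0"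
  using assms(2,3)
proof (induction Ts rule: finite_induct)
  case (insert t Ts)
  have "\<exists>u. \<forall>t\<in>Ts. eval_tm id id u t \<noteq> 0" using insert.prems by (intro insert.IH) auto
  moreover have "\<exists>u. eval_tm id id u t \<noteq> 0" using insert.prems[of t] by simp
  ultimately obtain u0 u1 where u: "\<forall>t\<in>Ts. eval_tm id id u0 t \<noteq> 0" "eval_tm id id u1 t \<noteq> 0" by blast
  define l where "l c i = u0 i + c * (u1 i - u0 i)" for c i
  have l01: "l 0 = u0" "l 1 = u1" unfolding l_def by auto
  have "\<exists>p. \<forall>c. poly p c = eval_tm id id (l c) s" if "s \<in> insert t Ts" for s
  proof -
    let ?s = "tsub (\<lambda>i. Add (Par (u0 i)) (Mul (Var 0) (Par (u1 i - u0 i)))) Par s"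
    have "nodev_tm ?s" using insert.prems[OF that] by (auto intro: nodev_tsub)
    then obtain p where p: "\<forall>c. poly p c = eval_tm id id ((\<lambda>_. 0)(0 := c)) ?s" using term_poly by blast
    have "poly p c = eval_tm id id (l c) s" for c
      unfolding p[rule_format] eval_tsub by (rule eval_tm_cong) (auto simp: l_def)
    then show ?thesis by blast
  qed
  then obtain p where p: "\<And>s c. s \<in> insert t Ts \<Longrightarrow> poly (p s) c = eval_tm id id (l c) s" by metis
  have nz: "p s \<noteq> 0" if "s \<in> insert t Ts" for s
  proof
    assume "p s = 0"
    then have "eval_tm id id (l c) s = 0" for c using p[OF that, of c] by simp
    from this[of 0] this[of 1] show False using that u unfolding l01 by auto
  qed
  have "finite (\<Union>s\<in>insert t Ts. {c. poly (p s) c = 0})" using insert.hyps nz poly_roots_finite by blast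
  then obtain c where "c \<notin> (\<Union>s\<in>insert t Ts. {c. poly (p s) c = 0})"
    using inf by (metis UNIV_I finite_subset subsetI)
  then have "\<forall>s\<in>insert t Ts. eval_tm id id (l c) s \<noteq> 0" using p by auto
  then show ?case by blast
qed auto

text \<open>The type says that no nonzero term over \<open>B\<close> vanishes at the derivatives of
  \<open>y\<close>; a finite part is reduced to one term by taking the product. \<open>B\<close> may
  be as large as \<open>F\<close>, so it can contain \<open>F\<close> together with all derivatives
  of further elements.\<close>

lemma exists_differentially_transcendental:
  fixes d :: "'a::field_char_0 \<Rightarrow> 'a" and e :: "'a \<Rightarrow> 'c::field"
  assumes dc: "diff_closed d" and E: "K_elem_ext d e ds" and sat: "K_saturated (UNIV :: 'a set) ds"
    and inf: "infinite (UNIV :: 'c set)" and B: "(card_of B, card_of (UNIV :: 'a set)) \<in> ordLeq"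
  shows "\<exists>y. \<forall>k. (ds ^^ k) y \<notin> acl (B \<union> (\<lambda>j. (ds ^^ j) y) ` {..<k})"
proof -
  let ?good = "\<lambda>t. nodev_tm t \<and> params_tm t \<subseteq> B \<and> (\<exists>u. eval_tm id id u t \<noteq> 0)"
  let ?jet = "tsub (\<lambda>i. (Der ^^ i) (Var 0)) Par"
  define \<Phi> where "\<Phi> = (\<lambda>t. Not (Eq (?jet t) Zero)) ` {t. ?good t}"
  have jet: "eval_tm ds id v (?jet t) = eval_tm id id (\<lambda>i. (ds ^^ i) (v 0)) t" if "nodev_tm t" for v t
    unfolding eval_tsub by (subst eval_tm_nodev[OF that, of ds _ _ id], rule eval_tm_cong) (auto simp: eval_Der_pow)
  have "\<exists>v. \<forall>\<phi>\<in>\<Phi>. sat ds {} id v \<phi>"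
  proof (rule sat[unfolded K_saturated_def, rule_format])
    show "diff_fm \<phi> \<and> fv \<phi> \<subseteq> {0}" if "\<phi> \<in> \<Phi>" for \<phi> using that unfolding \<Phi>_def by (auto simp: fv_tsub split: if_splits)
    have "(\<Union>\<phi>\<in>\<Phi>. params \<phi>) \<subseteq> B" unfolding \<Phi>_def by (auto simp: params_tsub)
    then show "(card_of (\<Union>\<phi>\<in>\<Phi>. params \<phi>), card_of (UNIV :: 'a set)) \<in> ordLeq"
      using card_of_mono1 B ordLeq_transitive by blast
    fix \<Psi> assume "\<Psi> \<subseteq> \<Phi>" "finite \<Psi>"
    then obtain Ts where Ts: "Ts \<subseteq> {t. ?good t}" "finite Ts" "\<Psi> = (\<lambda>t. Not (Eq (?jet t) Zero)) ` Ts"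
      unfolding \<Phi>_def by (meson finite_subset_image)
    obtain u where u: "\<forall>t\<in>Ts. eval_tm id id u t \<noteq> 0" using common_nonroot[OF inf Ts(2)] Ts(1) by blast
    obtain ts where ts: "set ts = Ts" using finite_list[OF Ts(2)] by blast
    define q where "q = foldr Mul ts One"
    have ev: "eval_tm id id w q \<noteq> 0 \<longleftrightarrow> (\<forall>t\<in>Ts. eval_tm id id w t \<noteq> 0)" for w
      unfolding q_def ts[symmetric] by (induction ts) auto
    have "nodev_tm q" unfolding q_def using Ts(1) unfolding ts[symmetric] by (induction ts) auto
    then obtain x where "eval_tm id id (\<lambda>i. (ds ^^ i) x) q \<noteq> 0" using K_elem_ext_jets[OF dc E, of q u] u ev by blast
    then have "\<forall>t\<in>Ts. eval_tm id id (\<lambda>i. (ds ^^ i) x) t \<noteq> 0" unfolding ev .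
    then show "\<exists>v. \<forall>\<phi>\<in>\<Psi>. sat ds {} id v \<phi>" unfolding Ts(3) using Ts(1) jet[of _ "\<lambda>_. x"]
      by (intro exI[of _ "\<lambda>_. x"]) auto
  qed
  then obtain v where v: "\<And>t. ?good t \<Longrightarrow> sat ds {} id v (Not (Eq (?jet t) Zero))" unfolding \<Phi>_def by blast
  define y where "y = v 0"
  have y: "eval_tm id id (\<lambda>i. (ds ^^ i) y) t \<noteq> 0" if "?good t" for t
    using v[OF that] jet[of t v] that unfolding y_def by simp
  have "(ds ^^ k) y \<notin> acl (B \<union> (\<lambda>j. (ds ^^ j) y) ` {..<k})" for k
  proof
    assume "(ds ^^ k) y \<in> acl (B \<union> (\<lambda>j. (ds ^^ j) y) ` {..<k})"
    from acl_term[OF inf this] obtain t u where t: "nodev_tm t" "params_tm t \<subseteq> B \<union> (\<lambda>j. (ds ^^ j) y) ` {..<k}"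
      "fv_tm t \<subseteq> {0}" "eval_tm id id (\<lambda>_. (ds ^^ k) y) t = 0" "eval_tm id id (\<lambda>_. u) t \<noteq> 0" by blast
    have "\<forall>p\<in>params_tm t - B. \<exists>j<k. p = (ds ^^ j) y" using t(2) by auto
    then obtain j where j: "\<And>p. p \<in> params_tm t - B \<Longrightarrow> j p < k \<and> p = (ds ^^ j p) y" by metis
    \<comment> \<open>Earlier derivatives occurring as parameters are replaced by their variables,
      and the unknown by variable \<open>k\<close>; the result is a term over \<open>B\<close>
      excluded by the type.\<close>
    define s where "s = tsub (\<lambda>_. Var k) (\<lambda>p. if p \<in> B then Par p else Var (j p)) t"
    have ev: "eval_tm id id (w(k := c)) s = eval_tm id id (\<lambda>_. c) t" if "w = (\<lambda>i. (ds ^^ i) y)" for w c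
      unfolding s_def eval_tsub
    proof (rule eval_tm_cong)
      fix p assume p: "p \<in> params_tm t"
      then show "eval_tm id id (w(k := c)) (if p \<in> B then Par p else Var (j p)) = id p"
        using j[of p] that by (cases "p \<in> B") (auto dest: sym)
    qed simp
    have "eval_tm id id (\<lambda>i. (ds ^^ i) y) s = 0"
      using ev[OF refl, of "(ds ^^ k) y"] t(4) by (metis fun_upd_triv)
    moreover have "?good s"
    proof (intro conjI exI)
      show "nodev_tm s" unfolding s_def using t by (auto intro!: nodev_tsub)
      show "params_tm s \<subseteq> B" unfolding s_def by (auto simp: params_tsub split: if_splits)
      show "eval_tm id id ((\<lambda>i. (ds ^^ i) y)(k := u)) s \<noteq> 0" unfolding ev[OF refl] by (rule t)
    qed
    ultimately show False using y by blast
  qed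
  then show ?thesis by blast
qed

text \<open>Some \<open>c0\<close> in \<open>c\<close> can be exchanged for \<open>z 0\<close>.
  Moving \<open>z 0\<close> into the base leaves the shifted sequence independent over it and one
  element fewer in \<open>c\<close>.\<close>

lemma steinitz_sequence:
  assumes "finite c" "\<And>k. z k \<notin> acl (B \<union> z ` {..<(k::nat)})"
  shows "\<exists>k. z k \<notin> acl (B \<union> c)"
  using assms
proof (induction "card c" arbitrary: c B z)
  case 0
  then have "c = {}" by simp
  then show ?case using "0.prems"(2)[of 0] by auto
next
  case (Suc n)
  show ?case
  proof (rule ccontr)
    assume "\<nexists>k. z k \<notin> acl (B \<union> c)"
    then have zc: "z k \<in> acl (B \<union> c)" for k by blast
    \<comment> \<open>When the elements of \<open>S\<close> are added one by one, \<open>c0\<close>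
      is the one at which \<open>z 0\<close> becomes algebraic.\<close>
    have "\<exists>c0\<in>S. \<exists>S'\<subseteq>S - {c0}. z 0 \<in> acl (insert c0 (B \<union> S')) \<and> z 0 \<notin> acl (B \<union> S')"
      if "finite S" "z 0 \<in> acl (B \<union> S)" for S
      using that
    proof (induction S rule: finite_induct)
      case empty then show ?case using Suc.prems(2)[of 0] by simp
    next
      case (insert a S)
      show ?case
      proof (cases "z 0 \<in> acl (B \<union> S)")
        case True
        then obtain c0 S' where "c0 \<in> S" "S' \<subseteq> S - {c0}" "z 0 \<in> acl (insert c0 (B \<union> S'))" "z 0 \<notin> acl (B \<union> S')" using insert.IH by blast
        then show ?thesis by (intro bexI[of _ c0] exI[of _ S']) auto
      next
        case False
        then show ?thesis using insert by (intro bexI[of _ a] exI[of _ S]) auto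
      qed
    qed
    from this[OF Suc.prems(1) zc] obtain c0 S' where c0: "c0 \<in> c" "S' \<subseteq> c - {c0}" "z 0 \<in> acl (insert c0 (B \<union> S'))" "z 0 \<notin> acl (B \<union> S')" by blast
    have "c0 \<in> acl (insert (z 0) (B \<union> S'))" by (rule acl_exchange[OF c0(3,4)])
    then have c0': "c0 \<in> acl (insert (z 0) B \<union> (c - {c0}))"
      using acl_mono[of "insert (z 0) (B \<union> S')" "insert (z 0) B \<union> (c - {c0})"] c0(2) by auto
    have "\<exists>k. z (Suc k) \<notin> acl (insert (z 0) B \<union> (c - {c0}))"
    proof (rule Suc.hyps(1)[of "c - {c0}" "\<lambda>k. z (Suc k)" "insert (z 0) B"])
      show "n = card (c - {c0})" "finite (c - {c0})" using Suc.hyps(2) Suc.prems(1) c0(1) by auto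
      fix k
      have "insert (z 0) B \<union> (\<lambda>k. z (Suc k)) ` {..<k} = B \<union> z ` {..<Suc k}"
        by (auto simp: lessThan_Suc_eq_insert_0)
      then show "z (Suc k) \<notin> acl (insert (z 0) B \<union> (\<lambda>k. z (Suc k)) ` {..<k})" using Suc.prems(2)[of "Suc k"] by simp
    qed
    then obtain k where k: "z (Suc k) \<notin> acl (insert (z 0) B \<union> (c - {c0}))" by blast
    have "B \<union> c \<subseteq> acl (insert (z 0) B \<union> (c - {c0}))" using acl_superset[of "insert (z 0) B \<union> (c - {c0})"] c0' by blast
    from acl_least[OF this] zc[of "Suc k"] k show False by blast
  qed
qed

lemma differentially_transcendental_generic:
  fixes \<delta> :: "'c::field \<Rightarrow> 'c"
  assumes d: "is_derivation \<delta>" and ch: "\<And>n. n > 0 \<Longrightarrow> (of_nat n :: 'c) \<noteq> 0" and B: "\<delta> ` B \<subseteq> B"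
    and y: "\<And>k. (\<delta> ^^ k) y \<notin> acl (B \<union> (\<lambda>j. (\<delta> ^^ j) y) ` {..<k})"
  shows "y \<notin> acl (B \<union> {x. \<delta> x = 0})"
proof
  assume "y \<in> acl (B \<union> {x. \<delta> x = 0})"
  from acl_finite_Un[OF this] obtain c where c: "finite c" "c \<subseteq> {x. \<delta> x = 0}" "y \<in> acl (B \<union> c)" by blast
  note A = subfldD[OF subfld_acl[of "B \<union> c"]]
  have "\<delta> ` (B \<union> c) \<subseteq> acl (B \<union> c)" using B c(2) A(1) acl_superset[of "B \<union> c"] by auto
  then have closed: "\<delta> x \<in> acl (B \<union> c)" if "x \<in> acl (B \<union> c)" for x
    using A that by (intro acl_derivation_closed[OF d ch]) auto
  have "(\<delta> ^^ k) y \<in> acl (B \<union> c)" for k by (induction k) (auto intro: closed c(3))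
  then show False using steinitz_sequence[OF c(1) y] by blast
qed

text \<open>Symmetry of independence: as each \<open>z k\<close> is transcendental over
  \<open>a\<close> and its predecessors, exchange forbids \<open>a\<close> to become algebraic at
  any finite stage, and algebraicity involves only finitely many terms of the sequence.\<close>

lemma acl_extend_independent:
  assumes a: "a \<notin> acl D" and z: "\<And>k. z k \<notin> acl (insert a D \<union> z ` {..<(k::nat)})"
  shows "a \<notin> acl (D \<union> range z)"
proof -
  have step: "a \<notin> acl (D \<union> z ` {..<k})" for k
  proof (induction k)
    case 0 then show ?case using a by simp
  next
    case (Suc k)
    show ?case
    proof
      assume "a \<in> acl (D \<union> z ` {..<Suc k})"
      then have "a \<in> acl (insert (z k) (D \<union> z ` {..<k}))" by (simp add: lessThan_Suc)
      from acl_exchange[OF this Suc] show False using z[of k] by simp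
    qed
  qed
  show ?thesis
  proof
    assume "a \<in> acl (D \<union> range z)"
    from acl_finite_Un[OF this] obtain S where S: "finite S" "S \<subseteq> range z" "a \<in> acl (D \<union> S)" by blast
    then obtain K where K: "finite K" "S = z ` K" by (meson finite_subset_image)
    then obtain k where "K \<subseteq> {..<k}" by (meson finite_nat_iff_bounded)
    then have "D \<union> S \<subseteq> D \<union> z ` {..<k}" using K by auto
    from acl_mono[OF this] S(3) step[of k] show False by blast
  qed
qed

section \<open>Comparison of the dimensions\<close>

lemma good_pairI:
  fixes e :: "'a::field_char_0 \<Rightarrow> 'b::field"
  assumes E: "pair_elem_ext C e P" and ac: "alg_closed_field TYPE('a)" and C: "acl C = C"
    and sat: "pair_saturated (UNIV :: 'a set) P" and L: "large P"
  shows "good_pair C e P"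
proof -
  have sC: "subfld C" using subfld_acl[of C] C by simp
  show ?thesis unfolding good_pair_def
    using pair_elem_ext_alg_closed[OF E ac] pair_elem_ext_hom[OF E] acl_range_alg_closed[OF E ac]
      pair_elem_ext_acl[OF E C] free_from_range[OF E C] exists_transcendental_constant[OF E sC sat]
      exists_generic[OF E sC sat _ L] by simp
qed

lemma K_elem_ext_derivation:
  assumes d: "is_derivation d" and E: "K_elem_ext d e ds"
  shows "is_derivation ds" "ds (e a) = e (d a)"
proof -
  let ?a = "Eq (Der (Add (Var 0) (Var 1))) (Add (Der (Var 0)) (Der (Var 1)))"
  let ?m = "Eq (Der (Mul (Var 0) (Var 1))) (Add (Mul (Var 0) (Der (Var 1))) (Mul (Der (Var 0)) (Var 1)))"
  have "\<forall>v. sat d {} id v ?a" "\<forall>v. sat d {} id v ?m" using d by (simp_all add: is_derivation_def)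
  then have *: "\<forall>v. sat ds {} e v ?a" "\<forall>v. sat ds {} e v ?m"
    using K_transfer[OF E, of ?a] K_transfer[OF E, of ?m] by simp_all
  show "is_derivation ds" unfolding is_derivation_def
  proof (intro allI conjI)
    fix x y
    show "ds (x + y) = ds x + ds y" using *(1)[rule_format, of "(\<lambda>_. y)(0 := x)"] by simp
    show "ds (x * y) = x * ds y + ds x * y" using *(2)[rule_format, of "(\<lambda>_. y)(0 := x)"] by simp
  qed
  have "\<forall>v. sat ds {} e v (Eq (Der (Par a)) (Par (d a)))"
    using K_transfer[OF E, of "Eq (Der (Par a)) (Par (d a))"] by simp
  then show "ds (e a) = e (d a)" by simp
qed

text \<open>Earlier elements remain independent when a generic \<open>y\<close> is added; otherwise
  exchange would make \<open>y\<close> algebraic over them, \<open>range e\<close> and the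
  constants.\<close>

lemma exists_clF_independent:
  assumes ex: "\<And>T. finite T \<Longrightarrow> \<exists>y. y \<notin> acl (range e \<union> T \<union> P)" and I: "finite I"
  shows "\<exists>w. \<forall>i\<in>I. w i \<notin> clF e P (w ` (I - {i}))"
  using I
proof (induction I rule: finite_induct)
  case (insert i I)
  then obtain w where w: "\<forall>i\<in>I. w i \<notin> clF e P (w ` (I - {i}))" by blast
  obtain y where y: "y \<notin> acl (range e \<union> w ` I \<union> P)" using ex[of "w ` I"] insert.hyps(1) by auto
  define w' where "w' = w(i := y)"
  have im: "w' ` J = w ` J" if "J \<subseteq> I" for J using that insert.hyps(2) unfolding w'_def by (intro image_cong) auto
  have "w' j \<notin> clF e P (w' ` (insert i I - {j}))" if "j \<in> insert i I" for j
  proof (cases "j = i")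
    case True
    then have "insert i I - {j} = I" using insert.hyps(2) by auto
    then show ?thesis using y True im[of I] unfolding clF_def by (simp add: w'_def Un_commute Un_left_commute)
  next
    case False
    then have j: "j \<in> I" using that by simp
    have "insert i I - {j} = insert i (I - {j})" using False by auto
    moreover have "w' i = y" by (simp add: w'_def)
    ultimately have *: "w' ` (insert i I - {j}) = insert y (w ` (I - {j}))" using im[of "I - {j}"] by auto
    have wj: "w' j = w j" unfolding w'_def using False by (rule fun_upd_other)
    show ?thesis
    proof
      assume "w' j \<in> clF e P (w' ` (insert i I - {j}))"
      then have "w j \<in> acl (insert y (w ` (I - {j}) \<union> range e \<union> P))" unfolding * wj clF_def by simp
      moreover have "w j \<notin> acl (w ` (I - {j}) \<union> range e \<union> P)" using w j unfolding clF_def by blast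
      ultimately have "y \<in> acl (insert (w j) (w ` (I - {j}) \<union> range e \<union> P))" by (rule acl_exchange)
      moreover have "insert (w j) (w ` (I - {j}) \<union> range e \<union> P) \<subseteq> range e \<union> w ` I \<union> P" using j by auto
      ultimately show False using notin_acl_mono[OF y] by metis
    qed
  qed
  then show ?case by blast
qed auto

text \<open>Each coordinate is chosen differentially transcendental over all derivatives of the
  earlier ones. \<open>alg_indep_over\<close> compares every derivative with all others, later ones
  included, so this sequential independence is made symmetric by
  \<open>acl_extend_independent\<close>.\<close>

lemma exists_differentially_independent:
  fixes d :: "'a::field_char_0 \<Rightarrow> 'a" and e :: "'a \<Rightarrow> 'c::field" and I :: "nat set"
  assumes dc: "diff_closed d" and E: "K_elem_ext d e ds" and sat: "K_saturated (UNIV :: 'a set) ds"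
    and inf: "infinite (UNIV :: 'c set)" and I: "finite I"
  shows "\<exists>b. alg_indep_over e (I \<times> (UNIV :: nat set)) (\<lambda>(i, k). (ds ^^ k) (b i))"
  using I
proof (induction I rule: finite_induct)
  case empty then show ?case unfolding alg_indep_over_def by auto
next
  case (insert i I)
  then obtain b where b: "alg_indep_over e (I \<times> (UNIV :: nat set)) (\<lambda>(i, k). (ds ^^ k) (b i))" by blast
  define x where "x = (\<lambda>(i, k). (ds ^^ k) (b i))"
  define D where "D = range e \<union> x ` (I \<times> UNIV)"
  \<comment> \<open>Only countably many elements are added to \<open>F\<close>, so the base does not
    exceed the number of parameters allowed by saturation.\<close>
  have "countable (x ` (I \<times> UNIV))" using insert.hyps(1) by (intro countable_image countable_SIGMA) (auto intro: countable_finite)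
  then have "(card_of D, card_of (UNIV :: 'a set)) \<in> ordLeq" unfolding D_def by (rule card_range_Un[OF countable_card_le]) auto
  from exists_differentially_transcendental[OF dc E sat inf this] obtain y where
    y: "\<And>k. (ds ^^ k) y \<notin> acl (D \<union> (\<lambda>j. (ds ^^ j) y) ` {..<k})" by blast
  define z where "z k = (ds ^^ k) y" for k
  have zD: "z k \<notin> acl (D \<union> z ` {..<k})" for k using y[of k] unfolding z_def .
  define x' where "x' = (\<lambda>(j, k). (ds ^^ k) ((b(i := y)) j))"
  have x'1: "x' (j, k) = x (j, k)" if "j \<in> I" for j k using that insert.hyps(2) unfolding x'_def x_def by auto
  have x'2: "x' (i, k) = z k" for k unfolding x'_def z_def by simp
  have "x' q \<notin> acl (range e \<union> x' ` (insert i I \<times> UNIV - {q}))" if q: "q \<in> insert i I \<times> UNIV" for q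
  proof -
    obtain j k where jk: "q = (j, k)" by force
    show ?thesis
    proof (cases "j = i")
      case False
      then have j: "j \<in> I" using q jk by simp
      let ?D = "range e \<union> x ` (I \<times> UNIV - {q})"
      have "x q \<notin> acl (?D \<union> range z)"
      proof (rule acl_extend_independent)
        show "x q \<notin> acl ?D" using b j jk unfolding alg_indep_over_def x_def[symmetric] by auto
        have "insert (x q) ?D \<subseteq> D" unfolding D_def using j jk by auto
        then have "insert (x q) ?D \<union> z ` {..<l} \<subseteq> D \<union> z ` {..<l}" for l by auto
        then show "z l \<notin> acl (insert (x q) ?D \<union> z ` {..<l})" for l by (rule notin_acl_mono[OF zD])
      qed
      moreover have "range e \<union> x' ` (insert i I \<times> UNIV - {q}) \<subseteq> ?D \<union> range z"
      proof -
        have "x' (a, c) \<in> ?D \<union> range z" if "a \<in> insert i I" "(a, c) \<noteq> q" for a c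
          using that x'1[of a c] x'2[of c] by (cases "a = i") auto
        then show ?thesis by auto
      qed
      ultimately have "x q \<notin> acl (range e \<union> x' ` (insert i I \<times> UNIV - {q}))" by (rule notin_acl_mono)
      moreover have "x' q = x q" unfolding jk by (rule x'1[OF j])
      ultimately show ?thesis by simp
    next
      case True
      \<comment> \<open>Derivatives of \<open>y\<close> of order below \<open>k\<close> join the
        base; those above \<open>k\<close> are adjoined as an independent sequence.\<close>
      let ?D = "D \<union> z ` {..<k}"
      have "z k \<notin> acl (?D \<union> range (\<lambda>l. z (Suc k + l)))"
      proof (rule acl_extend_independent[OF zD])
        fix l
        have "insert (z k) ?D \<union> (\<lambda>l. z (Suc k + l)) ` {..<l} \<subseteq> D \<union> z ` {..<Suc k + l}" by auto
        then show "z (Suc k + l) \<notin> acl (insert (z k) ?D \<union> (\<lambda>l. z (Suc k + l)) ` {..<l})" by (rule notin_acl_mono[OF zD])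
      qed
      moreover have "range e \<union> x' ` (insert i I \<times> UNIV - {q}) \<subseteq> ?D \<union> range (\<lambda>l. z (Suc k + l))"
      proof -
        have "x' (a, c) \<in> ?D \<union> range (\<lambda>l. z (Suc k + l))" if ac: "a \<in> insert i I" "(a, c) \<noteq> q" for a c
        proof (cases "a = i")
          case False
          then show ?thesis using ac x'1[of a c] unfolding D_def by auto
        next
          case ai: True
          then have "c \<noteq> k" using ac True jk by auto
          then have "c < k \<or> c = Suc k + (c - Suc k)" by auto
          then show ?thesis using x'2[of c] ai by (metis UnI1 UnI2 imageI lessThan_iff rangeI)
        qed
        moreover have "range e \<subseteq> ?D" unfolding D_def by auto
        ultimately show ?thesis by auto
      qed
      ultimately have "z k \<notin> acl (range e \<union> x' ` (insert i I \<times> UNIV - {q}))" by (rule notin_acl_mono)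
      moreover have "x' q = z k" unfolding jk True by (rule x'2)
      ultimately show ?thesis by simp
    qed
  qed
  then have "alg_indep_over e (insert i I \<times> UNIV) x'" unfolding alg_indep_over_def by blast
  then show ?case unfolding x'_def by blast
qed

text \<open>The base is \<open>F\<close> with all derivatives of the other coordinates: it is stable
  under \<open>ds\<close>, contains these coordinates, and the hypothesis makes the derivatives of
  \<open>b i\<close> independent over it.\<close>

lemma differentially_independent_clF:
  fixes d :: "'a::field_char_0 \<Rightarrow> 'a" and e :: "'a \<Rightarrow> 'c::field" and I :: "nat set"
  assumes d: "is_derivation d" and E: "K_elem_ext d e ds"
    and b: "alg_indep_over e (I \<times> (UNIV :: nat set)) (\<lambda>(i, k). (ds ^^ k) (b i))" and i: "i \<in> I"
  shows "b i \<notin> clF e {x. ds x = 0} (b ` (I - {i}))"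
proof -
  define x where "x = (\<lambda>(i, k). (ds ^^ k) (b i))"
  define B where "B = range e \<union> x ` ((I - {i}) \<times> UNIV)"
  note D = K_elem_ext_derivation[OF d E]
  have ch: "(of_nat n :: 'c) \<noteq> 0" if "n > 0" for n
    using pair_elem_ext_of_nat(2)[OF K_reduct_elem_ext[OF E], of n 0] that by simp
  have "ds (x (j, k)) = x (j, Suc k)" for j k unfolding x_def by simp
  then have B: "ds ` B \<subseteq> B" unfolding B_def by (auto simp: D(2))
  have "b i \<notin> acl (B \<union> {x. ds x = 0})"
  proof (rule differentially_transcendental_generic[OF D(1) ch B])
    fix k
    have "B \<union> (\<lambda>j. (ds ^^ j) (b i)) ` {..<k} \<subseteq> range e \<union> x ` (I \<times> UNIV - {(i, k)})"
      unfolding B_def x_def using i by force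
    moreover have "(ds ^^ k) (b i) \<notin> acl (range e \<union> x ` (I \<times> UNIV - {(i, k)}))"
      using b i unfolding alg_indep_over_def x_def by fastforce
    ultimately show "(ds ^^ k) (b i) \<notin> acl (B \<union> (\<lambda>j. (ds ^^ j) (b i)) ` {..<k})" by (rule notin_acl_mono[rotated])
  qed simp
  moreover have "b j \<in> B" if "j \<in> I - {i}" for j
  proof -
    have "b j = x (j, 0)" unfolding x_def by simp
    then show ?thesis using that unfolding B_def by blast
  qed
  then have "b ` (I - {i}) \<union> range e \<union> {x. ds x = 0} \<subseteq> B \<union> {x. ds x = 0}" unfolding B_def by auto
  ultimately show ?thesis unfolding clF_def by (rule notin_acl_mono)
qed

text \<open>\<open>Y\<close> may be infinite; the common bound \<open>n\<close> keeps both maxima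
  over finite sets. The inner maximum is removed so that only the set of realized values
  matters.\<close>

lemma Max_image_Max:
  fixes A :: "'i \<Rightarrow> nat set"
  assumes "Y \<noteq> {}" "\<And>y. y \<in> Y \<Longrightarrow> A y \<noteq> {}" "\<And>y. y \<in> Y \<Longrightarrow> A y \<subseteq> {..n}"
  shows "Max ((\<lambda>y. Max (A y)) ` Y) = Max (\<Union>y\<in>Y. A y)"
proof -
  have fin: "finite (A y)" if "y \<in> Y" for y using assms(3)[OF that] finite_subset by blast
  have U: "finite (\<Union>y\<in>Y. A y)" by (rule finite_subset[of _ "{..n}"]) (use assms in auto)
  have M: "Max (A y) \<in> A y" if "y \<in> Y" for y using Max_in[OF fin] assms(2) that by blast
  have fM: "finite ((\<lambda>y. Max (A y)) ` Y)" by (rule finite_subset[OF _ U]) (use M in auto)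
  show ?thesis
  proof (rule antisym)
    show "Max ((\<lambda>y. Max (A y)) ` Y) \<le> Max (\<Union>y\<in>Y. A y)"
      by (rule Max.boundedI[OF fM]) (use assms(1) M U in \<open>auto intro!: Max_ge\<close>)
    show "Max (\<Union>y\<in>Y. A y) \<le> Max ((\<lambda>y. Max (A y)) ` Y)"
    proof (rule Max.boundedI[OF U])
      show "(\<Union>y\<in>Y. A y) \<noteq> {}" using assms by auto
      fix a assume "a \<in> (\<Union>y\<in>Y. A y)"
      then obtain y where y: "y \<in> Y" "a \<in> A y" by blast
      have "a \<le> Max (A y)" using Max_ge[OF fin] y by blast
      also have "\<dots> \<le> Max ((\<lambda>y. Max (A y)) ` Y)" using Max_ge[OF fM] y by blast
      finally show "a \<le> Max ((\<lambda>y. Max (A y)) ` Y)" .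
    qed
  qed
qed

section \<open>Equality of the two dimensions\<close>

theorem theorem5p1:
  fixes d :: "'a::field_char_0 \<Rightarrow> 'a"
    and n :: nat and X :: "'a list set"
    and e1 :: "'a \<Rightarrow> 'b::field" and Cs :: "'b set"
    and e2 :: "'a \<Rightarrow> 'c::field" and ds :: "'c \<Rightarrow> 'c"
  assumes "is_derivation d"
    and "alg_closed_field TYPE('a)"
    and "diff_closed d"
    and "definable_pair {x. d x = 0} n X"
    and "pair_elem_ext {x. d x = 0} e1 Cs"
    and "pair_saturated (UNIV :: 'a set) Cs"
    and "K_elem_ext d e2 ds"
    and "K_saturated (UNIV :: 'a set) ds"
  shows "dim2 {x. d x = 0} e1 Cs n X = delta_dim d e2 ds n X"
proof (cases "X = {}")
  case True
  then show ?thesis unfolding dim2_def delta_dim_def by simp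
next
  case False
  note d = assms(1) and ac = assms(2) and dc = assms(3) and E1 = assms(5) and sat1 = assms(6) and K = assms(7) and satK = assms(8)
  define C where "C = {x. d x = 0}"
  define P2 where "P2 = {x. ds x = 0}"
  have E1: "pair_elem_ext C e1 Cs" using E1 unfolding C_def .
  have E2: "pair_elem_ext C e2 P2" unfolding C_def P2_def by (rule K_reduct_elem_ext[OF K])
  have sat2: "pair_saturated (UNIV :: 'a set) P2" unfolding P2_def by (rule K_reduct_saturated[OF satK])
  have C: "acl C = C" unfolding C_def by (rule acl_constants[OF d]) simp
  have sC: "subfld C" using subfld_acl[of C] C by simp
  note inf = pair_elem_ext_infinite(2)[OF E2 sC]
  note D = K_elem_ext_derivation[OF d K]
  have ch: "(of_nat m :: 'c) \<noteq> 0" if "m > 0" for m using pair_elem_ext_of_nat(2)[OF E2, of m 0] that by simp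
  have "\<exists>y. y \<notin> acl (range e2 \<union> T \<union> P2)" if T: "finite T" for T
  proof -
    \<comment> \<open>\<open>T\<close> is enlarged by all its derivatives, because the base in
      \<open>differentially_transcendental_generic\<close> has to be stable under
      \<open>ds\<close>.\<close>
    define B where "B = range e2 \<union> (\<lambda>(t, k). (ds ^^ k) t) ` (T \<times> UNIV)"
    have "countable ((\<lambda>(t, k). (ds ^^ k) t) ` (T \<times> (UNIV :: nat set)))" using T by (intro countable_image countable_SIGMA) (auto intro: countable_finite)
    then have "(card_of B, card_of (UNIV :: 'a set)) \<in> ordLeq" unfolding B_def by (rule card_range_Un[OF countable_card_le]) auto
    from exists_differentially_transcendental[OF dc K satK inf this] obtain y where
      y: "\<And>k. (ds ^^ k) y \<notin> acl (B \<union> (\<lambda>j. (ds ^^ j) y) ` {..<k})" by blast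
    have "ds ((ds ^^ k) t) \<in> B" if "t \<in> T" for t k
      unfolding B_def using that by (intro UnI2 image_eqI[of _ _ "(t, Suc k)"]) auto
    then have "ds ` B \<subseteq> B" unfolding B_def by (auto simp: D(2))
    from differentially_transcendental_generic[OF D(1) ch this y] have "y \<notin> acl (B \<union> P2)" unfolding P2_def by simp
    moreover have "t \<in> B" if "t \<in> T" for t unfolding B_def using that by (auto intro!: image_eqI[of _ _ "(t, 0)"])
    then have "range e2 \<union> T \<union> P2 \<subseteq> B \<union> P2" unfolding B_def by auto
    ultimately have "y \<notin> acl (range e2 \<union> T \<union> P2)" by (rule notin_acl_mono)
    then show ?thesis by blast
  qed
  then have L2: "large P2" by (rule largeI)
  have "0 \<in> P2" using pair_elem_ext_subfld[OF E2 sC] by (rule subfldD)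
  then have L1: "large Cs" by (rule large_transfer[OF E1 E2 _ L2])
  have g1: "good_pair C e1 Cs" by (rule good_pairI[OF E1 ac C sat1 L1])
  have g2: "good_pair C e2 P2" by (rule good_pairI[OF E2 ac C sat2 L2])

  \<comment> \<open>\<open>\<phi>\<close> and \<open>\<psi>\<close> are the formulas picked by
    \<open>dim2\<close> and \<open>delta_dim\<close>, independently of each other. Both define
    \<open>X\<close> over \<open>F\<close>, and elementarity extends their equivalence to the
    extension of the differential field (\<open>eq2\<close>).\<close>
  define \<phi> where "\<phi> = (SOME \<phi>. defines_pair C n \<phi> X)"
  have \<phi>: "defines_pair C n \<phi> X" using assms(4) unfolding definable_pair_def \<phi>_def C_def by (rule someI_ex)
  then have \<phi>1: "pair_fm \<phi>" "fv \<phi> \<subseteq> {..<n}" "X = {xs. length xs = n \<and> sat id C id (\<lambda>i. xs ! i) \<phi>}" unfolding defines_pair_def by auto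
  have "defines_K d n (elim_Pc \<phi>) X" unfolding defines_K_def using \<phi>1 sat_elim_Pc[OF \<phi>1(1), of d id] unfolding C_def by simp
  define \<psi> where "\<psi> = (SOME \<phi>. defines_K d n \<phi> X)"
  have "defines_K d n \<psi> X" unfolding \<psi>_def by (rule someI) fact
  then have \<psi>1: "diff_fm \<psi>" "fv \<psi> \<subseteq> {..<n}" "X = {xs. length xs = n \<and> sat d {} id (\<lambda>i. xs ! i) \<psi>}" unfolding defines_K_def by auto
  have list: "sat D P par v \<chi> \<longleftrightarrow> sat D P par (\<lambda>i. map v [0..<n] ! i) \<chi>" if "fv \<chi> \<subseteq> {..<n}" for D P par \<chi> and v :: "nat \<Rightarrow> 'd::field"
    by (rule sat_cong) (use that in auto)
  have "map v [0..<n] \<in> X \<longleftrightarrow> sat id C id v \<phi>" for v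
    unfolding \<phi>1(3) list[OF \<phi>1(2), of id C id v] by simp
  moreover have "map v [0..<n] \<in> X \<longleftrightarrow> sat d {} id v \<psi>" for v
    unfolding \<psi>1(3) list[OF \<psi>1(2), of d "{}" id v] by simp
  ultimately have "sat d {} id v \<psi> \<longleftrightarrow> sat id C id v \<phi>" for v by blast
  then have eq: "sat d {} id v \<psi> \<longleftrightarrow> sat d {} id v (elim_Pc \<phi>)" for v
    using sat_elim_Pc[OF \<phi>1(1), of d id v] unfolding C_def by simp
  let ?i1 = "Not (Conj \<psi> (Not (elim_Pc \<phi>)))" and ?i2 = "Not (Conj (elim_Pc \<phi>) (Not \<psi>))"
  have "\<forall>v. sat d {} id v ?i1" "\<forall>v. sat d {} id v ?i2" using eq by auto
  then have "\<forall>v. sat ds {} e2 v ?i1" "\<forall>v. sat ds {} e2 v ?i2"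
    using K_transfer[OF K, of ?i1] K_transfer[OF K, of ?i2] \<psi>1(1) by auto
  then have eq2: "sat ds {} e2 v \<psi> \<longleftrightarrow> sat id P2 e2 v \<phi>" for v
    using sat_elim_Pc[OF \<phi>1(1), of ds e2 v] unfolding P2_def by auto

  define Y1 where "Y1 = {ys. length ys = n \<and> sat id Cs e1 (\<lambda>i. ys ! i) \<phi>}"
  define Y2 where "Y2 = {ys. length ys = n \<and> sat ds {} e2 (\<lambda>i. ys ! i) \<psi>}"
  define Q1 where "Q1 ys I \<longleftrightarrow> I \<subseteq> {..<n} \<and> (\<forall>i\<in>I. ys ! i \<notin> clF e1 Cs ((\<lambda>j. ys ! j) ` (I - {i})))" for ys :: "'b list" and I
  define Q2 where "Q2 ys I \<longleftrightarrow> I \<subseteq> {..<n} \<and> alg_indep_over e2 (I \<times> (UNIV :: nat set)) (\<lambda>(i, k). (ds ^^ k) (ys ! i))" for ys :: "'c list" and I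
  \<comment> \<open>The solution sets lie in unrelated structures and share only their index sets,
    so it is enough to compare which \<open>I\<close> are independent at some solution.\<close>
  have Q12: "(\<exists>ys\<in>Y1. Q1 ys I) \<longleftrightarrow> (\<exists>zs\<in>Y2. Q2 zs I)" for I
  proof
    assume "\<exists>ys\<in>Y1. Q1 ys I"
    then obtain ys where ys: "sat id Cs e1 (\<lambda>i. ys ! i) \<phi>" "I \<subseteq> {..<n}" "\<And>i. i \<in> I \<Longrightarrow> ys ! i \<notin> clF e1 Cs ((\<lambda>j. ys ! j) ` (I - {i}))"
      unfolding Y1_def Q1_def by blast
    have "finite I" using ys(2) finite_subset by blast
    from exists_differentially_independent[OF dc K satK inf this] obtain b where
      b: "alg_indep_over e2 (I \<times> (UNIV :: nat set)) (\<lambda>(i, k). (ds ^^ k) (b i))" by blast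
    have "b i \<notin> clF e2 P2 (b ` (I - {i}))" if "i \<in> I" for i
      unfolding P2_def by (rule differentially_independent_clF[OF d K b that])
    from generic_transfer[OF g1 g2 \<phi>1(1,2) _ ys(2,3) this ys(1)] obtain w where
      w: "\<forall>i\<in>I. w i = b i" "sat id P2 e2 w \<phi>" by auto
    define zs where "zs = map w [0..<n]"
    have "zs \<in> Y2" unfolding Y2_def eq2 zs_def using w(2) list[OF \<phi>1(2), of id P2 e2 w] by simp
    moreover have zb: "zs ! i = b i" if "i \<in> I" for i using that ys(2) w(1) unfolding zs_def by auto
    \<comment> \<open>Independence on \<open>I\<close> involves only coordinates in
      \<open>I\<close>, where \<open>zs\<close> and \<open>b\<close> agree.\<close>
    have "(\<lambda>(i, k). (ds ^^ k) (zs ! i)) ` J = (\<lambda>(i, k). (ds ^^ k) (b i)) ` J" if "J \<subseteq> I \<times> UNIV" for J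
      by (rule image_cong) (use that zb in auto)
    then have "Q2 zs I" using b ys(2) zb unfolding Q2_def alg_indep_over_def by auto
    ultimately show "\<exists>zs\<in>Y2. Q2 zs I" by blast
  next
    assume "\<exists>zs\<in>Y2. Q2 zs I"
    then obtain zs where zs: "sat id P2 e2 (\<lambda>i. zs ! i) \<phi>" "I \<subseteq> {..<n}"
      "alg_indep_over e2 (I \<times> (UNIV :: nat set)) (\<lambda>(i, k). (ds ^^ k) (zs ! i))"
      unfolding Y2_def Q2_def eq2 by blast
    have "finite I" using zs(2) finite_subset by blast
    from exists_clF_independent[OF good_pairD(11)[OF g1] this] obtain w where
      w: "\<And>i. i \<in> I \<Longrightarrow> w i \<notin> clF e1 Cs (w ` (I - {i}))" by blast
    have "zs ! i \<notin> clF e2 P2 ((\<lambda>j. zs ! j) ` (I - {i}))" if "i \<in> I" for i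
      unfolding P2_def by (rule differentially_independent_clF[OF d K zs(3) that])
    from generic_transfer[OF g2 g1 \<phi>1(1,2) _ zs(2) this w zs(1)] obtain v where
      v: "\<forall>i\<in>I. v i = w i" "sat id Cs e1 v \<phi>" by auto
    define ys where "ys = map v [0..<n]"
    have "ys \<in> Y1" unfolding Y1_def ys_def using v(2) list[OF \<phi>1(2), of id Cs e1 v] by simp
    moreover have yw: "ys ! i = w i" if "i \<in> I" for i using that zs(2) v(1) unfolding ys_def by auto
    have "(\<lambda>j. ys ! j) ` J = w ` J" if "J \<subseteq> I" for J
      by (rule image_cong) (use that yw in auto)
    then have "Q1 ys I" using w zs(2) yw unfolding Q1_def by auto
    ultimately show "\<exists>ys\<in>Y1. Q1 ys I" by blast
  qed
  have Q1e: "Q1 ys {}" "Q2 zs {}" for ys zs unfolding Q1_def Q2_def alg_indep_over_def by auto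
  \<comment> \<open>The image of a point of \<open>X\<close> under \<open>e1\<close> keeps the
    solution sets nonempty, as the maxima require.\<close>
  obtain xs where xs: "xs \<in> X" using False by blast
  define v where "v i = (xs ! i)" for i
  have "sat id C id v \<phi>" using xs unfolding \<phi>1(3) v_def by blast
  then have "sat id Cs e1 (e1 \<circ> v) \<phi>" using pair_elem_extD[OF E1 \<phi>1(1)] by blast
  then have "map (e1 \<circ> v) [0..<n] \<in> Y1" unfolding Y1_def using list[OF \<phi>1(2), of id Cs e1 "e1 \<circ> v"] by simp
  then have Y1: "Y1 \<noteq> {}" by blast
  then have Y2: "Y2 \<noteq> {}" using Q12[of "{}"] Q1e(1) by blast
  have card: "card I \<in> {..n}" if "I \<subseteq> {..<n}" for I using card_mono[OF _ that] by simp
  have "Max (clF_dim e1 Cs ` Y1) = Max ((\<lambda>ys. Max {card I | I. Q1 ys I}) ` Y1)"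
    by (rule arg_cong[where f = Max], rule image_cong) (auto simp: Y1_def clF_dim_def Q1_def)
  also have "\<dots> = Max (\<Union>ys\<in>Y1. {card I | I. Q1 ys I})"
    by (rule Max_image_Max[where n = n, OF Y1]) (use Q1e(1) card in \<open>auto simp: Q1_def\<close>)
  also have "(\<Union>ys\<in>Y1. {card I | I. Q1 ys I}) = {card I | I. \<exists>ys\<in>Y1. Q1 ys I}" by blast
  also have "\<dots> = {card I | I. \<exists>ys\<in>Y2. Q2 ys I}" unfolding Q12 ..
  also have "\<dots> = (\<Union>ys\<in>Y2. {card I | I. Q2 ys I})" by blast
  also have "Max \<dots> = Max ((\<lambda>ys. Max {card I | I. Q2 ys I}) ` Y2)"
    by (rule Max_image_Max[where n = n, OF Y2, symmetric]) (use Q1e(2) card in \<open>auto simp: Q2_def\<close>)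
  also have "\<dots> = Max (dtrdeg e2 ds ` Y2)"
    by (rule arg_cong[where f = Max], rule image_cong) (auto simp: Y2_def dtrdeg_def Q2_def)
  finally have "Max (clF_dim e1 Cs ` Y1) = Max (dtrdeg e2 ds ` Y2)" .
  then show ?thesis unfolding dim2_def delta_dim_def Let_def C_def[symmetric] \<phi>_def[symmetric] \<psi>_def[symmetric] Y1_def[symmetric] Y2_def[symmetric]
    using False by simp
qed

end
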